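(* (ZF) Let $\lambda$ be a cardinal. The following are equivalent: (1) $\lambda$ is $0$-proto Berkeley. (2) For every relation $(M,R)$ there is a cardinal $\mu<\lambda$ such that first-order logic is $\mu$-chain compact for relation type $(M,R)$.
   Context: The theory is ZF (no choice). Cardinals are well-ordered cardinals. A cardinal $\lambda$ is $\alpha$-proto Berkeley (for an ordinal $\alpha<\lambda$) if for every transitive set $M$ with $\lambda\in M$ there is an elementary embedding $j:(M,\in)\to(M,\in)$ with $\alpha<\mathrm{crit}(j)<\lambda$, where $\mathrm{crit}(j)$ is the least ordinal moved by $j$. Vocabularies are sets of finitary relation symbols, finitary function symbols and constant symbols, of arbitrary size. A relation is a pair $(M,R^M)$ with $M$ a set and $R^M\subseteq M^2$. For a vocabulary $\tau$ with a designated binary relation symbol $R$, a $\tau$-structure $A$ has relation type $(M,R^M)$ if $(A,R^A)\cong(M,R^M)$. For a cardinal $\mu$, a logic $\mathcal L$ is $\mu$-chain compact for relation type $(M,R)$ if for every $\mathcal L$-theory $T$ (set of $\mathcal L$-sentences in a vocabulary with a designated binary relation symbol) which can be written as an increasing union $T=\bigcup_{\beta<\mu}T_\beta$: if every $T_\beta$ has a model of relation type $(M,R)$, then $T$ has a model of relation type $(M,R)$.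
   Formalization: The cardinal μ in (2) is required to be infinite; for finite μ ≥ 1 an increasing union is its last member, so every logic is trivially μ-chain compact and (2) would hold for every λ > 1. *)

theory Defs
  imports Main
begin

text \<open>
  HOL proves the axiom of choice for its own sets, so a theorem of ZF without choice cannot be
  stated about HOL sets. It is stated here about an arbitrary first-order model of ZF: a type
  with a binary relation satisfying the usual axioms, Separation and Replacement being schemata
  over first-order formulas with parameters. (Replacement for arbitrary HOL functions would force
  choice to hold in the model.) By the completeness theorem, truth in all such models is
  provability in ZF.

  All set-theoretic and logical notions below are interpreted inside the model: every quantifier
  ranges over elements of the model. In particular natural numbers, finite sequences,
  formulas and satisfaction are those of the model, which need not be well-founded from outside.
\<close>

section \<open>Models of ZF\<close>

text \<open>Formulas of the language of set theory, used only to state the two axiom schemata.\<close>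

datatype fm = FMem nat nat | FEq nat nat | FNeg fm | FAnd fm fm | FAll nat fm

primrec fsat :: "('a \<Rightarrow> 'a \<Rightarrow> bool) \<Rightarrow> (nat \<Rightarrow> 'a) \<Rightarrow> fm \<Rightarrow> bool" where
  "fsat E s (FMem i j) \<longleftrightarrow> E (s i) (s j)"
| "fsat E s (FEq i j) \<longleftrightarrow> s i = s j"
| "fsat E s (FNeg p) \<longleftrightarrow> \<not> fsat E s p"
| "fsat E s (FAnd p q) \<longleftrightarrow> fsat E s p \<and> fsat E s q"
| "fsat E s (FAll i p) \<longleftrightarrow> (\<forall>x. fsat E (s(i := x)) p)"

class ZF =
  fixes mem :: "'a \<Rightarrow> 'a \<Rightarrow> bool"
  assumes extensionality: "(\<forall>z. mem z x \<longleftrightarrow> mem z y) \<Longrightarrow> x = y"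
    and foundation: "\<exists>x. mem x a \<Longrightarrow> \<exists>x. mem x a \<and> \<not> (\<exists>y. mem y x \<and> mem y a)"
    and pairing: "\<exists>c. \<forall>z. mem z c \<longleftrightarrow> z = x \<or> z = y"
    and union: "\<exists>c. \<forall>z. mem z c \<longleftrightarrow> (\<exists>y. mem y a \<and> mem z y)"
    and powerset: "\<exists>c. \<forall>z. mem z c \<longleftrightarrow> (\<forall>y. mem y z \<longrightarrow> mem y a)"
    and infinity: "\<exists>w. (\<exists>e. mem e w \<and> (\<forall>z. \<not> mem z e)) \<and>
          (\<forall>x. mem x w \<longrightarrow> (\<exists>y. mem y w \<and> (\<forall>z. mem z y \<longleftrightarrow> mem z x \<or> z = x)))"
    and separation: "\<exists>b. \<forall>x. mem x b \<longleftrightarrow> mem x a \<and> fsat mem (s(0 := x)) \<phi>"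
    and replacement:
      "(\<forall>x y z. mem x a \<and> fsat mem (s(0 := x, 1 := y)) \<phi> \<and> fsat mem (s(0 := x, 1 := z)) \<phi> \<longrightarrow> y = z)
       \<Longrightarrow> \<exists>b. \<forall>y. mem y b \<longleftrightarrow> (\<exists>x. mem x a \<and> fsat mem (s(0 := x, 1 := y)) \<phi>)"

section \<open>Basic set theory inside the model\<close>

abbreviation elts :: "'a::ZF \<Rightarrow> 'a set" where
  "elts a \<equiv> {x. mem x a}"

text \<open>
  The element of the model with the given extension. It is meaningful only if there is one; it
  is applied only to classes that are first-order definable and that ZF proves to be sets.
\<close>

definition vset :: "'a::ZF set \<Rightarrow> 'a" where
  "vset S = (THE b. elts b = S)"

definition vempty :: "'a::ZF" where
  "vempty = vset {}"

definition vpair :: "'a::ZF \<Rightarrow> 'a \<Rightarrow> 'a" ("\<langle>_,/ _\<rangle>") where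
  "\<langle>a, b\<rangle> = vset {vset {a}, vset {a, b}}"

definition vsucc :: "'a::ZF \<Rightarrow> 'a" where
  "vsucc a = vset (insert a (elts a))"

definition Transitive :: "'a::ZF \<Rightarrow> bool" where
  "Transitive a \<longleftrightarrow> (\<forall>x\<in>elts a. elts x \<subseteq> elts a)"

definition Ordinal :: "'a::ZF \<Rightarrow> bool" where
  "Ordinal a \<longleftrightarrow> Transitive a \<and> (\<forall>x\<in>elts a. Transitive x)"

definition Natural :: "'a::ZF \<Rightarrow> bool" where
  "Natural n \<longleftrightarrow> Ordinal n \<and> (\<forall>m\<in>elts (vsucc n). m = vempty \<or> (\<exists>k. m = vsucc k))"

definition omega :: "'a::ZF" where
  "omega = vset {n. Natural n}"

definition is_fun :: "'a::ZF \<Rightarrow> 'a \<Rightarrow> 'a \<Rightarrow> bool" where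
  "is_fun f A B \<longleftrightarrow> (\<forall>p\<in>elts f. \<exists>x\<in>elts A. \<exists>y\<in>elts B. p = \<langle>x, y\<rangle>) \<and>
     (\<forall>x\<in>elts A. \<exists>!y. \<langle>x, y\<rangle> \<in> elts f)"

definition app :: "'a::ZF \<Rightarrow> 'a \<Rightarrow> 'a" where
  "app f x = (THE y. \<langle>x, y\<rangle> \<in> elts f)"

definition vcomp :: "'a::ZF \<Rightarrow> 'a \<Rightarrow> 'a" where
  "vcomp g f = vset {p. \<exists>x y z. p = \<langle>x, z\<rangle> \<and> \<langle>x, y\<rangle> \<in> elts f \<and> \<langle>y, z\<rangle> \<in> elts g}"

definition Bij :: "'a::ZF \<Rightarrow> 'a \<Rightarrow> 'a \<Rightarrow> bool" where
  "Bij f A B \<longleftrightarrow> is_fun f A B \<and> (\<forall>y\<in>elts B. \<exists>!x. x \<in> elts A \<and> app f x = y)"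

text \<open>Cardinals are initial ordinals; the finite ones are included.\<close>

definition Cardinal :: "'a::ZF \<Rightarrow> bool" where
  "Cardinal k \<longleftrightarrow> Ordinal k \<and> (\<forall>a\<in>elts k. \<not> (\<exists>f. Bij f a k))"

definition InfCardinal :: "'a::ZF \<Rightarrow> bool" where
  "InfCardinal k \<longleftrightarrow> Cardinal k \<and> elts omega \<subseteq> elts k"

text \<open>The sequence of length two with entries \<open>x\<close>, \<open>y\<close>, and a sequence of length \<open>n\<close> prolonged by \<open>a\<close>.\<close>

definition seq2 :: "'a::ZF \<Rightarrow> 'a \<Rightarrow> 'a" where
  "seq2 x y = vset {\<langle>vempty, x\<rangle>, \<langle>vsucc vempty, y\<rangle>}"

definition snoc :: "'a::ZF \<Rightarrow> 'a \<Rightarrow> 'a \<Rightarrow> 'a" where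
  "snoc s n a = vset (insert \<langle>n, a\<rangle> (elts s))"

abbreviation "v1 \<equiv> vsucc vempty"
abbreviation "v2 \<equiv> vsucc v1"
abbreviation "v3 \<equiv> vsucc v2"
abbreviation "v4 \<equiv> vsucc v3"

section \<open>First-order logic inside the model\<close>

text \<open>
  A symbol carries its kind and its arity (a natural number of the model) together with an
  arbitrary set as its name, so that a vocabulary is just a set of symbols, of any size.
\<close>

definition relsym :: "'a::ZF \<Rightarrow> 'a \<Rightarrow> 'a" where
  "relsym k a = \<langle>vempty, \<langle>k, a\<rangle>\<rangle>"

definition funsym :: "'a::ZF \<Rightarrow> 'a \<Rightarrow> 'a" where
  "funsym k a = \<langle>v1, \<langle>k, a\<rangle>\<rangle>"

definition consym :: "'a::ZF \<Rightarrow> 'a" where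
  "consym a = \<langle>v2, a\<rangle>"

definition Vocabulary :: "'a::ZF \<Rightarrow> bool" where
  "Vocabulary \<tau> \<longleftrightarrow> (\<forall>x\<in>elts \<tau>. (\<exists>k\<in>elts omega. \<exists>a. x = relsym k a) \<or>
     (\<exists>k\<in>elts omega. \<exists>a. x = funsym k a) \<or> (\<exists>a. x = consym a))"

definition var_tm :: "'a::ZF \<Rightarrow> 'a" where
  "var_tm i = \<langle>vempty, i\<rangle>"

definition con_tm :: "'a::ZF \<Rightarrow> 'a" where
  "con_tm c = \<langle>v1, c\<rangle>"

definition fun_tm :: "'a::ZF \<Rightarrow> 'a \<Rightarrow> 'a" where
  "fun_tm f u = \<langle>v2, \<langle>f, u\<rangle>\<rangle>"

text \<open>
  Terms of vocabulary \<open>\<tau>\<close> in the variables \<open>v\<^sub>i\<close> with \<open>i < n\<close>: the elements of the least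
  set closed under the term-forming operations. The argument \<open>u\<close> of a \<open>k\<close>-ary symbol is a
  function with domain \<open>k = {0, \<dots>, k - 1}\<close>.
\<close>

definition closed_tm :: "'a::ZF \<Rightarrow> 'a \<Rightarrow> 'a \<Rightarrow> bool" where
  "closed_tm \<tau> n X \<longleftrightarrow>
     (\<forall>i\<in>elts n. var_tm i \<in> elts X) \<and>
     (\<forall>a. consym a \<in> elts \<tau> \<longrightarrow> con_tm (consym a) \<in> elts X) \<and>
     (\<forall>k a u. funsym k a \<in> elts \<tau> \<and> is_fun u k X \<longrightarrow> fun_tm (funsym k a) u \<in> elts X)"

definition Tms :: "'a::ZF \<Rightarrow> 'a \<Rightarrow> 'a" where
  "Tms \<tau> n = vset {t. \<forall>X. closed_tm \<tau> n X \<longrightarrow> t \<in> elts X}"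

definition eq_fm :: "'a::ZF \<Rightarrow> 'a \<Rightarrow> 'a" where
  "eq_fm t u = \<langle>vempty, \<langle>t, u\<rangle>\<rangle>"

definition rel_fm :: "'a::ZF \<Rightarrow> 'a \<Rightarrow> 'a" where
  "rel_fm r u = \<langle>v1, \<langle>r, u\<rangle>\<rangle>"

definition neg_fm :: "'a::ZF \<Rightarrow> 'a" where
  "neg_fm \<phi> = \<langle>v2, \<phi>\<rangle>"

definition and_fm :: "'a::ZF \<Rightarrow> 'a \<Rightarrow> 'a" where
  "and_fm \<phi> \<psi> = \<langle>v3, \<langle>\<phi>, \<psi>\<rangle>\<rangle>"

definition ex_fm :: "'a::ZF \<Rightarrow> 'a" where
  "ex_fm \<phi> = \<langle>v4, \<phi>\<rangle>"

text \<open>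
  Formulas are well-scoped (de Bruijn levels): a formula in context \<open>n\<close> has its free variables
  among the \<open>v\<^sub>i\<close> with \<open>i < n\<close>, and if \<open>\<phi>\<close> is a formula in context \<open>n + 1\<close>, then \<open>ex_fm \<phi>\<close> is the
  formula \<open>\<exists>v\<^sub>n. \<phi>\<close> in context \<open>n\<close>. Sentences are the formulas in context \<open>0\<close>.
\<close>

definition closed_fm :: "'a::ZF \<Rightarrow> 'a \<Rightarrow> bool" where
  "closed_fm \<tau> X \<longleftrightarrow> (\<forall>n\<in>elts omega.
     (\<forall>t\<in>elts (Tms \<tau> n). \<forall>u\<in>elts (Tms \<tau> n). \<langle>n, eq_fm t u\<rangle> \<in> elts X) \<and>
     (\<forall>k a u. relsym k a \<in> elts \<tau> \<and> is_fun u k (Tms \<tau> n) \<longrightarrow> \<langle>n, rel_fm (relsym k a) u\<rangle> \<in> elts X) \<and>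
     (\<forall>\<phi>. \<langle>n, \<phi>\<rangle> \<in> elts X \<longrightarrow> \<langle>n, neg_fm \<phi>\<rangle> \<in> elts X) \<and>
     (\<forall>\<phi> \<psi>. \<langle>n, \<phi>\<rangle> \<in> elts X \<and> \<langle>n, \<psi>\<rangle> \<in> elts X \<longrightarrow> \<langle>n, and_fm \<phi> \<psi>\<rangle> \<in> elts X) \<and>
     (\<forall>\<phi>. \<langle>vsucc n, \<phi>\<rangle> \<in> elts X \<longrightarrow> \<langle>n, ex_fm \<phi>\<rangle> \<in> elts X))"

definition Form :: "'a::ZF \<Rightarrow> 'a \<Rightarrow> 'a \<Rightarrow> bool" where
  "Form \<tau> n \<phi> \<longleftrightarrow> (\<forall>X. closed_fm \<tau> X \<longrightarrow> \<langle>n, \<phi>\<rangle> \<in> elts X)"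

text \<open>
  A structure has a universe \<open>M\<close> and an interpretation \<open>I\<close>, a function with domain \<open>\<tau>\<close>. A
  \<open>k\<close>-ary relation on \<open>M\<close> is a set of functions from \<open>k\<close> to \<open>M\<close>. The universe may be empty.
\<close>

definition Pow_fun :: "'a::ZF \<Rightarrow> 'a \<Rightarrow> 'a" where
  "Pow_fun M k = vset {s. is_fun s k M}"

definition Structure :: "'a::ZF \<Rightarrow> 'a \<Rightarrow> 'a \<Rightarrow> bool" where
  "Structure \<tau> M I \<longleftrightarrow> (\<exists>Y. is_fun I \<tau> Y) \<and>
     (\<forall>k a. relsym k a \<in> elts \<tau> \<longrightarrow> elts (app I (relsym k a)) \<subseteq> elts (Pow_fun M k)) \<and>
     (\<forall>k a. funsym k a \<in> elts \<tau> \<longrightarrow> is_fun (app I (funsym k a)) (Pow_fun M k) M) \<and>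
     (\<forall>a. consym a \<in> elts \<tau> \<longrightarrow> app I (consym a) \<in> elts M)"

text \<open>The function evaluating the terms of \<open>Tms \<tau> n\<close> under an assignment \<open>s\<close> from \<open>n\<close> to \<open>M\<close>.\<close>

definition is_eval :: "'a::ZF \<Rightarrow> 'a \<Rightarrow> 'a \<Rightarrow> 'a \<Rightarrow> 'a \<Rightarrow> 'a \<Rightarrow> bool" where
  "is_eval \<tau> M I n s e \<longleftrightarrow> is_fun e (Tms \<tau> n) M \<and>
     (\<forall>i\<in>elts n. app e (var_tm i) = app s i) \<and>
     (\<forall>a. consym a \<in> elts \<tau> \<longrightarrow> app e (con_tm (consym a)) = app I (consym a)) \<and>
     (\<forall>k a u. funsym k a \<in> elts \<tau> \<and> is_fun u k (Tms \<tau> n) \<longrightarrow>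
        app e (fun_tm (funsym k a) u) = app (app I (funsym k a)) (vcomp e u))"

definition eval_tm :: "'a::ZF \<Rightarrow> 'a \<Rightarrow> 'a \<Rightarrow> 'a \<Rightarrow> 'a \<Rightarrow> 'a" where
  "eval_tm \<tau> M I n s = (THE e. is_eval \<tau> M I n s e)"

text \<open>
  Tarski's clauses for a set \<open>S\<close> of triples \<open>\<langle>\<langle>n, \<phi>\<rangle>, s\<rangle>\<close> with \<open>\<phi>\<close> a formula in context \<open>n\<close> and \<open>s\<close>
  an assignment from \<open>n\<close> to \<open>M\<close>. ZF proves that such a set exists and that it is unique on
  these triples.
\<close>

definition is_truth :: "'a::ZF \<Rightarrow> 'a \<Rightarrow> 'a \<Rightarrow> 'a \<Rightarrow> bool" where
  "is_truth \<tau> M I S \<longleftrightarrow> (\<forall>n\<in>elts omega. \<forall>s. is_fun s n M \<longrightarrow>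
     (\<forall>t\<in>elts (Tms \<tau> n). \<forall>u\<in>elts (Tms \<tau> n).
        \<langle>\<langle>n, eq_fm t u\<rangle>, s\<rangle> \<in> elts S \<longleftrightarrow> app (eval_tm \<tau> M I n s) t = app (eval_tm \<tau> M I n s) u) \<and>
     (\<forall>k a u. relsym k a \<in> elts \<tau> \<and> is_fun u k (Tms \<tau> n) \<longrightarrow>
        (\<langle>\<langle>n, rel_fm (relsym k a) u\<rangle>, s\<rangle> \<in> elts S \<longleftrightarrow>
           vcomp (eval_tm \<tau> M I n s) u \<in> elts (app I (relsym k a)))) \<and>
     (\<forall>\<phi>. Form \<tau> n \<phi> \<longrightarrow>
        (\<langle>\<langle>n, neg_fm \<phi>\<rangle>, s\<rangle> \<in> elts S \<longleftrightarrow> \<langle>\<langle>n, \<phi>\<rangle>, s\<rangle> \<notin> elts S)) \<and>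
     (\<forall>\<phi> \<psi>. Form \<tau> n \<phi> \<and> Form \<tau> n \<psi> \<longrightarrow>
        (\<langle>\<langle>n, and_fm \<phi> \<psi>\<rangle>, s\<rangle> \<in> elts S \<longleftrightarrow>
           \<langle>\<langle>n, \<phi>\<rangle>, s\<rangle> \<in> elts S \<and> \<langle>\<langle>n, \<psi>\<rangle>, s\<rangle> \<in> elts S)) \<and>
     (\<forall>\<phi>. Form \<tau> (vsucc n) \<phi> \<longrightarrow>
        (\<langle>\<langle>n, ex_fm \<phi>\<rangle>, s\<rangle> \<in> elts S \<longleftrightarrow>
           (\<exists>a\<in>elts M. \<langle>\<langle>vsucc n, \<phi>\<rangle>, snoc s n a\<rangle> \<in> elts S))))"

definition Sat :: "'a::ZF \<Rightarrow> 'a \<Rightarrow> 'a \<Rightarrow> 'a \<Rightarrow> 'a \<Rightarrow> 'a \<Rightarrow> bool" where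
  "Sat \<tau> M I n \<phi> s \<longleftrightarrow> (\<exists>S. is_truth \<tau> M I S \<and> \<langle>\<langle>n, \<phi>\<rangle>, s\<rangle> \<in> elts S)"

definition elem_emb :: "'a::ZF \<Rightarrow> 'a \<Rightarrow> 'a \<Rightarrow> 'a \<Rightarrow> 'a \<Rightarrow> 'a \<Rightarrow> bool" where
  "elem_emb \<tau> M I N J j \<longleftrightarrow> is_fun j M N \<and>
     (\<forall>n\<in>elts omega. \<forall>\<phi> s. Form \<tau> n \<phi> \<and> is_fun s n M \<longrightarrow>
        (Sat \<tau> M I n \<phi> s \<longleftrightarrow> Sat \<tau> N J n \<phi> (vcomp j s)))"

section \<open>Proto Berkeley cardinals\<close>

definition mem_voc :: "'a::ZF" where
  "mem_voc = vset {relsym v2 vempty}"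

definition mem_interp :: "'a::ZF \<Rightarrow> 'a" where
  "mem_interp M = vset {\<langle>relsym v2 vempty, vset {p. \<exists>x\<in>elts M. \<exists>y\<in>elts M. x \<in> elts y \<and> p = seq2 x y}\<rangle>}"

definition mem_emb :: "'a::ZF \<Rightarrow> 'a \<Rightarrow> bool" where
  "mem_emb M j \<longleftrightarrow> elem_emb mem_voc M (mem_interp M) M (mem_interp M) j"

definition is_crit :: "'a::ZF \<Rightarrow> 'a \<Rightarrow> 'a \<Rightarrow> bool" where
  "is_crit M j \<kappa> \<longleftrightarrow> Ordinal \<kappa> \<and> \<kappa> \<in> elts M \<and> app j \<kappa> \<noteq> \<kappa> \<and>
     (\<forall>\<xi>\<in>elts M. Ordinal \<xi> \<and> app j \<xi> \<noteq> \<xi> \<longrightarrow> \<xi> \<notin> elts \<kappa>)"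

definition proto_Berkeley :: "'a::ZF \<Rightarrow> 'a \<Rightarrow> bool" where
  "proto_Berkeley \<alpha> l \<longleftrightarrow> Cardinal l \<and> Ordinal \<alpha> \<and> \<alpha> \<in> elts l \<and>
     (\<forall>M. Transitive M \<and> l \<in> elts M \<longrightarrow>
        (\<exists>j \<kappa>. mem_emb M j \<and> is_crit M j \<kappa> \<and> \<alpha> \<in> elts \<kappa> \<and> \<kappa> \<in> elts l))"

section \<open>Chain compactness for relation types\<close>

definition is_relation :: "'a::ZF \<Rightarrow> 'a \<Rightarrow> bool" where
  "is_relation M R \<longleftrightarrow> (\<forall>p\<in>elts R. \<exists>x\<in>elts M. \<exists>y\<in>elts M. p = \<langle>x, y\<rangle>)"

text \<open>
  Here \<open>r\<close> is the designated binary relation symbol, and \<open>(A, I)\<close> the structure whose reduct to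
  \<open>r\<close> is isomorphic to \<open>(M, R)\<close>.
\<close>

definition has_rel_type :: "'a::ZF \<Rightarrow> 'a \<Rightarrow> 'a \<Rightarrow> 'a \<Rightarrow> 'a \<Rightarrow> bool" where
  "has_rel_type r A I M R \<longleftrightarrow> (\<exists>f. Bij f A M \<and>
     (\<forall>x\<in>elts A. \<forall>y\<in>elts A. seq2 x y \<in> elts (app I r) \<longleftrightarrow> \<langle>app f x, app f y\<rangle> \<in> elts R))"

text \<open>
  A logic is given by its sentences, \<open>Sen \<tau> \<phi>\<close>, and its satisfaction relation, \<open>Mod \<tau> A I \<phi>\<close>.
\<close>

type_synonym 'a sentences = "'a \<Rightarrow> 'a \<Rightarrow> bool"
type_synonym 'a satisfaction = "'a \<Rightarrow> 'a \<Rightarrow> 'a \<Rightarrow> 'a \<Rightarrow> bool"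

definition has_model_of_type ::
  "'a::ZF satisfaction \<Rightarrow> 'a \<Rightarrow> 'a \<Rightarrow> 'a \<Rightarrow> 'a \<Rightarrow> 'a \<Rightarrow> bool" where
  "has_model_of_type Mod \<tau> r T M R \<longleftrightarrow> (\<exists>A I. Structure \<tau> A I \<and>
     (\<forall>\<phi>\<in>elts T. Mod \<tau> A I \<phi>) \<and> has_rel_type r A I M R)"

text \<open>
  The chain \<open>C\<close> is a function with domain \<open>\<mu>\<close>; increasing means weakly increasing. The definition
  makes sense for every \<open>\<mu>\<close>, but for finite nonzero \<open>\<mu>\<close> it holds trivially, the union being the last
  member of the chain. Chain compactness is therefore of interest for infinite \<open>\<mu>\<close> only.
\<close>

definition chain_compact ::
  "'a::ZF sentences \<Rightarrow> 'a satisfaction \<Rightarrow> 'a \<Rightarrow> 'a \<Rightarrow> 'a \<Rightarrow> bool" where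
  "chain_compact Sen Mod \<mu> M R \<longleftrightarrow>
     (\<forall>\<tau> a T C. Vocabulary \<tau> \<and> relsym v2 a \<in> elts \<tau> \<and> (\<forall>\<phi>\<in>elts T. Sen \<tau> \<phi>) \<and>
        (\<exists>Y. is_fun C \<mu> Y) \<and>
        (\<forall>\<beta>\<in>elts \<mu>. \<forall>\<gamma>\<in>elts \<beta>. elts (app C \<gamma>) \<subseteq> elts (app C \<beta>)) \<and>
        elts T = (\<Union>\<beta>\<in>elts \<mu>. elts (app C \<beta>)) \<and>
        (\<forall>\<beta>\<in>elts \<mu>. has_model_of_type Mod \<tau> (relsym v2 a) (app C \<beta>) M R) \<longrightarrow>
        has_model_of_type Mod \<tau> (relsym v2 a) T M R)"

definition fo_sentence :: "'a::ZF sentences" where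
  "fo_sentence \<tau> \<phi> \<longleftrightarrow> Form \<tau> vempty \<phi>"

definition fo_models :: "'a::ZF satisfaction" where
  "fo_models \<tau> A I \<phi> \<longleftrightarrow> Sat \<tau> A I vempty \<phi> vempty"

end

theory Submission
  imports Defs
begin

text \<open>
  From proto Berkeley to compactness. Suppose that for some relation type \<open>(M, R)\<close> every infinite
  cardinal \<open>\<mu>\<close> below \<open>l\<close> has a chain of theories of length \<open>\<mu>\<close> all of whose members, but not whose union,
  have a model of type \<open>(M, R)\<close>. By Collection some set \<open>X0\<close> contains such a chain for every \<open>\<mu>\<close>. If
  \<open>X\<close> is transitive and \<open>p \<in> X\<close>, then \<open>p\<close> is definable in \<open>X \<union> {X, {X, p}}\<close>, so an embedding \<open>j\<close> given by the
  proto Berkeley property can be made to preserve any given relations on \<open>X0\<close>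
  (\<open>proto_Berkeley_fixing\<close>). Let \<open>\<kappa> < l\<close> be its critical point. It is an infinite cardinal, so
  \<open>X0\<close> contains a bad chain \<open>C\<close> of length \<open>\<kappa>\<close>. Now \<open>j(C)\<close> is a chain of length \<open>j(\<kappa>) > \<kappa>\<close>
  whose members have models of type \<open>(M, R)\<close>, and its member with index \<open>\<kappa>\<close> contains \<open>j(\<phi>)\<close> for every
  \<open>\<phi>\<close> in the union of \<open>C\<close>. A model of this member, with its symbols renamed along \<open>j\<close>
  (\<open>renamed_model\<close>), is a model of the union of \<open>C\<close>: contradiction.

  From compactness to proto Berkeley. Let \<open>M\<close> be transitive with \<open>l \<in> M\<close>, and let first-order logic be
  \<open>\<mu>\<close>-chain compact for the type \<open>(M, \<in>)\<close>, where \<open>\<mu> < l\<close> is an infinite cardinal. Take constants for the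
  elements of \<open>M\<close> and one more constant \<open>d\<close>. Let \<open>T\<^sub>\<beta>\<close> consist of the sentences that hold in \<open>M\<close>
  whenever \<open>d\<close> is interpreted by an ordinal \<open>\<gamma>\<close> with \<open>\<beta> \<le> \<gamma> < \<mu>\<close>. These theories form a chain. A model of their union
  of type \<open>(M, \<in>)\<close> yields an elementary \<open>j : M \<rightarrow> M\<close> together with an element of \<open>j(\<mu>)\<close> that differs
  from \<open>j(\<xi>)\<close> for all \<open>\<xi> < \<mu>\<close>. Hence \<open>j\<close> moves some ordinal \<open>\<xi> \<le> \<mu>\<close>
  (\<open>chain_compact_gives_embedding\<close>).

  All of this happens inside a model of ZF, where Separation and Replacement apply to definable
  predicates only. So every construction needs a proof of definability, and recursion, Collection, and the
  existence and uniqueness of Tarskian truth are derived from rules for definability.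
\<close>

section \<open>Definable classes\<close>

primrec ren :: "(nat \<Rightarrow> nat) \<Rightarrow> fm \<Rightarrow> fm" where
  "ren f (FMem i j) = FMem (f i) (f j)"
| "ren f (FEq i j) = FEq (f i) (f j)"
| "ren f (FNeg p) = FNeg (ren f p)"
| "ren f (FAnd p q) = FAnd (ren f p) (ren f q)"
| "ren f (FAll i p) = FAll (f i) (ren f p)"

lemma fsat_ren: "inj f \<Longrightarrow> fsat E s (ren f p) \<longleftrightarrow> fsat E (\<lambda>i. s (f i)) p"
proof (induction p arbitrary: s)
  case (FAll i p)
  have "(\<lambda>j. (s(f i := x)) (f j)) = (\<lambda>j. s (f j))(i := x)" for x
    using FAll.prems by (auto simp: inj_def fun_eq_iff)
  then show ?case using FAll by simp
qed auto

text \<open>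
  Two environments interleaved: even variables hold arguments, odd variables hold parameters.
  Injective renamings of variables can then merge two lists of parameters into one.
\<close>

definition mix :: "(nat \<Rightarrow> 'a) \<Rightarrow> (nat \<Rightarrow> 'a) \<Rightarrow> nat \<Rightarrow> 'a" where
  "mix s p i = (if even i then s (i div 2) else p (i div 2))"

lemma mix_simps [simp]: "mix s p (2 * i) = s i" "mix s p (Suc (2 * i)) = p i"
  by (auto simp: mix_def)

lemma mix_upd: "mix (s(i := x)) p = (mix s p)(2 * i := x)"
  by (auto simp: mix_def fun_eq_iff)

definition DR :: "((nat \<Rightarrow> 'a::ZF) \<Rightarrow> bool) \<Rightarrow> bool" where
  "DR P \<longleftrightarrow> (\<exists>\<phi> p. \<forall>s. P s \<longleftrightarrow> fsat mem (mix s p) \<phi>)"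

lemma DR_mem: "DR (\<lambda>s. mem (s i) (s j))"
  unfolding DR_def by (rule exI[of _ "FMem (2*i) (2*j)"]) simp

lemma DR_eq: "DR (\<lambda>s. s i = s j)"
  unfolding DR_def by (rule exI[of _ "FEq (2*i) (2*j)"]) simp

lemma DR_param: "DR (\<lambda>s. s i = c)"
  unfolding DR_def
  by (rule exI[of _ "FEq (2*i) (Suc (2*0))"], rule exI[of _ "\<lambda>_. c"]) (simp only: fsat.simps mix_simps, simp)

lemma DR_not: "DR P \<Longrightarrow> DR (\<lambda>s. \<not> P s)"
  unfolding DR_def by (metis fsat.simps(3))

text \<open>
  The parameters of the two formulas are moved to the variables \<open>4k + 1\<close> and \<open>4k + 3\<close>, which is how
  \<open>mix s (mix p q)\<close> stores them.
\<close>

lemma DR_conj: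
  assumes "DR P" "DR Q" shows "DR (\<lambda>s. P s \<and> Q s)"
proof -
  obtain \<phi> p where 1: "\<And>s. P s \<longleftrightarrow> fsat mem (mix s p) \<phi>" using assms(1) by (auto simp: DR_def)
  obtain \<psi> q where 2: "\<And>s. Q s \<longleftrightarrow> fsat mem (mix s q) \<psi>" using assms(2) by (auto simp: DR_def)
  define f g :: "nat \<Rightarrow> nat"
    where "f i = (if even i then i else 2 * i - 1)" and "g i = (if even i then i else 2 * i + 1)" for i
  have inj: "inj f"
    by (rule injI) (simp add: f_def split: if_splits, presburger+)
  have inj': "inj g"
    by (rule injI) (simp add: g_def split: if_splits, presburger+)
  have "mix s (mix p q) (f i) = mix s p i" "mix s (mix p q) (g i) = mix s q i" for s i
  proof -
    have "i = 2 * (i div 2) \<or> i = Suc (2 * (i div 2))" by presburger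
    then obtain b where "i = 2 * b \<or> i = Suc (2 * b)" by blast
    moreover have "f (2 * b) = 2 * b" "f (Suc (2 * b)) = Suc (2 * (2 * b))"
      "g (2 * b) = 2 * b" "g (Suc (2 * b)) = Suc (2 * Suc (2 * b))" by (auto simp: f_def g_def)
    ultimately show "mix s (mix p q) (f i) = mix s p i" "mix s (mix p q) (g i) = mix s q i"
      by (metis mix_simps)+
  qed
  then have "\<forall>s. (P s \<and> Q s) \<longleftrightarrow> fsat mem (mix s (mix p q)) (FAnd (ren f \<phi>) (ren g \<psi>))"
    by (simp add: 1 2 fsat_ren inj inj')
  then show ?thesis unfolding DR_def by blast
qed

lemma DR_all: "DR P \<Longrightarrow> DR (\<lambda>s. \<forall>x. P (s(i := x)))"
proof -
  assume "DR P"
  then obtain \<phi> p where 1: "\<And>s. P s \<longleftrightarrow> fsat mem (mix s p) \<phi>" by (auto simp: DR_def)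
  have "\<forall>s. (\<forall>x. P (s(i := x))) \<longleftrightarrow> fsat mem (mix s p) (FAll (2 * i) \<phi>)"
    by (simp add: 1 mix_upd)
  then show ?thesis unfolding DR_def by blast
qed

lemma DR_ex: "DR P \<Longrightarrow> DR (\<lambda>s. \<exists>x. P (s(i := x)))"
  using DR_not[OF DR_all[OF DR_not]] by simp

lemma DR_disj: "DR P \<Longrightarrow> DR Q \<Longrightarrow> DR (\<lambda>s. P s \<or> Q s)"
  using DR_not[OF DR_conj[OF DR_not DR_not]] by simp

lemma DR_iff: "DR P \<Longrightarrow> DR Q \<Longrightarrow> DR (\<lambda>s. P s \<longleftrightarrow> Q s)"
  using DR_disj[OF DR_conj[of P Q] DR_conj[OF DR_not[of P] DR_not[of Q]]]
  by (rule back_subst[of DR]) auto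

lemma DR_ren: "DR P \<Longrightarrow> inj f \<Longrightarrow> DR (\<lambda>s. P (\<lambda>i. s (f i)))"
proof -
  assume "DR P" and f: "inj f"
  then obtain \<phi> p where 1: "\<And>s. P s \<longleftrightarrow> fsat mem (mix s p) \<phi>" by (auto simp: DR_def)
  define g where "g i = (if even i then 2 * f (i div 2) else i)" for i
  have "inj g"
  proof (rule injI)
    fix x y assume "g x = g y"
    moreover from this have "even x \<longleftrightarrow> even y" by (auto simp: g_def split: if_splits)
    moreover have "x div 2 = y div 2 \<Longrightarrow> even x \<Longrightarrow> even y \<Longrightarrow> x = y" by presburger
    ultimately show "x = y" using injD[OF f] by (auto simp: g_def split: if_splits)
  qed
  moreover have "(\<lambda>i. mix s p (g i)) = mix (\<lambda>i. s (f i)) p" for s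
    by (auto simp: mix_def g_def fun_eq_iff)
  ultimately have "\<forall>s. P (\<lambda>i. s (f i)) \<longleftrightarrow> fsat mem (mix s p) (ren g \<phi>)"
    by (simp add: 1 fsat_ren)
  then show ?thesis unfolding DR_def by blast
qed

definition small :: "'a::ZF set \<Rightarrow> bool" where
  "small S \<longleftrightarrow> (\<exists>b. elts b = S)"

lemma elts_inject: "elts a = elts b \<longleftrightarrow> a = (b::'a::ZF)"
  using extensionality[of a b] by auto

lemma elts_eqI: "(\<And>z. z \<in> elts a \<longleftrightarrow> z \<in> elts b) \<Longrightarrow> a = (b::'a::ZF)"
  using elts_inject by blast

lemma vset_elts [simp]: "vset (elts a) = a"
  unfolding vset_def elts_inject by simp

lemma elts_vset: "small S \<Longrightarrow> elts (vset S) = S"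
  unfolding small_def by fastforce

lemma mem_vset: "small S \<Longrightarrow> x \<in> elts (vset S) \<longleftrightarrow> x \<in> S"
  by (simp add: elts_vset del: mem_Collect_eq)

lemma small_elts [simp]: "small (elts a)"
  unfolding small_def by blast

lemma small_pair [simp]: "small {x, y}"
  unfolding small_def using pairing[of x y] by auto

lemma small_single [simp]: "small {x}"
  using small_pair[of x x] by simp

lemma small_Union_elts: "small (\<Union>y\<in>elts a. elts y)"
  unfolding small_def using union[of a] by (simp add: set_eq_iff Bex_def)

lemma small_Un [simp]: "small A \<Longrightarrow> small B \<Longrightarrow> small (A \<union> B)"
proof -
  assume "small A" "small B"
  then obtain a b where "elts a = A" "elts b = B" unfolding small_def by blast
  moreover obtain c where "elts c = {a, b}" using small_pair unfolding small_def by blast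
  ultimately show ?thesis using small_Union_elts[of c] by (simp del: mem_Collect_eq)
qed

lemma small_insert [simp]: "small A \<Longrightarrow> small (insert x A)"
  using small_Un[of "{x}" A] by simp

lemma pair_eq_iff [simp]: "\<langle>a, b\<rangle> = \<langle>c, d\<rangle> \<longleftrightarrow> a = c \<and> b = d"
proof
  assume "\<langle>a, b\<rangle> = \<langle>c, d\<rangle>"
  then have "{vset {a}, vset {a,b}} = {vset {c}, vset {c,d}}"
    unfolding vpair_def by (metis elts_vset small_pair)
  moreover have "vset {a} = vset {c} \<longleftrightarrow> a = c" "vset {a,b} = vset {c} \<longleftrightarrow> {a,b} = {c}"
     "vset {a} = vset {c,d} \<longleftrightarrow> {a} = {c,d}" "vset {a,b} = vset {c,d} \<longleftrightarrow> {a,b} = {c,d}" for a b c d :: 'a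
    by (metis elts_vset small_pair singleton_inject insert_absorb2)+
  ultimately show "a = c \<and> b = d" by (auto simp: doubleton_eq_iff)
qed simp

lemma DR_vpair: "DR (\<lambda>s. s i = \<langle>s j, s k\<rangle>)"
proof -
  define w v where "w = Suc (i + j + k)" and "v = Suc w"
  have [simp]: "i \<noteq> w" "i \<noteq> v" "j \<noteq> w" "j \<noteq> v" "k \<noteq> w" "k \<noteq> v" "w \<noteq> v" "v \<noteq> w"
    "w \<noteq> i" "v \<noteq> i" "w \<noteq> j" "v \<noteq> j" "w \<noteq> k" "v \<noteq> k"
    unfolding v_def w_def by auto
  have set1: "DR (\<lambda>s. \<forall>x. mem x (s w) \<longleftrightarrow> x = s j)" 
    using DR_all[OF DR_iff[OF DR_mem[of v w] DR_eq[of v j]], of v] by simp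
  have set2: "DR (\<lambda>s. \<forall>x. mem x (s w) \<longleftrightarrow> x = s j \<or> x = s k)"
    using DR_all[OF DR_iff[OF DR_mem[of v w] DR_disj[OF DR_eq[of v j] DR_eq[of v k]]], of v] by simp
  have "DR (\<lambda>s. \<forall>y. mem y (s i) \<longleftrightarrow> (\<forall>x. mem x y \<longleftrightarrow> x = s j) \<or> (\<forall>x. mem x y \<longleftrightarrow> x = s j \<or> x = s k))"
    using DR_all[OF DR_iff[OF DR_mem[of w i] DR_disj[OF set1 set2]], of w] by simp
  moreover have "z = \<langle>a, b\<rangle> \<longleftrightarrow> (\<forall>y. mem y z \<longleftrightarrow> (\<forall>x. mem x y \<longleftrightarrow> x = a) \<or> (\<forall>x. mem x y \<longleftrightarrow> x = a \<or> x = b))"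
    for z a b :: 'a
  proof -
    have "y = vset {a} \<longleftrightarrow> (\<forall>x. mem x y \<longleftrightarrow> x = a)" "y = vset {a,b} \<longleftrightarrow> (\<forall>x. mem x y \<longleftrightarrow> x = a \<or> x = b)" for y
      using elts_inject[of y "vset {a}"] elts_inject[of y "vset {a, b}"] by (auto simp: elts_vset)
    moreover have "z = \<langle>a, b\<rangle> \<longleftrightarrow> (\<forall>y. mem y z \<longleftrightarrow> y = vset {a} \<or> y = vset {a,b})"
      using elts_inject[of z "\<langle>a, b\<rangle>"] unfolding vpair_def by (auto simp: elts_vset)
    ultimately show ?thesis by simp
  qed
  ultimately show ?thesis by simp
qed

text \<open>
  Definability with parameters, for classes and for class functions. One argument suffices:
  predicates of several arguments are coded as predicates of nested pairs. The closure rules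
  collected as \<open>D_intros\<close> then prove definability by following the syntax of the predicate.
\<close>

definition D :: "('a::ZF \<Rightarrow> bool) \<Rightarrow> bool" where
  "D P \<longleftrightarrow> DR (\<lambda>s. P (s 0))"

definition DF :: "('a::ZF \<Rightarrow> 'a) \<Rightarrow> bool" where
  "DF f \<longleftrightarrow> DR (\<lambda>s. s 1 = f (s 0))"

lemma D_at: "D P \<Longrightarrow> DR (\<lambda>s. P (s i))"
proof -
  assume "D P"
  moreover have "inj (\<lambda>n. if n = 0 then i else n + i + 1)" by (auto simp: inj_def)
  ultimately show ?thesis
    using DR_ren[of "\<lambda>s. P (s 0)" "\<lambda>n. if n = 0 then i else n + i + 1"] unfolding D_def by simp
qed

lemma DF_at: "DF f \<Longrightarrow> i \<noteq> j \<Longrightarrow> DR (\<lambda>s. s j = f (s i))"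
proof -
  assume "DF f" "i \<noteq> j"
  moreover from this have "inj (\<lambda>n::nat. if n = 0 then i else if n = 1 then j else n + i + j + 2)" by (intro injI) (simp split: if_splits)
  ultimately show ?thesis
    using DR_ren[of "\<lambda>s. s 1 = f (s 0)" "\<lambda>n. if n = 0 then i else if n = 1 then j else n + i + j + 2"]
    unfolding DF_def by simp
qed

text \<open>
  The projections get a default value outside the pairs, since an unspecified value need not be
  definable in the model.
\<close>

definition vfst :: "'a::ZF \<Rightarrow> 'a" where
  "vfst z = (if \<exists>x y. z = \<langle>x, y\<rangle> then THE x. \<exists>y. z = \<langle>x, y\<rangle> else vempty)"

definition vsnd :: "'a::ZF \<Rightarrow> 'a" where
  "vsnd z = (if \<exists>x y. z = \<langle>x, y\<rangle> then THE y. \<exists>x. z = \<langle>x, y\<rangle> else vempty)"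

lemma vfst_vpair [simp]: "vfst \<langle>x, y\<rangle> = x" and vsnd_vpair [simp]: "vsnd \<langle>x, y\<rangle> = y"
  unfolding vfst_def vsnd_def by auto

named_theorems D_intros

lemma D_comp: assumes "D P" "DF f" shows "D (\<lambda>x. P (f x))"
  using DR_ex[OF DR_conj[OF DF_at[OF assms(2), of 0 1] D_at[OF assms(1), of 1]], of 1]
  unfolding D_def by simp

lemma DF_comp: assumes "DF f" "DF g" shows "DF (\<lambda>x. f (g x))"
  using DR_ex[OF DR_conj[OF DF_at[OF assms(2), of 0 2] DF_at[OF assms(1), of 2 1]], of 2]
  unfolding DF_def by simp

lemma D_mem [D_intros]: assumes "DF f" "DF g" shows "D (\<lambda>x. mem (f x) (g x))"
  using DR_ex[OF DR_ex[OF DR_conj[OF DF_at[OF assms(1), of 0 1] DR_conj[OF DF_at[OF assms(2), of 0 2] DR_mem[of 1 2]]], of 2], of 1]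
  unfolding D_def by simp

lemma D_eq [D_intros]: assumes "DF f" "DF g" shows "D (\<lambda>x. f x = g x)"
  using DR_ex[OF DR_ex[OF DR_conj[OF DF_at[OF assms(1), of 0 1] DR_conj[OF DF_at[OF assms(2), of 0 2] DR_eq[of 1 2]]], of 2], of 1]
  unfolding D_def by simp

lemma DF_vpair [D_intros]: assumes "DF f" "DF g" shows "DF (\<lambda>x. \<langle>f x, g x\<rangle>)"
  using DR_ex[OF DR_ex[OF DR_conj[OF DF_at[OF assms(1), of 0 3] DR_conj[OF DF_at[OF assms(2), of 0 2] DR_vpair[of 1 3 2]]], of 2], of 3]
  unfolding DF_def by simp

lemma DF_const [D_intros]: "DF (\<lambda>_. c)"
  using DR_param[of 1 c] unfolding DF_def by simp

lemma DF_id [D_intros]: "DF (\<lambda>x. x)"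
  using DR_eq[of 1 0] unfolding DF_def by simp

lemma DF_vfst0: "DF vfst"
proof -
  have "DR (\<lambda>s. \<exists>y. s 0 = \<langle>s 1, y\<rangle>)" using DR_ex[OF DR_vpair[of 0 1 2], of 2] by simp
  moreover from DR_ex[OF this, of 1] have "DR (\<lambda>s. \<exists>x y. s 0 = \<langle>x, y\<rangle>)" by simp
  ultimately have "DR (\<lambda>s. (\<exists>y. s 0 = \<langle>s 1, y\<rangle>) \<or> \<not> (\<exists>x y. s 0 = \<langle>x, y\<rangle>) \<and> s 1 = vempty)"
    by (intro DR_disj DR_conj DR_not DR_param)
  moreover have "y = vfst x \<longleftrightarrow> (\<exists>y'. x = \<langle>y, y'\<rangle>) \<or> \<not> (\<exists>x' y. x = \<langle>x', y\<rangle>) \<and> y = vempty" for x y :: 'a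
    by (cases "\<exists>x' y. x = \<langle>x', y\<rangle>") (force, auto simp: vfst_def)
  ultimately show ?thesis unfolding DF_def by simp
qed

lemma DF_vsnd0: "DF vsnd"
proof -
  have "DR (\<lambda>s. \<exists>y. s 0 = \<langle>y, s 1\<rangle>)" using DR_ex[OF DR_vpair[of 0 2 1], of 2] by simp
  moreover from DR_ex[OF this, of 1] have "DR (\<lambda>s. \<exists>x y. s 0 = \<langle>y, x\<rangle>)" by simp
  ultimately have "DR (\<lambda>s. (\<exists>y. s 0 = \<langle>y, s 1\<rangle>) \<or> \<not> (\<exists>x y. s 0 = \<langle>y, x\<rangle>) \<and> s 1 = vempty)"
    by (intro DR_disj DR_conj DR_not DR_param)
  moreover have "y = vsnd x \<longleftrightarrow> (\<exists>y'. x = \<langle>y', y\<rangle>) \<or> \<not> (\<exists>x' y. x = \<langle>y, x'\<rangle>) \<and> y = vempty" for x y :: 'a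
    by (cases "\<exists>x' y. x = \<langle>y, x'\<rangle>") (force, auto simp: vsnd_def)
  ultimately show ?thesis unfolding DF_def by simp
qed

lemmas DF_vfst [D_intros] = DF_comp[OF DF_vfst0] and DF_vsnd [D_intros] = DF_comp[OF DF_vsnd0]

lemma D_not [D_intros]: "D P \<Longrightarrow> D (\<lambda>x. \<not> P x)"
  unfolding D_def by (rule DR_not)
lemma D_conj [D_intros]: "D P \<Longrightarrow> D Q \<Longrightarrow> D (\<lambda>x. P x \<and> Q x)"
  unfolding D_def by (rule DR_conj)
lemma D_disj [D_intros]: "D P \<Longrightarrow> D Q \<Longrightarrow> D (\<lambda>x. P x \<or> Q x)"
  unfolding D_def by (rule DR_disj)
lemma D_iff [D_intros]: "D P \<Longrightarrow> D Q \<Longrightarrow> D (\<lambda>x. P x \<longleftrightarrow> Q x)"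
  unfolding D_def by (rule DR_iff)
lemma D_imp [D_intros]: "D P \<Longrightarrow> D Q \<Longrightarrow> D (\<lambda>x. P x \<longrightarrow> Q x)"
  unfolding imp_conv_disj by (intro D_disj D_not)

lemma D_elts [D_intros]: "DF f \<Longrightarrow> DF g \<Longrightarrow> D (\<lambda>x. f x \<in> elts (g x))"
  using D_mem[of f g] by simp

lemma D_const [D_intros]: "D (\<lambda>_. b)"
proof (cases b)
  case True
  have "D (\<lambda>x::'a. x = x)" by (intro D_eq DF_id)
  then show ?thesis using True by simp
next
  case False
  have "D (\<lambda>x::'a. \<not> x = x)" by (intro D_not D_eq DF_id)
  then show ?thesis using False by simp
qed

lemma DR_graph:
  assumes "D (\<lambda>z. P (vfst z) (vsnd z))" shows "DR (\<lambda>s. P (s 0) (s 1))"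
proof -
  have "DR (\<lambda>s. s 2 = \<langle>s 0, s 1\<rangle> \<and> P (vfst (s 2)) (vsnd (s 2)))"
    by (rule DR_conj[OF DR_vpair D_at[OF assms]])
  from DR_ex[OF this, of 2] show ?thesis by simp
qed

text \<open>
  The bound variable is paired with the previous argument, so nested quantifiers give nested pairs.
\<close>

lemma D_all [D_intros]:
  assumes "D (\<lambda>z. P (vfst z) (vsnd z))" shows "D (\<lambda>x. \<forall>y. P x y)"
proof -
  have "DR (\<lambda>s. P (s 0) (s 1))" using assms by (rule DR_graph)
  from DR_all[OF this, of 1] show ?thesis unfolding D_def by simp
qed

lemma D_ex [D_intros]:
  assumes "D (\<lambda>z. P (vfst z) (vsnd z))" shows "D (\<lambda>x. \<exists>y. P x y)"
proof -
  have "DR (\<lambda>s. P (s 0) (s 1))" using assms by (rule DR_graph)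
  from DR_ex[OF this, of 1] show ?thesis unfolding D_def by simp
qed

lemma D_ball [D_intros]:
  assumes "DF A" "D (\<lambda>z. P (vfst z) (vsnd z))" shows "D (\<lambda>x. \<forall>y\<in>elts (A x). P x y)"
  unfolding Ball_def by (intro D_intros assms(2) assms(1)[THEN DF_comp])

lemma D_bex [D_intros]:
  assumes "DF A" "D (\<lambda>z. P (vfst z) (vsnd z))" shows "D (\<lambda>x. \<exists>y\<in>elts (A x). P x y)"
  unfolding Bex_def by (intro D_intros assms(2) assms(1)[THEN DF_comp])

lemma D_subset [D_intros]:
  assumes "DF A" "DF B" shows "D (\<lambda>x. elts (A x) \<subseteq> elts (B x))"
  unfolding subset_eq by (intro D_intros assms[THEN DF_comp])

lemma D_comp2:
  assumes "D (\<lambda>z. P (vfst z) (vsnd z))" "DF f" "DF g" shows "D (\<lambda>x. P (f x) (g x))"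
  using D_comp[OF assms(1) DF_vpair[OF assms(2,3)]] by simp

lemma DF_comp2:
  assumes "DF (\<lambda>z. F (vfst z) (vsnd z))" "DF f" "DF g" shows "DF (\<lambda>x. F (f x) (g x))"
  using DF_comp[OF assms(1) DF_vpair[OF assms(2,3)]] by simp

lemma D_ex1 [D_intros]:
  assumes "D (\<lambda>z. P (vfst z) (vsnd z))" shows "D (\<lambda>x. \<exists>!y. P x y)"
  unfolding Ex1_def by (intro D_intros assms D_comp2[where P = P, OF assms])

lemma DF_graph:
  assumes "D (\<lambda>z. P (vfst z) (vsnd z))" "\<And>x y. y = f x \<longleftrightarrow> P x y" shows "DF f"
proof -
  have "DR (\<lambda>s. P (s 0) (s 1))" using assms(1) by (rule DR_graph)
  then show ?thesis unfolding DF_def assms(2) .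
qed

lemma DF_vset [D_intros]:
  assumes "D (\<lambda>z. P (vfst z) (vsnd z))" "\<And>x. small {y. P x y}" shows "DF (\<lambda>x. vset {y. P x y})"
proof (rule DF_graph)
  show "D (\<lambda>z. \<forall>t. t \<in> elts (vsnd z) \<longleftrightarrow> P (vfst z) t)"
    by (intro D_intros D_comp2[where P = P, OF assms(1)])
  show "y = vset {y. P x y} \<longleftrightarrow> (\<forall>t. t \<in> elts y \<longleftrightarrow> P x t)" for x y
    using elts_inject[of y "vset {y. P x y}"] assms(2) by (auto simp: elts_vset)
qed

lemma DF_if [D_intros]:
  assumes "D P" "DF f" "DF g" shows "DF (\<lambda>x. if P x then f x else g x)"
  by (rule DF_graph[where P = "\<lambda>x y. P x \<and> y = f x \<or> \<not> P x \<and> y = g x"])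
     (intro D_intros D_comp[OF assms(1)] assms(2,3)[THEN DF_comp], auto)

text \<open>
  The schemata of Separation and Replacement enter only here and in \<open>small_image\<close>: definable
  predicates and functions satisfy them.
\<close>

lemma small_sep: assumes "D P" shows "small {x \<in> elts a. P x}"
proof -
  obtain \<phi> p where 1: "\<And>s. P (s 0) \<longleftrightarrow> fsat mem (mix s p) \<phi>" using assms by (auto simp: D_def DR_def)
  have "P x \<longleftrightarrow> fsat mem ((mix (\<lambda>_. x) p)(0 := x)) \<phi>" for x
    using 1[of "\<lambda>_. x"] by (simp add: mix_def fun_upd_idem)
  have "P x \<longleftrightarrow> fsat mem ((mix (\<lambda>_. vempty) p)(0 := x)) \<phi>" for x
    using 1[of "(\<lambda>_. vempty)(0 := x)"] mix_upd[of "\<lambda>_. vempty" 0 x p] by simp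
  then show ?thesis
    using separation[of a "mix (\<lambda>_. vempty) p" \<phi>] unfolding small_def by auto
qed

lemma small_subset: "D P \<Longrightarrow> (\<And>x. P x \<Longrightarrow> x \<in> elts a) \<Longrightarrow> small {x. P x}"
  using small_sep[of P a] by (metis (mono_tags, lifting) Collect_cong)

lemma small_image: assumes "DF f" shows "small (f ` elts a)"
proof -
  obtain \<phi> p where 1: "\<And>s. s 1 = f (s 0) \<longleftrightarrow> fsat mem (mix s p) \<phi>" using assms by (auto simp: DF_def DR_def)
  define g :: "nat \<Rightarrow> nat" where "g i = (if i = 0 then 0 else if i = 2 then 1 else i + 2)" for i
  have inj: "inj g" by (auto simp: inj_def g_def)
  define s where "s i = mix (\<lambda>_. vempty) p (i - 2)" for i
  have "(\<lambda>i. (s(0 := x, 1 := y)) (g i)) = mix ((\<lambda>_. vempty)(0 := x, 1 := y)) p" for x y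
    by (auto simp: fun_eq_iff g_def s_def mix_upd)
  then have "y = f x \<longleftrightarrow> fsat mem (s(0 := x, 1 := y)) (ren g \<phi>)" for x y
    using 1[of "(\<lambda>_. vempty)(0 := x, 1 := y)"] by (simp add: fsat_ren[OF inj])
  note eq = this
  have "\<exists>b. \<forall>y. mem y b \<longleftrightarrow> (\<exists>x. mem x a \<and> y = f x)"
    using replacement[of a s "ren g \<phi>"] unfolding eq[symmetric] by blast
  then obtain b where "\<And>y. mem y b \<longleftrightarrow> (\<exists>x. mem x a \<and> y = f x)" by blast
  then have "elts b = f ` elts a" by auto
  then show ?thesis unfolding small_def by blast
qed

section \<open>Sets and functions\<close>

lemma smallI: "(\<And>x. mem x b \<longleftrightarrow> x \<in> S) \<Longrightarrow> small S"
  unfolding small_def by (intro exI[of _ b]) auto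

lemma small_empty [simp]: "small {}"
  using small_sep[OF D_const[of False]] by simp

lemma mem_vempty [simp]: "\<not> mem x vempty"
  using elts_vset[OF small_empty] unfolding vempty_def by auto

lemma eq_vempty_iff: "a = vempty \<longleftrightarrow> (\<forall>x. \<not> mem x a)"
  using elts_eqI[of a vempty] by auto

lemma mem_vsucc [simp]: "mem x (vsucc a) \<longleftrightarrow> x = a \<or> mem x a"
  using elts_vset[of "insert a (elts a)"] unfolding vsucc_def by auto

lemma foundation_min:
  assumes "mem x a" obtains y where "mem y a" "\<And>z. mem z y \<Longrightarrow> \<not> mem z a"
  using foundation[of a] assms by blast

lemma mem_irrefl [simp]: "\<not> mem x x"
proof
  assume "mem x x"
  moreover have "mem y (vset {x}) \<longleftrightarrow> y = x" for y using mem_vset[of "{x}" y] by simp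
  ultimately show False using foundation_min[of x "vset {x}"] by metis
qed

lemma mem_asym: "mem x y \<Longrightarrow> \<not> mem y x"
proof
  assume "mem x y" "mem y x"
  moreover have "mem z (vset {x, y}) \<longleftrightarrow> z = x \<or> z = y" for z using mem_vset[of "{x, y}" z] by simp
  ultimately show False using foundation_min[of x "vset {x, y}"] by metis
qed

definition vPow :: "'a::ZF \<Rightarrow> 'a" where
  "vPow a = vset {x. elts x \<subseteq> elts a}"

lemma small_vPow: "small {x. elts x \<subseteq> elts a}"
proof -
  obtain c where "\<And>z. mem z c \<longleftrightarrow> (\<forall>y. mem y z \<longrightarrow> mem y a)" using powerset[of a] by blast
  then show ?thesis by (intro smallI[of c]) auto
qed

lemma mem_vPow [simp]: "mem x (vPow a) \<longleftrightarrow> elts x \<subseteq> elts a"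
  using mem_vset[OF small_vPow[of a], of x] unfolding vPow_def by simp

lemma DF_vPow [D_intros]: "DF f \<Longrightarrow> DF (\<lambda>x. vPow (f x))"
proof -
  have "DF vPow" unfolding vPow_def by (intro D_intros small_vPow)
  then show "DF f \<Longrightarrow> DF (\<lambda>x. vPow (f x))" by (rule DF_comp)
qed

definition vUnion :: "'a::ZF \<Rightarrow> 'a" where
  "vUnion a = vset {z. \<exists>y. mem y a \<and> mem z y}"

lemma mem_vUnion [simp]: "mem z (vUnion a) \<longleftrightarrow> (\<exists>y. mem y a \<and> mem z y)"
proof -
  obtain c where "\<And>z. mem z c \<longleftrightarrow> (\<exists>y. mem y a \<and> mem z y)" using union[of a] by blast
  then have "small {z. \<exists>y. mem y a \<and> mem z y}" by (intro smallI[of c]) auto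
  then show ?thesis using mem_vset[of "{z. \<exists>y. mem y a \<and> mem z y}" z] unfolding vUnion_def by simp
qed

lemma DF_char:
  assumes "D (\<lambda>z. P (vfst z) (vsnd z))" "\<And>x t. mem t (f x) \<longleftrightarrow> P x t" shows "DF f"
proof (rule DF_graph)
  show "D (\<lambda>z. \<forall>t. mem t (vsnd z) \<longleftrightarrow> P (vfst z) t)"
    by (intro D_intros D_comp2[where P = P, OF assms(1)])
  show "y = f x \<longleftrightarrow> (\<forall>t. mem t y \<longleftrightarrow> P x t)" for x y
    using elts_eqI[of y "f x"] assms(2) by auto
qed



lemma DF_vUnion [D_intros]:
  assumes "DF f" shows "DF (\<lambda>x. vUnion (f x))"
  by (rule DF_char[where P = "\<lambda>x t. \<exists>y. mem y (f x) \<and> mem t y"])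
     (intro D_intros assms[THEN DF_comp], simp)

lemma DF_vsucc [D_intros]:
  assumes "DF f" shows "DF (\<lambda>x. vsucc (f x))"
  by (rule DF_char[where P = "\<lambda>x t. t = f x \<or> mem t (f x)"])
     (intro D_intros assms[THEN DF_comp], simp)

definition vinsert :: "'a::ZF \<Rightarrow> 'a \<Rightarrow> 'a" where
  "vinsert x a = vset (insert x (elts a))"

lemma mem_vinsert [simp]: "mem y (vinsert x a) \<longleftrightarrow> y = x \<or> mem y a"
  using mem_vset[of "insert x (elts a)" y] unfolding vinsert_def by simp

lemma DF_vinsert [D_intros]:
  assumes "DF f" "DF g" shows "DF (\<lambda>x. vinsert (f x) (g x))"
  by (rule DF_char[where P = "\<lambda>x t. t = f x \<or> mem t (g x)"])
     (intro D_intros assms[THEN DF_comp], simp)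

lemma small_UN: assumes "DF f" shows "small {z. \<exists>x. mem x a \<and> mem z (f x)}"
proof -
  obtain b where b: "elts b = f ` elts a" using small_image[OF assms] unfolding small_def by blast
  have "{z. \<exists>x. mem x a \<and> mem z (f x)} = elts (vUnion b)"
    using b by (auto simp: set_eq_iff)
  then show ?thesis by (metis small_elts)
qed

lemma small_image_Collect: assumes "DF f" shows "small {z. \<exists>x. mem x a \<and> z = f x}"
  using small_image[OF assms, of a] unfolding image_def by simp

definition vprod :: "'a::ZF \<Rightarrow> 'a \<Rightarrow> 'a" where
  "vprod A B = vset {p. \<exists>x y. mem x A \<and> mem y B \<and> p = \<langle>x, y\<rangle>}"

lemma small_vprod: "small {p. \<exists>x y. mem x A \<and> mem y B \<and> p = \<langle>x, y\<rangle>}"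
proof -
  define g where "g x = vset {p. \<exists>y. mem y B \<and> p = \<langle>x, y\<rangle>}" for x
  have small: "small {p. \<exists>y. mem y B \<and> p = \<langle>x, y\<rangle>}" for x
    by (rule small_image_Collect) (intro D_intros)
  have "DF g" unfolding g_def by (intro D_intros small)
  from small_UN[OF this, of A] show ?thesis
    using mem_vset[OF small] unfolding g_def by (rule_tac back_subst[of small]) auto
qed

lemma mem_vprod [simp]: "mem p (vprod A B) \<longleftrightarrow> (\<exists>x y. mem x A \<and> mem y B \<and> p = \<langle>x, y\<rangle>)"
  using mem_vset[OF small_vprod[of A B], of p] unfolding vprod_def by simp

text \<open>
  The function \<open>app\<close> takes an unspecified value where its argument is not a function or the point is
  not in the domain, and such a value need not be definable. The union of all values at \<open>x\<close> is
  definable everywhere, and it is the value if there is exactly one.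
\<close>

definition vapp :: "'a::ZF \<Rightarrow> 'a \<Rightarrow> 'a" where
  "vapp f x = vset {z. \<exists>y. mem \<langle>x, y\<rangle> f \<and> mem z y}"

lemma pair_parts: 
  "mem \<langle>x, y\<rangle> f \<Longrightarrow> mem x (vUnion (vUnion f))" "mem \<langle>x, y\<rangle> f \<Longrightarrow> mem y (vUnion (vUnion f))"
proof -
  have "mem x (vset {x, y})" "mem y (vset {x, y})" "mem (vset {x, y}) \<langle>x, y\<rangle>"
    using mem_vset[OF small_pair] unfolding vpair_def by auto
  then show "mem \<langle>x, y\<rangle> f \<Longrightarrow> mem x (vUnion (vUnion f))" "mem \<langle>x, y\<rangle> f \<Longrightarrow> mem y (vUnion (vUnion f))"
    by auto
qed

lemma small_vapp: "small {z. \<exists>y. mem \<langle>x, y\<rangle> f \<and> mem z y}"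
proof (rule small_subset[of _ "vUnion (vUnion (vUnion f))"])
  show "D (\<lambda>z. \<exists>y. mem \<langle>x, y\<rangle> f \<and> mem z y)" by (intro D_intros)
qed (use pair_parts(2)[of x _ f] in \<open>auto simp del: mem_vUnion simp: mem_vUnion[of _ "vUnion (vUnion f)"]\<close>)

lemma mem_vapp: "mem z (vapp f x) \<longleftrightarrow> (\<exists>y. mem \<langle>x, y\<rangle> f \<and> mem z y)"
  using mem_vset[OF small_vapp[of x f], of z] unfolding vapp_def by simp

lemma DF_vapp [D_intros]:
  assumes "DF f" "DF g" shows "DF (\<lambda>x. vapp (f x) (g x))"
  by (rule DF_char[where P = "\<lambda>x t. \<exists>y. mem \<langle>g x, y\<rangle> (f x) \<and> mem t y"])
     (intro D_intros assms[THEN DF_comp], simp add: mem_vapp)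

lemma DF_vapp1: "DF (vapp f)"
  by (intro D_intros)

lemma is_fun_iff: "is_fun f A B \<longleftrightarrow> (\<forall>p. mem p f \<longrightarrow> (\<exists>x y. mem x A \<and> mem y B \<and> p = \<langle>x, y\<rangle>)) \<and>
    (\<forall>x. mem x A \<longrightarrow> (\<exists>!y. mem \<langle>x, y\<rangle> f))"
  unfolding is_fun_def by auto

lemma D_is_fun [D_intros]:
  assumes "DF f" "DF A" "DF B" shows "D (\<lambda>x. is_fun (f x) (A x) (B x))"
  unfolding is_fun_iff by (intro D_intros assms[THEN DF_comp])

lemma fun_pair: "is_fun f A B \<Longrightarrow> mem \<langle>x, y\<rangle> f \<longleftrightarrow> mem x A \<and> y = app f x"
proof -
  assume f: "is_fun f A B"
  have dom: "mem x A" if "mem \<langle>x, y\<rangle> f" for x y using f that unfolding is_fun_iff by force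
  have ex: "\<exists>!y. mem \<langle>x, y\<rangle> f" if "mem x A" for x using f that unfolding is_fun_iff by blast
  have "mem \<langle>x, app f x\<rangle> f" if "mem x A" for x
    using theI'[OF ex[OF that]] unfolding app_def by simp
  then show ?thesis using dom ex by blast
qed

lemma fun_val: "is_fun f A B \<Longrightarrow> mem x A \<Longrightarrow> mem (app f x) B"
proof -
  assume f: "is_fun f A B" and x: "mem x A"
  then have "mem \<langle>x, app f x\<rangle> f" by (simp add: fun_pair[OF f])
  then show ?thesis using f unfolding is_fun_iff by force
qed

lemma fun_mem: "is_fun f A B \<Longrightarrow> mem p f \<longleftrightarrow> (\<exists>x. mem x A \<and> p = \<langle>x, app f x\<rangle>)"
proof -
  assume f: "is_fun f A B"
  have "mem p f \<Longrightarrow> \<exists>x y. p = \<langle>x, y\<rangle>" using f unfolding is_fun_iff by blast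
  then show ?thesis using fun_pair[OF f] by auto
qed

lemma vapp_app: "is_fun f A B \<Longrightarrow> mem x A \<Longrightarrow> vapp f x = app f x"
  by (rule elts_eqI) (simp add: mem_vapp fun_pair)

lemma fun_ext: "is_fun f A B \<Longrightarrow> is_fun g A C \<Longrightarrow> (\<And>x. mem x A \<Longrightarrow> app f x = app g x) \<Longrightarrow> f = g"
  by (rule elts_eqI) (auto simp: fun_mem)

lemma fun_codom: "is_fun f A B \<Longrightarrow> (\<And>x. mem x A \<Longrightarrow> mem (app f x) C) \<Longrightarrow> is_fun f A C"
  unfolding is_fun_iff[of f A C] by (auto simp: fun_mem fun_pair)

lemma app_unique: "is_fun f A B \<Longrightarrow> mem \<langle>x, y\<rangle> f \<Longrightarrow> app f x = y"
  by (simp add: fun_pair)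

definition vlam :: "'a::ZF \<Rightarrow> ('a \<Rightarrow> 'a) \<Rightarrow> 'a" where
  "vlam A F = vset {p. \<exists>x. mem x A \<and> p = \<langle>x, F x\<rangle>}"

lemma mem_vlam: "DF F \<Longrightarrow> mem p (vlam A F) \<longleftrightarrow> (\<exists>x. mem x A \<and> p = \<langle>x, F x\<rangle>)"
proof -
  assume "DF F"
  then have "small {p. \<exists>x. mem x A \<and> p = \<langle>x, F x\<rangle>}" by (intro small_image_Collect D_intros)
  from mem_vset[OF this] show ?thesis unfolding vlam_def by simp
qed

lemma vlam_fun: "DF F \<Longrightarrow> (\<And>x. mem x A \<Longrightarrow> mem (F x) B) \<Longrightarrow> is_fun (vlam A F) A B"
  unfolding is_fun_iff by (auto simp: mem_vlam)

lemma vlam_fun_ex: "DF F \<Longrightarrow> \<exists>B. is_fun (vlam A F) A B"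
proof -
  assume F: "DF F"
  obtain b where "elts b = F ` elts A" using small_image[OF F] unfolding small_def by blast
  then have "is_fun (vlam A F) A b" by (intro vlam_fun F) auto
  then show ?thesis by blast
qed

lemma app_vlam: "DF F \<Longrightarrow> mem x A \<Longrightarrow> app (vlam A F) x = F x"
  by (metis vlam_fun_ex fun_pair mem_vlam pair_eq_iff)

lemma DF_vlam [D_intros]:
  assumes "DF A" "\<And>x. DF (F x)" "DF (\<lambda>z. F (vfst z) (vsnd z))"
  shows "DF (\<lambda>x. vlam (A x) (F x))"
  by (rule DF_char[where P = "\<lambda>x t. \<exists>y. mem y (A x) \<and> t = \<langle>y, F x y\<rangle>"])
     (intro D_intros assms(1)[THEN DF_comp] DF_comp2[where F = F, OF assms(3)], simp add: mem_vlam assms(2))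

lemma mem_vcomp: "mem p (vcomp g f) \<longleftrightarrow> (\<exists>x y z. p = \<langle>x, z\<rangle> \<and> mem \<langle>x, y\<rangle> f \<and> mem \<langle>y, z\<rangle> g)"
proof -
  have "small {p. \<exists>x y z. p = \<langle>x, z\<rangle> \<and> \<langle>x, y\<rangle> \<in> elts f \<and> \<langle>y, z\<rangle> \<in> elts g}"
    by (rule small_subset[of _ "vprod (vUnion (vUnion f)) (vUnion (vUnion g))"], intro D_intros)
       (use pair_parts in \<open>auto simp del: mem_vUnion\<close>)
  from mem_vset[OF this] show ?thesis unfolding vcomp_def by simp
qed

lemma DF_vcomp [D_intros]:
  assumes "DF f" "DF g" shows "DF (\<lambda>x. vcomp (g x) (f x))"
  by (rule DF_char[where P = "\<lambda>x p. \<exists>u y z. p = \<langle>u, z\<rangle> \<and> mem \<langle>u, y\<rangle> (f x) \<and> mem \<langle>y, z\<rangle> (g x)"])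
     (intro D_intros assms[THEN DF_comp], simp add: mem_vcomp)

lemma vcomp_fun: "is_fun f A B \<Longrightarrow> is_fun g B C \<Longrightarrow> is_fun (vcomp g f) A C"
  unfolding is_fun_iff[of "vcomp g f"]
  by (auto simp: mem_vcomp fun_pair fun_val)

lemma app_vcomp: "is_fun f A B \<Longrightarrow> is_fun g B C \<Longrightarrow> mem x A \<Longrightarrow> app (vcomp g f) x = app g (app f x)"
  by (rule app_unique[OF vcomp_fun]) (auto simp: mem_vcomp fun_pair fun_val)

lemma vcomp_assoc:
  assumes f: "is_fun f A B" and g: "is_fun g B C" and h: "is_fun h C E"
  shows "vcomp h (vcomp g f) = vcomp (vcomp h g) f"
  by (rule fun_ext[OF vcomp_fun[OF vcomp_fun[OF f g] h] vcomp_fun[OF f vcomp_fun[OF g h]]])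
     (simp add: app_vcomp[OF vcomp_fun[OF f g] h] app_vcomp[OF f g] app_vcomp[OF f vcomp_fun[OF g h]]
       app_vcomp[OF g h] fun_val[OF f])

lemma vlam_id_fun: "is_fun (vlam A (\<lambda>x. x)) A A"
  by (rule vlam_fun) (intro D_intros)

lemma vcomp_vlam_id: "is_fun p k A \<Longrightarrow> vcomp (vlam A (\<lambda>x. x)) p = p"
  by (rule fun_ext[OF vcomp_fun[OF _ vlam_id_fun]]) 
    (auto simp: app_vcomp[OF _ vlam_id_fun] app_vlam[OF DF_id] fun_val)

lemma fun_vempty [simp]: "is_fun vempty vempty A"
  unfolding is_fun_iff by simp

lemma fun_from_vempty: "is_fun s vempty A \<Longrightarrow> s = vempty"
  by (rule fun_ext[OF _ fun_vempty]) auto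

lemma vcomp_vempty [simp]: "vcomp f vempty = vempty"
  by (rule elts_eqI) (simp add: mem_vcomp)

lemma v01 [simp]: "vempty \<noteq> vsucc x" "vsucc x \<noteq> vempty"
  by (metis mem_vempty mem_vsucc)+

lemma vsucc_inject [simp]: "vsucc x = vsucc y \<longleftrightarrow> x = y"
  by (metis mem_asym mem_vsucc)

lemma mem_seq2: "mem p (seq2 x y) \<longleftrightarrow> p = \<langle>vempty, x\<rangle> \<or> p = \<langle>v1, y\<rangle>"
  using mem_vset[OF small_pair] unfolding seq2_def by auto

lemma DF_seq2 [D_intros]:
  assumes "DF f" "DF g" shows "DF (\<lambda>x. seq2 (f x) (g x))"
  by (rule DF_char[where P = "\<lambda>x p. p = \<langle>vempty, f x\<rangle> \<or> p = \<langle>v1, g x\<rangle>"])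
     (intro D_intros assms[THEN DF_comp], simp add: mem_seq2)

lemma seq2_fun: "mem x A \<Longrightarrow> mem y A \<Longrightarrow> is_fun (seq2 x y) v2 A"
  unfolding is_fun_iff by (auto simp: mem_seq2)

lemma app_seq2 [simp]: "app (seq2 x y) vempty = x" "app (seq2 x y) v1 = y"
  unfolding app_def by (auto simp: mem_seq2)

lemma fun_v2: "is_fun u v2 A \<Longrightarrow> u = seq2 (app u vempty) (app u v1)"
  by (rule fun_ext[of _ v2 A _ A]) (auto intro!: seq2_fun fun_val)

lemma seq2_inject [simp]: "seq2 x y = seq2 x' y' \<longleftrightarrow> x = x' \<and> y = y'"
  by (metis app_seq2)

lemma vcomp_seq2: "is_fun f A B \<Longrightarrow> mem x A \<Longrightarrow> mem y A \<Longrightarrow> vcomp f (seq2 x y) = seq2 (app f x) (app f y)"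
  by (rule fun_ext[of _ v2 B _ B]) (auto intro!: vcomp_fun seq2_fun fun_val simp: app_vcomp[OF seq2_fun])

lemma mem_snoc: "mem p (snoc s n a) \<longleftrightarrow> p = \<langle>n, a\<rangle> \<or> mem p s"
  using mem_vset[of "insert \<langle>n, a\<rangle> (elts s)" p] unfolding snoc_def by simp

lemma DF_snoc [D_intros]:
  assumes "DF f" "DF g" "DF h" shows "DF (\<lambda>x. snoc (f x) (g x) (h x))"
  by (rule DF_char[where P = "\<lambda>x p. p = \<langle>g x, h x\<rangle> \<or> mem p (f x)"])
     (intro D_intros assms[THEN DF_comp], simp add: mem_snoc)

lemma snoc_fun: "is_fun s n A \<Longrightarrow> mem a A \<Longrightarrow> is_fun (snoc s n a) (vsucc n) A"
  unfolding is_fun_iff[of "snoc s n a"] by (auto simp: mem_snoc fun_pair fun_mem fun_val)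

lemma app_snoc:
  assumes "is_fun s n A" shows "app (snoc s n a) n = a" "mem i n \<Longrightarrow> app (snoc s n a) i = app s i"
proof -
  show "app (snoc s n a) n = a" unfolding app_def by (auto simp: mem_snoc fun_pair[OF assms])
  assume "mem i n" then show "app (snoc s n a) i = app s i" 
    unfolding app_def[of "snoc s n a"] by (auto simp: mem_snoc fun_pair[OF assms])
qed

lemma vcomp_snoc: "is_fun s n A \<Longrightarrow> mem a A \<Longrightarrow> is_fun g A B \<Longrightarrow> vcomp g (snoc s n a) = snoc (vcomp g s) n (app g a)"
  apply (rule fun_ext[of _ "vsucc n" B _ B])
  apply (blast intro: vcomp_fun snoc_fun)
  apply (blast intro: vcomp_fun snoc_fun fun_val)
  apply (subst app_vcomp[OF snoc_fun], assumption+)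
  apply (auto simp: app_snoc app_snoc[OF vcomp_fun] app_vcomp)
  done

lemma vlam_restrict:
  assumes f: "is_fun f A B" and C: "\<And>x. mem x C \<Longrightarrow> mem x A"
  shows "is_fun (vlam C (vapp f)) C B" "mem x C \<Longrightarrow> app (vlam C (vapp f)) x = app f x"
proof -
  have D: "DF (vapp f)" by (intro D_intros)
  show "is_fun (vlam C (vapp f)) C B"
    by (rule vlam_fun[OF D]) (simp add: vapp_app[OF f] fun_val[OF f] C)
  show "mem x C \<Longrightarrow> app (vlam C (vapp f)) x = app f x"
    by (simp add: app_vlam[OF D] vapp_app[OF f] C)
qed

lemma fun_vsucc_snoc:
  assumes s: "is_fun s (vsucc n) A" shows "s = snoc (vlam n (vapp s)) n (app s n)"
proof -
  have r: "is_fun (vlam n (vapp s)) n A" by (rule vlam_restrict[OF s]) simp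
  show ?thesis
    by (rule fun_ext[OF s snoc_fun[OF r]])
      (auto simp: fun_val[OF s] app_snoc[OF r] vlam_restrict(2)[OF s])
qed

lemma Bij_iff: "Bij f A B \<longleftrightarrow> is_fun f A B \<and> (\<forall>y. mem y B \<longrightarrow> (\<exists>!x. mem x A \<and> vapp f x = y))"
proof (cases "is_fun f A B")
  case True
  then have "(mem x A \<and> vapp f x = y) \<longleftrightarrow> (mem x A \<and> app f x = y)" for x y by (auto simp: vapp_app)
  then show ?thesis unfolding Bij_def by simp
qed (simp add: Bij_def)

lemma D_Bij [D_intros]:
  assumes "DF f" "DF A" "DF B" shows "D (\<lambda>x. Bij (f x) (A x) (B x))"
  unfolding Bij_iff by (intro D_intros assms[THEN DF_comp])

lemma Bij_surj: "Bij f A B \<Longrightarrow> mem y B \<Longrightarrow> \<exists>x. mem x A \<and> app f x = y"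
  unfolding Bij_def Ex1_def mem_Collect_eq Ball_def by blast

lemma Bij_inverse:
  assumes "Bij f A B"
  obtains g where "is_fun g B A" "\<And>x. mem x A \<Longrightarrow> app g (app f x) = x" "\<And>y. mem y B \<Longrightarrow> app f (app g y) = y"
proof -
  have f: "is_fun f A B" and ex: "\<And>y. mem y B \<Longrightarrow> \<exists>!x. mem x A \<and> app f x = y"
    using assms unfolding Bij_def by auto
  have "small {p. \<exists>x y. p = \<langle>y, x\<rangle> \<and> mem \<langle>x, y\<rangle> f}"
    by (rule small_subset[of _ "vprod B A"], intro D_intros) (auto simp: fun_pair[OF f] fun_val[OF f])
  then obtain g where "elts g = {p. \<exists>x y. p = \<langle>y, x\<rangle> \<and> mem \<langle>x, y\<rangle> f}" unfolding small_def by blast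
  then have g: "mem p g \<longleftrightarrow> (\<exists>x. mem x A \<and> p = \<langle>app f x, x\<rangle>)" for p
    by (auto simp: set_eq_iff fun_pair[OF f])
  have gf: "is_fun g B A"
    unfolding is_fun_iff using ex fun_val[OF f] by (auto simp: g) metis+
  show ?thesis
  proof (rule that[OF gf])
    show 1: "mem x A \<Longrightarrow> app g (app f x) = x" for x by (rule app_unique[OF gf]) (auto simp: g)
    show "mem y B \<Longrightarrow> app f (app g y) = y" for y using ex[of y] 1 by metis
  qed
qed

section \<open>Ordinals and natural numbers\<close>

lemma Transitive_iff: "Transitive a \<longleftrightarrow> (\<forall>x y. mem x a \<longrightarrow> mem y x \<longrightarrow> mem y a)"
  unfolding Transitive_def by auto

lemma Ordinal_iff: "Ordinal a \<longleftrightarrow> Transitive a \<and> (\<forall>x. mem x a \<longrightarrow> Transitive x)"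
  unfolding Ordinal_def by auto

lemma D_Transitive [D_intros]: assumes "DF A" shows "D (\<lambda>x. Transitive (A x))"
  unfolding Transitive_iff by (intro D_intros assms[THEN DF_comp])

lemma D_Ordinal [D_intros]: assumes "DF A" shows "D (\<lambda>x. Ordinal (A x))"
  unfolding Ordinal_iff by (intro D_intros assms[THEN DF_comp] assms)

lemma Ordinal_mem: "Ordinal a \<Longrightarrow> mem x a \<Longrightarrow> Ordinal x"
  unfolding Ordinal_iff Transitive_iff by blast

lemma Ordinal_trans: "Ordinal a \<Longrightarrow> mem x a \<Longrightarrow> mem y x \<Longrightarrow> mem y a"
  unfolding Ordinal_iff Transitive_iff by blast

lemma Ordinal_vempty [simp]: "Ordinal vempty"
  unfolding Ordinal_iff Transitive_iff by simp

lemma Ordinal_vsucc [simp]: "Ordinal a \<Longrightarrow> Ordinal (vsucc a)"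
  unfolding Ordinal_iff Transitive_iff mem_vsucc by blast

lemma Ordinal_least:
  assumes "D P" "Ordinal a" "P a"
  obtains b where "Ordinal b" "P b" "mem b (vsucc a)" "\<And>c. mem c b \<Longrightarrow> \<not> P c"
proof -
  obtain S where "elts S = {x \<in> elts (vsucc a). P x}" using small_sep[OF assms(1)] unfolding small_def by blast
  then have S: "mem x S \<longleftrightarrow> mem x (vsucc a) \<and> P x" for x by (auto simp: set_eq_iff)
  have o: "Ordinal (vsucc a)" using assms(2) by simp
  obtain b where b: "mem b S" "\<And>c. mem c b \<Longrightarrow> \<not> mem c S" using foundation_min[of a S] S assms(3) by auto
  show ?thesis
  proof (rule that)
    show "mem b (vsucc a)" "P b" using b S by blast+
    then show "Ordinal b" using Ordinal_mem[OF o] by blast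
    show "\<not> P c" if "mem c b" for c
      using b(2)[OF that] S Ordinal_trans[OF o \<open>mem b (vsucc a)\<close> that] by blast
  qed
qed

lemma Ordinal_induct [consumes 2, case_names less]:
  assumes "D P" "Ordinal a" "\<And>a. Ordinal a \<Longrightarrow> (\<And>b. mem b a \<Longrightarrow> P b) \<Longrightarrow> P a"
  shows "P a"
proof (rule ccontr)
  assume "\<not> P a"
  from Ordinal_least[OF D_not[OF assms(1)] assms(2) this] show False using assms(3) by metis
qed

text \<open>
  Let \<open>a\<close> be minimal among the ordinals not comparable to all others, and \<open>b\<close> minimal among those not
  comparable to \<open>a\<close>. Then every element of either one belongs to the other, so they are equal.
\<close>

lemma Ordinal_linear: 
  assumes "Ordinal a" "Ordinal b" shows "mem a b \<or> a = b \<or> mem b a"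
proof -
  have "D (\<lambda>a. \<forall>b. Ordinal b \<longrightarrow> mem a b \<or> a = b \<or> mem b a)" by (intro D_intros)
  then have "\<forall>b. Ordinal b \<longrightarrow> mem a b \<or> a = b \<or> mem b a" using assms(1)
  proof (induction rule: Ordinal_induct)
    case (less a)
    have "mem a b \<or> a = b \<or> mem b a" if "Ordinal b" for b
    proof -
      have "D (\<lambda>b. mem a b \<or> a = b \<or> mem b a)" by (intro D_intros)
      then show ?thesis using that
      proof (induction rule: Ordinal_induct)
        case (less b)
        note ihb = this and iha = \<open>\<And>x. mem x a \<Longrightarrow> \<forall>b. Ordinal b \<longrightarrow> mem x b \<or> x = b \<or> mem b x\<close>
        show ?case
        proof (rule ccontr)
          assume "\<not> ?case"
          then have n: "\<not> mem a b" "a \<noteq> b" "\<not> mem b a" by auto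
          have "mem x b" if "mem x a" for x
            using iha[OF that] n that Ordinal_trans[OF \<open>Ordinal a\<close> that] ihb(1) by blast
          moreover have "mem x a" if "mem x b" for x
            using ihb(2)[OF that] n that Ordinal_trans[OF \<open>Ordinal b\<close> that] by blast
          ultimately have "a = b" by (intro elts_eqI) auto
          then show False using n by simp
        qed
      qed
    qed
    then show ?case by blast
  qed
  then show ?thesis using assms(2) by blast
qed

lemma Natural_iff: "Natural n \<longleftrightarrow> Ordinal n \<and> (\<forall>m. mem m (vsucc n) \<longrightarrow> m = vempty \<or> (\<exists>k. m = vsucc k))"
  unfolding Natural_def by auto

lemma D_Natural [D_intros]: assumes "DF A" shows "D (\<lambda>x. Natural (A x))"
  unfolding Natural_iff by (intro D_intros assms[THEN DF_comp] assms)

lemma Natural_mem: "Natural n \<Longrightarrow> mem m n \<Longrightarrow> Natural m"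
  unfolding Natural_iff using Ordinal_mem Ordinal_trans by (metis mem_vsucc)

lemma Natural_vempty [simp]: "Natural vempty"
  unfolding Natural_iff by simp

lemma Natural_vsucc: "Natural n \<Longrightarrow> Natural (vsucc n)"
  unfolding Natural_iff by auto

lemma small_Natural: "small {n::'a::ZF. Natural n}"
proof -
  obtain w e :: 'a where e: "mem e w" "\<And>z. \<not> mem z e"
    and s: "\<And>x. mem x w \<Longrightarrow> \<exists>y. mem y w \<and> (\<forall>z. mem z y \<longleftrightarrow> mem z x \<or> z = x)"
    using infinity by blast
  have e0: "mem vempty w" using e eq_vempty_iff[of e] by simp
  have s: "mem (vsucc x) w" if "mem x w" for x
  proof -
    from s[OF that] obtain y where "mem y w" "\<forall>z. mem z y \<longleftrightarrow> mem z x \<or> z = x" by blast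
    moreover from this have "y = vsucc x" by (intro elts_eqI) auto
    ultimately show ?thesis by simp
  qed
  have "mem n w" if "Natural n" for n :: 'a
  proof -
    have "D (\<lambda>n. Natural n \<longrightarrow> mem n w)" by (intro D_intros)
    moreover have "Ordinal n" using that unfolding Natural_iff by simp
    ultimately have "Natural n \<longrightarrow> mem n w"
    proof (induction rule: Ordinal_induct)
      case (less n)
      have "Natural n \<Longrightarrow> n = vempty \<or> (\<exists>k. n = vsucc k)" unfolding Natural_iff by simp
      then show ?case using e0 s less Natural_mem by (metis mem_vsucc)
    qed
    then show ?thesis using that by simp
  qed
  then show ?thesis by (intro small_subset[of _ w] D_intros) auto
qed

lemma mem_omega [simp]: "mem n omega \<longleftrightarrow> Natural n"
  using mem_vset[OF small_Natural] unfolding omega_def by simp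

lemma nat_induct [consumes 2, case_names zero succ]:
  assumes "D P" "mem n omega" "P vempty" "\<And>n. mem n omega \<Longrightarrow> P n \<Longrightarrow> P (vsucc n)"
  shows "P n"
proof -
  have "D (\<lambda>n. Natural n \<longrightarrow> P n)" by (intro D_intros D_comp[OF assms(1)])
  moreover have "Ordinal n" using assms(2) unfolding mem_omega Natural_iff by simp
  ultimately have "Natural n \<longrightarrow> P n"
  proof (induction rule: Ordinal_induct)
    case (less n)
    show ?case
    proof
      assume n: "Natural n"
      then consider "n = vempty" | k where "n = vsucc k" unfolding Natural_iff by auto
      then show "P n" using assms(3,4) less n Natural_mem[OF n] by cases auto
    qed
  qed
  then show ?thesis using assms(2) by simp
qed

lemma Ordinal_omega [simp]: "Ordinal omega"
  unfolding Ordinal_iff Transitive_iff mem_omega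
  by (metis Natural_mem Natural_iff Ordinal_trans)

lemma Natural_Ordinal: "Natural n \<Longrightarrow> Ordinal n"
  unfolding Natural_iff by simp

lemma Cardinal_iff: "Cardinal k \<longleftrightarrow> Ordinal k \<and> (\<forall>a. mem a k \<longrightarrow> \<not> (\<exists>f. Bij f a k))"
  unfolding Cardinal_def by auto

lemma D_InfCardinal [D_intros]: assumes "DF A" shows "D (\<lambda>x. InfCardinal (A x))"
  unfolding InfCardinal_def Cardinal_iff by (intro D_intros assms[THEN DF_comp] assms)

lemma Natural_cases: "Natural x \<Longrightarrow> x = vempty \<or> (\<exists>n. Natural n \<and> x = vsucc n)"
  using Natural_mem[of x] unfolding Natural_iff[of x] by (metis mem_vsucc)

lemma vUnion_vsucc: "Ordinal n \<Longrightarrow> vUnion (vsucc n) = n"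
  by (rule elts_eqI) (auto intro: Ordinal_trans)

text \<open>
  If \<open>\<xi>\<close> is infinite, then \<open>0 \<mapsto> \<xi>\<close>, \<open>n + 1 \<mapsto> n\<close> and the identity elsewhere define a bijection from
  \<open>\<xi>\<close> to its successor, which is therefore not a cardinal.
\<close>

lemma InfCardinal_limit:
  assumes \<mu>: "InfCardinal \<mu>" and \<xi>: "mem \<xi> \<mu>" shows "mem (vsucc \<xi>) \<mu>"
proof -
  have \<mu>O: "Ordinal \<mu>" and om: "\<And>n. Natural n \<Longrightarrow> mem n \<mu>"
    and nb: "\<And>a f. mem a \<mu> \<Longrightarrow> \<not> Bij f a \<mu>"
    using \<mu> unfolding InfCardinal_def Cardinal_iff by auto
  have \<xi>O: "Ordinal \<xi>" by (rule Ordinal_mem[OF \<mu>O \<xi>])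
  show ?thesis
  proof (rule ccontr)
    assume n: "\<not> ?thesis"
    have "\<not> mem \<mu> (vsucc \<xi>)" using \<xi> mem_asym by auto
    then have \<mu>_eq: "\<mu> = vsucc \<xi>" using n Ordinal_linear[OF \<mu>O Ordinal_vsucc[OF \<xi>O]] by blast
    have \<xi>n: "\<not> Natural \<xi>" using om[OF Natural_vsucc] \<mu>_eq mem_irrefl by metis
    then have "\<xi> = omega \<or> mem omega \<xi>" using Ordinal_linear[OF \<xi>O Ordinal_omega] by auto
    then have om\<xi>: "mem k \<xi>" if "Natural k" for k
      using that Ordinal_trans[OF \<xi>O, of omega k] by auto
    define F where "F x = (if x = vempty then \<xi> else if Natural x then vUnion x else x)" for x
    have F: "DF F" unfolding F_def by (intro D_intros)
    have F0: "F vempty = \<xi>" unfolding F_def by simp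
    have Fs: "F (vsucc k) = k" if "Natural k" for k
      using that Natural_vsucc[OF that] vUnion_vsucc[OF Natural_Ordinal[OF that]] unfolding F_def by simp
    have Fi: "F x = x" if "\<not> Natural x" for x using that Natural_vempty unfolding F_def by auto
    have cases: "x = vempty \<or> (\<exists>k. Natural k \<and> x = vsucc k) \<or> \<not> Natural x" for x :: 'a
      using Natural_cases by blast
    have "Bij (vlam \<xi> F) \<xi> \<mu>" unfolding Bij_def mem_Collect_eq Ball_def
    proof (intro conjI allI impI)
      show "is_fun (vlam \<xi> F) \<xi> \<mu>"
      proof (rule vlam_fun[OF F])
        show "mem (F x) \<mu>" if "mem x \<xi>" for x
          using cases[of x] F0 Fs Fi om that \<mu>_eq by (metis mem_vsucc)
      qed
      fix y assume "mem y \<mu>"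
      then have y: "y = \<xi> \<or> mem y \<xi>" using \<mu>_eq by simp
      have inj: "x = x'" if "F x = F x'" "mem x \<xi>" "mem x' \<xi>" for x x'
        using cases[of x] cases[of x'] F0 Fs Fi that \<xi>n mem_irrefl by metis
      have "\<exists>x. mem x \<xi> \<and> F x = y"
        using y F0 Fs[of y] Fi[of y] om\<xi>[OF Natural_vempty] om\<xi>[OF Natural_vsucc[of y]] by metis
      then show "\<exists>!x. mem x \<xi> \<and> app (vlam \<xi> F) x = y"
        using inj by (auto simp: app_vlam[OF F])
    qed
    then show False using nb[OF \<xi>] by blast
  qed
qed

section \<open>Recursion and collection\<close>

text \<open>
  Definite description with a default value, so that it preserves definability.
\<close>

definition the0 :: "('a::ZF \<Rightarrow> bool) \<Rightarrow> 'a" where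
  "the0 P = (if \<exists>!y. P y then THE y. P y else vempty)"

lemma the0_eq: "P y \<Longrightarrow> (\<And>z. P z \<Longrightarrow> z = y) \<Longrightarrow> the0 P = y"
  unfolding the0_def by (metis the_equality)

lemma the0_prop: "\<exists>!y. P y \<Longrightarrow> P (the0 P)"
  unfolding the0_def by (simp add: theI')

lemma DF_the0 [D_intros]:
  assumes "D (\<lambda>z. P (vfst z) (vsnd z))" shows "DF (\<lambda>x. the0 (P x))"
proof (rule DF_graph)
  show "D (\<lambda>z. (\<exists>!y. P (vfst z) y) \<and> P (vfst z) (vsnd z) \<or> \<not> (\<exists>!y. P (vfst z) y) \<and> vsnd z = vempty)"
    by (intro D_intros D_comp2[where P = P, OF assms])
  show "y = the0 (P x) \<longleftrightarrow> (\<exists>!y. P x y) \<and> P x y \<or> \<not> (\<exists>!y. P x y) \<and> y = vempty" for x y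
  proof (cases "\<exists>!y. P x y")
    case True
    then have "P x (the0 (P x))" by (rule the0_prop)
    then show ?thesis using True by blast
  qed (simp add: the0_def)
qed

lemma sep_ex: "D P \<Longrightarrow> \<exists>b. \<forall>x. mem x b \<longleftrightarrow> mem x a \<and> P x"
  using mem_vset[OF small_sep[of P a]] by (intro exI[of _ "vset {x \<in> elts a. P x}"]) simp

lemma vlam_cong: "(\<And>x. mem x A \<Longrightarrow> F x = G x) \<Longrightarrow> vlam A F = vlam A G"
  unfolding vlam_def by (rule arg_cong[of _ _ vset]) auto

lemma vapp_vlam: "DF F \<Longrightarrow> mem x A \<Longrightarrow> vapp (vlam A F) x = F x"
  by (metis vlam_fun_ex vapp_app app_vlam)

text \<open>
  Recursion along a transitive set-like relation; \<open>Pd x\<close> is the set of predecessors of \<open>x\<close>. An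
  approximation at \<open>x\<close> is a set function with domain exactly \<open>Pd x\<close> that obeys the recursion. As its domain is
  determined by \<open>x\<close>, there is one and only one, and the recursive function is definable by speaking about it.
\<close>

lemma wf_recursion:
  fixes Pd :: "'a::ZF \<Rightarrow> 'a" and G :: "'a \<Rightarrow> 'a \<Rightarrow> 'a"
  assumes Pd: "DF Pd"
    and tr: "\<And>x y z. mem y (Pd x) \<Longrightarrow> mem z (Pd y) \<Longrightarrow> mem z (Pd x)"
    and ind: "\<And>Q x. D Q \<Longrightarrow> (\<And>x. (\<And>y. mem y (Pd x) \<Longrightarrow> Q y) \<Longrightarrow> Q x) \<Longrightarrow> Q x"
    and G: "DF (\<lambda>z. G (vfst z) (vsnd z))"
  shows "\<exists>F. DF F \<and> (\<forall>x. F x = G x (vlam (Pd x) F))"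
proof -
  define att where "att x f \<longleftrightarrow> f = vlam (Pd x) (\<lambda>y. G y (vlam (Pd y) (vapp f)))" for x f
  define A where "A x = the0 (att x)" for x
  note DG = DF_comp2[where F = G, OF G] Pd[THEN DF_comp]
  have Datt: "D (\<lambda>z. att (vfst z) (vsnd z))"
    unfolding att_def by (intro D_intros DG)
  have A: "DF A" unfolding A_def by (intro D_intros Datt)
  have GA: "DF (\<lambda>y. G y (A y))" by (intro D_intros DG A)
  have Gf: "DF (\<lambda>y. G y (vlam (Pd y) (vapp f)))" for f by (intro D_intros DG)
  have val: "vapp f y = G y (vlam (Pd y) (vapp f))" if "att x f" "mem y (Pd x)" for x f y
    using that vapp_vlam[OF Gf that(2)] unfolding att_def by metis
  have restr: "att y (vlam (Pd y) (vapp f))" if f: "att x f" and y: "mem y (Pd x)" for x f y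
    unfolding att_def
  proof (rule vlam_cong)
    fix z assume z: "mem z (Pd y)"
    have "vapp f z = G z (vlam (Pd z) (vapp f))" using val[OF f tr[OF y z]] .
    also have "vlam (Pd z) (vapp f) = vlam (Pd z) (vapp (vlam (Pd y) (vapp f)))"
      by (rule vlam_cong) (simp add: vapp_vlam D_intros tr[OF z])
    finally show "vapp f z = G z (vlam (Pd z) (vapp (vlam (Pd y) (vapp f))))" .
  qed
  have ex1: "\<exists>!f. att x f" for x
  proof (rule ind[of "\<lambda>x. \<exists>!f. att x f"])
    show "D (\<lambda>x. \<exists>!f. att x f)" by (intro D_intros Datt)
    fix x assume "\<And>y. mem y (Pd x) \<Longrightarrow> \<exists>!f. att y f"
    then have Aatt: "att y (A y)" and uniq: "\<And>f. att y f \<Longrightarrow> f = A y" if "mem y (Pd x)" for y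
      unfolding A_def using the0_prop[of "att y"] that by blast+
    have eq: "f = vlam (Pd x) (\<lambda>y. G y (A y))" if f: "att x f" for f
    proof -
      have "f = vlam (Pd x) (\<lambda>y. G y (vlam (Pd y) (vapp f)))" using f unfolding att_def .
      also have "\<dots> = vlam (Pd x) (\<lambda>y. G y (A y))"
        by (rule vlam_cong) (metis uniq restr[OF f])
      finally show ?thesis .
    qed
    have "att x (vlam (Pd x) (\<lambda>y. G y (A y)))" (is "att x ?f")
      unfolding att_def
    proof (rule vlam_cong)
      fix y assume y: "mem y (Pd x)"
      have "vlam (Pd y) (vapp ?f) = vlam (Pd y) (\<lambda>z. G z (vlam (Pd z) (vapp (A y))))"
      proof (rule vlam_cong)
        fix z assume z: "mem z (Pd y)"
        have "vlam (Pd z) (vapp (A y)) = A z" using uniq[OF tr[OF y z] restr[OF Aatt[OF y] z]] .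
        then show "vapp ?f z = G z (vlam (Pd z) (vapp (A y)))"
          by (simp add: vapp_vlam[OF GA tr[OF y z]])
      qed
      also have "\<dots> = A y" using Aatt[OF y] unfolding att_def by simp
      finally show "G y (A y) = G y (vlam (Pd y) (vapp ?f))" by simp
    qed
    then show "\<exists>!f. att x f" using eq by metis
  qed
  have Aatt: "att x (A x)" for x unfolding A_def by (rule the0_prop[OF ex1])
  have "A x = vlam (Pd x) (\<lambda>y. G y (A y))" for x
  proof -
    have "A x = vlam (Pd x) (\<lambda>y. G y (vlam (Pd y) (vapp (A x))))" using Aatt[of x] unfolding att_def .
    also have "\<dots> = vlam (Pd x) (\<lambda>y. G y (A y))"
      by (rule vlam_cong) (metis ex1 Aatt restr)
    finally show ?thesis .
  qed
  then have "\<forall>x. G x (A x) = G x (vlam (Pd x) (\<lambda>x. G x (A x)))" by metis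
  then show ?thesis using GA by blast
qed

lemma Ordinal_recursion:
  assumes G: "DF (\<lambda>z. G (vfst z) (vsnd z))"
  shows "\<exists>F. DF F \<and> (\<forall>x. Ordinal x \<longrightarrow> F x = G x (vlam x F))"
proof -
  define Pd :: "'a \<Rightarrow> 'a" where "Pd x = (if Ordinal x then x else vempty)" for x
  have 1: "DF Pd" unfolding Pd_def by (intro D_intros)
  have 2: "mem z (Pd x)" if "mem y (Pd x)" "mem z (Pd y)" for x y z
    using that unfolding Pd_def by (auto split: if_splits intro: Ordinal_trans)
  have 3: "Q x" if Q: "D Q" and step: "\<And>x. (\<And>y. mem y (Pd x) \<Longrightarrow> Q y) \<Longrightarrow> Q x" for Q x
  proof (cases "Ordinal x")
    case True
    with Q show ?thesis by (induction rule: Ordinal_induct) (rule step, simp add: Pd_def)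
  qed (rule step, simp add: Pd_def)
  have "\<exists>F. DF F \<and> (\<forall>x. F x = G x (vlam (Pd x) F))"
    by (rule wf_recursion[OF 1 _ _ G]) (fact 2, fact 3)
  then show ?thesis unfolding Pd_def by metis
qed

definition vUn :: "'a::ZF \<Rightarrow> 'a \<Rightarrow> 'a" where
  "vUn a b = vset (elts a \<union> elts b)"

lemma mem_vUn [simp]: "mem x (vUn a b) \<longleftrightarrow> mem x a \<or> mem x b"
  using mem_vset[of "elts a \<union> elts b" x] unfolding vUn_def by simp

lemma DF_vUn [D_intros]:
  assumes "DF f" "DF g" shows "DF (\<lambda>x. vUn (f x) (g x))"
  by (rule DF_char[where P = "\<lambda>x t. mem t (f x) \<or> mem t (g x)"])
     (intro D_intros assms[THEN DF_comp], simp)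

definition vUN :: "'a::ZF \<Rightarrow> ('a \<Rightarrow> 'a) \<Rightarrow> 'a" where
  "vUN a F = vset {z. \<exists>x. mem x a \<and> mem z (F x)}"

lemma mem_vUN: "DF F \<Longrightarrow> mem z (vUN a F) \<longleftrightarrow> (\<exists>x. mem x a \<and> mem z (F x))"
  using mem_vset[OF small_UN[of F a], of z] unfolding vUN_def by simp

lemma DF_vUN [D_intros]:
  assumes "DF A" "\<And>x. DF (F x)" "DF (\<lambda>z. F (vfst z) (vsnd z))"
  shows "DF (\<lambda>x. vUN (A x) (F x))"
  by (rule DF_char[where P = "\<lambda>x t. \<exists>y. mem y (A x) \<and> mem t (F x y)"])
     (intro D_intros assms(1)[THEN DF_comp] DF_comp2[where F = F, OF assms(3)], simp add: mem_vUN assms(2))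

text \<open>
  Transitive sets closed under subsets of elements and under adjoining an element to a set. They
  serve as bounds: they contain the pairs of their elements and, if \<open>\<omega>\<close> is an element, also the finite sequences,
  hence the codes of the terms and formulas of every vocabulary that they contain.
\<close>

definition Univ :: "'a::ZF \<Rightarrow> bool" where
  "Univ X \<longleftrightarrow> Transitive X \<and> (\<forall>x y. mem y X \<longrightarrow> elts x \<subseteq> elts y \<longrightarrow> mem x X) \<and>
     (\<forall>x y. mem x X \<longrightarrow> mem y X \<longrightarrow> mem (vinsert x y) X)"

text \<open>
  Start with \<open>{Y}\<close>, repeat \<open>z \<mapsto> z \<union> \<Union>z \<union> Pow z\<close> through the natural numbers, and take the union.
\<close>

lemma Univ_exists: obtains X where "Univ X" "mem Y X"
proof -
  define H where "H z = vUn z (vUn (vUnion z) (vPow z))" for z :: 'a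
  have H: "DF H" unfolding H_def by (intro D_intros)
  have DH: "DF (\<lambda>m. H (vapp f m))" for f by (intro D_intros H[THEN DF_comp])
  have "DF (\<lambda>z. vinsert Y (vUN (vfst z) (\<lambda>m. H (vapp (vsnd z) m))))"
    by (intro D_intros H[THEN DF_comp])
  from Ordinal_recursion[of "\<lambda>x f. vinsert Y (vUN x (\<lambda>m. H (vapp f m)))", OF this]
  obtain F where DF: "DF F" and F: "\<And>x. Ordinal x \<Longrightarrow> F x = vinsert Y (vUN x (\<lambda>m. H (vapp (vlam x F) m)))"
    by blast
  have F: "mem z (F x) \<longleftrightarrow> z = Y \<or> (\<exists>m. mem m x \<and> mem z (H (F m)))" if "Ordinal x" for x z
    unfolding F[OF that] by (auto simp: mem_vUN DH vapp_vlam[OF DF])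
  define X where "X = vUN omega F"
  have X: "mem z X \<longleftrightarrow> (\<exists>n. Natural n \<and> mem z (F n))" for z unfolding X_def by (simp add: mem_vUN DF)
  have mono: "mem z (F n)" if "mem z (F m)" "mem m n" "Natural n" for z m n
    using that F[OF Natural_Ordinal[OF that(3)], of z] by (auto simp: H_def)
  have step: "mem y (F (vsucc n))" if "Natural n" "mem x (F n)" "mem y x" for x y n
    using that F[OF Natural_Ordinal[OF Natural_vsucc[OF that(1)]], of y] by (auto simp: H_def)
  have pow: "mem x (F (vsucc n))" if "Natural n" "elts x \<subseteq> elts (F n)" for x n
    using that F[OF Natural_Ordinal[OF Natural_vsucc[OF that(1)]], of x] by (auto simp: H_def)
  have "mem Y X" using F[OF Ordinal_vempty, of Y] Natural_vempty X by blast
  moreover have "Transitive X" unfolding Transitive_iff X using step Natural_vsucc by blast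
  moreover have "mem x X" if yX: "mem y X" and xy: "elts x \<subseteq> elts y" for x y
  proof -
    obtain n where n: "Natural n" "mem y (F n)" using yX X by blast
    then have "elts x \<subseteq> elts (F (vsucc n))" using xy step[OF n] by blast
    from pow[OF Natural_vsucc[OF n(1)] this] show ?thesis using X Natural_vsucc n(1) by blast
  qed
  moreover have "mem (vinsert x y) X" if xy: "mem x X" "mem y X" for x y
  proof -
    obtain n m where nm: "Natural n" "mem x (F n)" "Natural m" "mem y (F m)" using xy X by blast
    obtain k where k: "Natural k" "mem x (F k)" "mem y (F k)"
      using nm mono Ordinal_linear[of n m] Natural_Ordinal by metis
    then have "elts (vinsert x y) \<subseteq> elts (F (vsucc k))"
      using step[OF k(1,3)] mono[OF k(2) _ Natural_vsucc[OF k(1)]] by auto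
    from pow[OF Natural_vsucc[OF k(1)] this] show ?thesis using X Natural_vsucc k(1) by blast
  qed
  ultimately show ?thesis using that[of X] unfolding Univ_def by blast
qed

lemma mem_induct:
  assumes "D P" "\<And>x. (\<And>y. mem y x \<Longrightarrow> P y) \<Longrightarrow> P x" shows "P a"
proof (rule ccontr)
  assume "\<not> P a"
  obtain X where X: "Univ X" "mem a X" using Univ_exists .
  obtain S where S: "\<And>x. mem x S \<longleftrightarrow> mem x X \<and> \<not> P x"
    using sep_ex[OF D_not[OF assms(1)], of X] by blast
  obtain b where b: "mem b S" "\<And>c. mem c b \<Longrightarrow> \<not> mem c S"
    using foundation_min[of a S] S X \<open>\<not> P a\<close> by blast
  then have "P c" if "mem c b" for c
    using that S X(1) unfolding Univ_def Transitive_iff by blast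
  then show False using assms(2) b(1) S by blast
qed

definition tc :: "'a::ZF \<Rightarrow> 'a" where
  "tc x = vset {z. \<forall>t. Transitive t \<and> (\<forall>y. mem y x \<longrightarrow> mem y t) \<longrightarrow> mem z t}"

lemma mem_tc: "mem z (tc x) \<longleftrightarrow> (\<forall>t. Transitive t \<and> (\<forall>y. mem y x \<longrightarrow> mem y t) \<longrightarrow> mem z t)"
proof -
  obtain X where "Univ X" "mem x X" using Univ_exists .
  then have "Transitive X \<and> (\<forall>y. mem y x \<longrightarrow> mem y X)" unfolding Univ_def Transitive_iff by blast
  then have "small {z. \<forall>t. Transitive t \<and> (\<forall>y. mem y x \<longrightarrow> mem y t) \<longrightarrow> mem z t}"
    by (intro small_subset[of _ X] D_intros) simp
  from mem_vset[OF this] show ?thesis unfolding tc_def by simp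
qed

lemma DF_tc: "DF tc"
  by (rule DF_char[OF _ mem_tc]) (intro D_intros)

lemma tc_base: "mem y x \<Longrightarrow> mem y (tc x)"
  unfolding mem_tc by blast

lemma tc_step: "mem y (tc x) \<Longrightarrow> mem z y \<Longrightarrow> mem z (tc x)"
  unfolding mem_tc Transitive_iff by blast

lemma tc_least: "mem z (tc x) \<Longrightarrow> Transitive t \<Longrightarrow> (\<And>y. mem y x \<Longrightarrow> mem y t) \<Longrightarrow> mem z t"
  unfolding mem_tc by blast

lemma tc_trans: "mem y (tc x) \<Longrightarrow> mem z (tc y) \<Longrightarrow> mem z (tc x)"
  by (erule tc_least) (auto simp: Transitive_iff intro: tc_step)

text \<open>
  The statement that \<open>Q\<close> holds on the whole transitive closure of \<open>x\<close> is inductive along \<open>\<in>\<close>: the elements of \<open>x\<close>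
  and of the transitive closures of these elements form a transitive set.
\<close>

lemma tc_induct:
  assumes Q: "D Q" and step: "\<And>x. (\<And>y. mem y (tc x) \<Longrightarrow> Q y) \<Longrightarrow> Q x" shows "Q x"
proof -
  have "\<forall>y. mem y (tc x) \<longrightarrow> Q y" for x
  proof (rule mem_induct[of "\<lambda>x. \<forall>y. mem y (tc x) \<longrightarrow> Q y"])
    show "D (\<lambda>x. \<forall>y. mem y (tc x) \<longrightarrow> Q y)" by (intro D_intros Q[THEN D_comp] DF_tc[THEN DF_comp])
    fix x assume ih: "\<And>y. mem y x \<Longrightarrow> \<forall>z. mem z (tc y) \<longrightarrow> Q z"
    have "D (\<lambda>z. Q z \<and> (mem z x \<or> (\<exists>y. mem y x \<and> mem z (tc y))))"
      by (intro D_intros Q[THEN D_comp] DF_tc[THEN DF_comp] Q)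
    from sep_ex[OF this, of "tc x"]
    obtain t where t: "\<And>z. mem z t \<longleftrightarrow> mem z (tc x) \<and> Q z \<and> (mem z x \<or> (\<exists>y. mem y x \<and> mem z (tc y)))"
      by blast
    have Qx: "Q y" if "mem y x" for y using step ih[OF that] by blast
    have "Transitive t" unfolding Transitive_iff t using tc_step tc_base ih by metis
    then show "\<forall>y. mem y (tc x) \<longrightarrow> Q y" using tc_least[of _ x t] t Qx tc_base by blast
  qed
  then show ?thesis using step by blast
qed

lemma mem_recursion:
  assumes "DF (\<lambda>z. G (vfst z) (vsnd z))"
  shows "\<exists>F. DF F \<and> (\<forall>x. F x = G x (vlam (tc x) F))"
  by (rule wf_recursion[OF DF_tc _ _ assms]) (fact tc_trans, fact tc_induct)

lemma Ordinal_vUnion: "(\<And>x. mem x a \<Longrightarrow> Ordinal x) \<Longrightarrow> Ordinal (vUnion a)"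
  unfolding Ordinal_iff Transitive_iff mem_vUnion by blast

text \<open>
  Replacement applied to the least suitable ordinal.
\<close>

lemma Ordinal_collection:
  fixes P :: "'a::ZF \<Rightarrow> 'a \<Rightarrow> bool"
  assumes P: "D (\<lambda>z. P (vfst z) (vsnd z))" and ex: "\<And>x. mem x a \<Longrightarrow> \<exists>\<alpha>. Ordinal \<alpha> \<and> P x \<alpha>"
  shows "\<exists>b. Ordinal b \<and> (\<forall>x. mem x a \<longrightarrow> (\<exists>\<alpha>. mem \<alpha> b \<and> P x \<alpha>))"
proof -
  define Q where "Q x \<alpha> \<longleftrightarrow> Ordinal \<alpha> \<and> P x \<alpha> \<and> (\<forall>\<beta>. mem \<beta> \<alpha> \<longrightarrow> \<not> P x \<beta>)" for x \<alpha>
  have Q: "D (\<lambda>z. Q (vfst z) (vsnd z))" unfolding Q_def by (intro D_intros D_comp2[where P = P, OF P])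
  define L where "L x = the0 (Q x)" for x
  have L: "DF L" unfolding L_def by (intro D_intros Q)
  have QL: "Q x (L x)" if x: "mem x a" for x
  proof -
    obtain \<alpha> where \<alpha>: "Ordinal \<alpha>" "P x \<alpha>" using ex[OF x] by blast
    have "D (P x)" by (intro D_comp2[where P = P, OF P] D_intros)
    from Ordinal_least[OF this \<alpha>] obtain b where "Q x b" unfolding Q_def by metis
    moreover have "Q x b \<Longrightarrow> Q x c \<Longrightarrow> b = c" for b c unfolding Q_def using Ordinal_linear[of b c] by blast
    ultimately have "\<exists>!\<alpha>. Q x \<alpha>" by (intro ex1I)
    then show ?thesis unfolding L_def by (rule the0_prop)
  qed
  have "small {z. \<exists>x. mem x a \<and> z = vsucc (L x)}" by (rule small_image_Collect) (intro D_intros L)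
  then obtain c where c: "\<And>z. mem z c \<longleftrightarrow> (\<exists>x. mem x a \<and> z = vsucc (L x))" 
    using mem_vset by blast
  have "Ordinal (vUnion c)" using QL by (intro Ordinal_vUnion) (auto simp: c Q_def)
  moreover have "\<exists>\<alpha>. mem \<alpha> (vUnion c) \<and> P x \<alpha>" if "mem x a" for x
    using QL[OF that] that unfolding Q_def mem_vUnion c by (intro exI[of _ "L x"]) auto
  ultimately show ?thesis by blast
qed

text \<open>
  Every set lies in some level of the cumulative hierarchy \<open>V\<close>, so it suffices to bound the least
  level that contains a witness. No choice of witnesses is made.
\<close>

lemma collection:
  fixes P :: "'a::ZF \<Rightarrow> 'a \<Rightarrow> bool"
  assumes P: "D (\<lambda>z. P (vfst z) (vsnd z))" and ex: "\<And>x. mem x a \<Longrightarrow> \<exists>y. P x y"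
  obtains b where "\<And>x. mem x a \<Longrightarrow> \<exists>y. mem y b \<and> P x y"
proof -
  have DU: "DF (\<lambda>m. vPow (vapp f m))" for f :: 'a by (intro D_intros)
  have "DF (\<lambda>z. vUN (vfst z) (\<lambda>m. vPow (vapp (vsnd z) m)))" by (intro D_intros)
  from Ordinal_recursion[of "\<lambda>x f. vUN x (\<lambda>m. vPow (vapp f m))", OF this]
  obtain V :: "'a \<Rightarrow> 'a" where V: "DF V" and VO: "\<And>x. Ordinal x \<Longrightarrow> V x = vUN x (\<lambda>m. vPow (vapp (vlam x V) m))"
    by blast
  have VO: "mem z (V x) \<longleftrightarrow> (\<exists>m. mem m x \<and> elts z \<subseteq> elts (V m))" if "Ordinal x" for x z
    unfolding VO[OF that] by (simp add: mem_vUN DU vapp_vlam[OF V] cong: conj_cong)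
  have mono: "mem z (V \<beta>)" if "mem z (V \<alpha>)" "mem \<alpha> \<beta>" "Ordinal \<beta>" for z \<alpha> \<beta>
    using that(1) unfolding VO[OF that(3)] VO[OF Ordinal_mem[OF that(3,2)]]
    using Ordinal_trans[OF that(3,2)] by blast
  have rank: "\<exists>\<alpha>. Ordinal \<alpha> \<and> mem x (V \<alpha>)" for x
  proof (rule mem_induct[of "\<lambda>x. \<exists>\<alpha>. Ordinal \<alpha> \<and> mem x (V \<alpha>)"])
    show "D (\<lambda>x. \<exists>\<alpha>. Ordinal \<alpha> \<and> mem x (V \<alpha>))" by (intro D_intros V[THEN DF_comp])
    fix x assume ih: "\<And>y. mem y x \<Longrightarrow> \<exists>\<alpha>. Ordinal \<alpha> \<and> mem y (V \<alpha>)"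
    have "D (\<lambda>z. mem (vfst z) (V (vsnd z)))" by (intro D_intros V[THEN DF_comp])
    from Ordinal_collection[of "\<lambda>y \<alpha>. mem y (V \<alpha>)", OF this ih]
    obtain b where b: "Ordinal b" "\<And>y. mem y x \<Longrightarrow> \<exists>\<alpha>. mem \<alpha> b \<and> mem y (V \<alpha>)" by blast
    then have "elts x \<subseteq> elts (V b)" using mono by blast
    then have "mem x (V (vsucc b))" using VO[of "vsucc b"] b(1) by auto
    then show "\<exists>\<alpha>. Ordinal \<alpha> \<and> mem x (V \<alpha>)" using b(1) Ordinal_vsucc by blast
  qed
  have 1: "D (\<lambda>z. \<exists>y. mem y (V (vsnd z)) \<and> P (vfst z) y)"
    by (intro D_intros V[THEN DF_comp] D_comp2[where P = P, OF P])
  have 2: "\<exists>\<alpha>. Ordinal \<alpha> \<and> (\<exists>y. mem y (V \<alpha>) \<and> P x y)" if "mem x a" for x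
    using ex[OF that] rank by blast
  obtain b where b: "Ordinal b" "\<And>x. mem x a \<Longrightarrow> \<exists>\<alpha>. mem \<alpha> b \<and> (\<exists>y. mem y (V \<alpha>) \<and> P x y)"
    using Ordinal_collection[of "\<lambda>x \<alpha>. \<exists>y. mem y (V \<alpha>) \<and> P x y" a, OF 1 2] by blast
  have "\<exists>y. mem y (V b) \<and> P x y" if "mem x a" for x using mono b(1) b(2)[OF that] by blast
  then show ?thesis by (rule that)
qed

lemma Univ_trans: "Univ X \<Longrightarrow> mem x X \<Longrightarrow> mem y x \<Longrightarrow> mem y X"
  unfolding Univ_def Transitive_iff by blast

lemma Univ_subset: "Univ X \<Longrightarrow> mem y X \<Longrightarrow> (\<And>z. mem z x \<Longrightarrow> mem z y) \<Longrightarrow> mem x X"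
  by (metis Univ_def mem_Collect_eq subsetI)

lemma Univ_insert: "Univ X \<Longrightarrow> mem x X \<Longrightarrow> mem y X \<Longrightarrow> mem (vinsert x y) X"
  unfolding Univ_def by auto

lemma vpair_vinsert: "\<langle>x, y\<rangle> = vinsert (vinsert x vempty) (vinsert (vinsert x (vinsert y vempty)) vempty)"
proof -
  have 1: "vset {a} = vinsert a vempty" for a :: 'a
    by (rule elts_eqI) (use mem_vset[OF small_single] in simp)
  have 2: "vset {a, b} = vinsert a (vinsert b vempty)" for a b :: 'a
    by (rule elts_eqI) (use mem_vset[OF small_pair] in simp)
  show ?thesis unfolding vpair_def 2 1 ..
qed

lemma Univ_vempty: "Univ X \<Longrightarrow> mem y X \<Longrightarrow> mem vempty X"
  by (rule Univ_subset) auto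

lemma Univ_vpair: "Univ X \<Longrightarrow> mem \<langle>x, y\<rangle> X \<longleftrightarrow> mem x X \<and> mem y X"
proof
  assume X: "Univ X" and p: "mem \<langle>x, y\<rangle> X"
  have 1: "mem (vinsert x (vinsert y vempty)) \<langle>x, y\<rangle>" unfolding vpair_vinsert by simp
  show "mem x X \<and> mem y X" using Univ_trans[OF X Univ_trans[OF X p 1]] by simp
next
  assume X: "Univ X" and p: "mem x X \<and> mem y X"
  then show "mem \<langle>x, y\<rangle> X" unfolding vpair_vinsert by (intro Univ_insert) (auto intro: Univ_vempty)
qed

lemma Univ_finite_fun:
  assumes X: "Univ X" and k: "mem k omega" and u: "is_fun u k X" and ne: "mem k X"
  shows "mem u X"
proof -
  have "D (\<lambda>k. \<forall>u. is_fun u k X \<longrightarrow> mem k X \<longrightarrow> mem u X)" by (intro D_intros)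
  then have "\<forall>u. is_fun u k X \<longrightarrow> mem k X \<longrightarrow> mem u X" using k
  proof (induction rule: nat_induct)
    case zero
    then show ?case using fun_from_vempty by metis
  next
    case (succ k)
    show ?case
    proof (intro allI impI)
      fix u assume u: "is_fun u (vsucc k) X" and kX: "mem (vsucc k) X"
      have "mem k X" using Univ_trans[OF X kX] by simp
      moreover have r: "is_fun (vlam k (vapp u)) k X" by (rule vlam_restrict[OF u]) simp
      ultimately have "mem (vlam k (vapp u)) X" "mem \<langle>k, app u k\<rangle> X"
        using succ.IH fun_val[OF u, of k] by (auto simp: Univ_vpair[OF X])
      then have "mem (vinsert \<langle>k, app u k\<rangle> (vlam k (vapp u))) X" by (intro Univ_insert X)
      moreover have "u = vinsert \<langle>k, app u k\<rangle> (vlam k (vapp u))"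
        by (subst fun_vsucc_snoc[OF u], rule elts_eqI) (auto simp: mem_snoc)
      ultimately show "mem u X" by simp
    qed
  qed
  then show ?thesis using u ne by blast
qed

section \<open>Syntax\<close>

lemmas symbol_defs = relsym_def funsym_def consym_def
lemmas tm_defs = var_tm_def con_tm_def fun_tm_def
lemmas fm_defs = eq_fm_def rel_fm_def neg_fm_def and_fm_def ex_fm_def

lemma symbol_inject [simp]:
  "relsym k a = relsym k' a' \<longleftrightarrow> k = k' \<and> a = a'" "funsym k a = funsym k' a' \<longleftrightarrow> k = k' \<and> a = a'"
  "consym a = consym a' \<longleftrightarrow> a = a'" "relsym k a \<noteq> funsym k' a'" "relsym k a \<noteq> consym a'"
  "funsym k a \<noteq> relsym k' a'" "funsym k a \<noteq> consym a'" "consym a \<noteq> relsym k' a'" "consym a \<noteq> funsym k' a'"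
  by (simp_all add: symbol_defs)

lemma DF_symbols1 [D_intros]:
  assumes "DF f"
  shows "DF (\<lambda>x. consym (f x))" "DF (\<lambda>x. var_tm (f x))" "DF (\<lambda>x. con_tm (f x))"
    "DF (\<lambda>x. neg_fm (f x))" "DF (\<lambda>x. ex_fm (f x))"
  unfolding symbol_defs tm_defs fm_defs by (intro D_intros assms)+

lemma DF_symbols2 [D_intros]:
  assumes "DF f" "DF g"
  shows "DF (\<lambda>x. relsym (f x) (g x))" "DF (\<lambda>x. funsym (f x) (g x))" "DF (\<lambda>x. fun_tm (f x) (g x))"
    "DF (\<lambda>x. eq_fm (f x) (g x))" "DF (\<lambda>x. rel_fm (f x) (g x))" "DF (\<lambda>x. and_fm (f x) (g x))"
  unfolding symbol_defs tm_defs fm_defs by (intro D_intros assms)+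

lemma Vocabulary_iff: "Vocabulary \<tau> \<longleftrightarrow> (\<forall>x. mem x \<tau> \<longrightarrow> (\<exists>k a. mem k omega \<and> (x = relsym k a \<or> x = funsym k a)) \<or> (\<exists>a. x = consym a))"
  unfolding Vocabulary_def by (simp del: mem_omega) blast

lemma D_Vocabulary [D_intros]: assumes "DF t" shows "D (\<lambda>x. Vocabulary (t x))"
  unfolding Vocabulary_iff by (intro D_intros assms[THEN DF_comp])

lemma Vocabulary_arity:
  assumes "Vocabulary \<tau>"
  shows "mem (relsym k a) \<tau> \<Longrightarrow> Natural k" "mem (funsym k a) \<tau> \<Longrightarrow> Natural k"
  using assms unfolding Vocabulary_iff by (force simp del: mem_omega simp: mem_omega[symmetric])+

text \<open>
  If \<open>\<tau>\<close> is not a vocabulary, its symbols may have arbitrary sets as arities, and it is not clear that the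
  terms form a set. Replacing such \<open>\<tau>\<close> by the empty vocabulary makes the notions of term and formula
  definable for all arguments.
\<close>

definition voc :: "'a::ZF \<Rightarrow> 'a" where
  "voc \<tau> = (if Vocabulary \<tau> then \<tau> else vempty)"

lemma Vocabulary_voc [simp]: "Vocabulary (voc \<tau>)" and voc_eq [simp]: "Vocabulary \<tau> \<Longrightarrow> voc \<tau> = \<tau>"
  unfolding voc_def by (auto simp: Vocabulary_iff)

lemma DF_voc [D_intros]: assumes "DF t" shows "DF (\<lambda>x. voc (t x))"
  unfolding voc_def by (intro D_intros assms)

lemma closed_tm_iff: "closed_tm \<tau> n X \<longleftrightarrow> (\<forall>i. mem i n \<longrightarrow> mem (var_tm i) X) \<and>
     (\<forall>a. mem (consym a) \<tau> \<longrightarrow> mem (con_tm (consym a)) X) \<and>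
     (\<forall>k a u. mem (funsym k a) \<tau> \<and> is_fun u k X \<longrightarrow> mem (fun_tm (funsym k a) u) X)"
  unfolding closed_tm_def by simp

lemma D_closed_tm [D_intros]:
  assumes "DF t" "DF n" "DF X" shows "D (\<lambda>x. closed_tm (t x) (n x) (X x))"
  unfolding closed_tm_iff by (intro D_intros assms[THEN DF_comp])

lemma Univ_numerals:
  assumes X: "Univ X" "mem omega X"
  shows "Natural n \<Longrightarrow> mem n X" "mem vempty X" "mem v1 X" "mem v2 X" "mem v3 X" "mem v4 X"
proof -
  show *: "Natural n \<Longrightarrow> mem n X" for n using Univ_trans[OF X, of n] by simp
  show "mem vempty X" "mem v1 X" "mem v2 X" "mem v3 X" "mem v4 X"
    by (intro * Natural_vsucc Natural_vempty)+
qed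

lemma Univ_closed_tm:
  assumes X: "Univ X" "mem omega X" and \<tau>: "Vocabulary \<tau>" "mem \<tau> X" and n: "mem n X"
  shows "closed_tm \<tau> n X"
  unfolding closed_tm_iff
proof (intro conjI allI impI)
  note N = Univ_numerals[OF X]
  show "mem (var_tm i) X" if "mem i n" for i
    using Univ_trans[OF X(1) n that] N by (simp add: var_tm_def Univ_vpair[OF X(1)])
  show "mem (con_tm (consym a)) X" if "mem (consym a) \<tau>" for a
    using Univ_trans[OF X(1) \<tau>(2) that] N by (simp add: con_tm_def Univ_vpair[OF X(1)])
  fix k a u assume "mem (funsym k a) \<tau> \<and> is_fun u k X"
  then have f: "mem (funsym k a) \<tau>" and u: "is_fun u k X" by auto
  have k: "mem k omega" using Vocabulary_arity(2)[OF \<tau>(1) f] by simp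
  have "mem u X" by (rule Univ_finite_fun[OF X(1) k u]) (use k N in simp)
  then show "mem (fun_tm (funsym k a) u) X"
    using Univ_trans[OF X(1) \<tau>(2) f] N by (simp add: fun_tm_def Univ_vpair[OF X(1)])
qed

lemma mem_Tms: 
  assumes "Vocabulary \<tau>" shows "mem t (Tms \<tau> n) \<longleftrightarrow> (\<forall>X. closed_tm \<tau> n X \<longrightarrow> mem t X)"
proof -
  obtain X where X: "Univ X" "mem \<langle>omega, \<langle>\<tau>, n\<rangle>\<rangle> X" using Univ_exists .
  then have "closed_tm \<tau> n X" using assms by (intro Univ_closed_tm) (auto simp: Univ_vpair)
  then have "small {t. \<forall>X. closed_tm \<tau> n X \<longrightarrow> t \<in> elts X}"
    by (intro small_subset[of _ X] D_intros) simp
  from mem_vset[OF this] show ?thesis unfolding Tms_def by simp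
qed

lemma Tms_subset: "Vocabulary \<tau> \<Longrightarrow> closed_tm \<tau> n X \<Longrightarrow> mem t (Tms \<tau> n) \<Longrightarrow> mem t X"
  by (simp add: mem_Tms)

lemma is_fun_mono: "is_fun f A B \<Longrightarrow> (\<And>x. mem x B \<Longrightarrow> mem x C) \<Longrightarrow> is_fun f A C"
  by (rule fun_codom[of f A B]) (auto dest: fun_val)

lemma closed_tm_Tms: assumes "Vocabulary \<tau>" shows "closed_tm \<tau> n (Tms \<tau> n)"
proof -
  have *: "is_fun u k X" if "is_fun u k (Tms \<tau> n)" "closed_tm \<tau> n X" for u k X
    using is_fun_mono[OF that(1)] Tms_subset[OF assms that(2)] by blast
  show ?thesis unfolding closed_tm_iff
  proof (intro conjI allI impI)
    show "mem (var_tm i) (Tms \<tau> n)" if "mem i n" for i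
      using that unfolding mem_Tms[OF assms] closed_tm_iff by blast
    show "mem (con_tm (consym a)) (Tms \<tau> n)" if "mem (consym a) \<tau>" for a
      using that unfolding mem_Tms[OF assms] closed_tm_iff by blast
    show "mem (fun_tm (funsym k a) u) (Tms \<tau> n)" if "mem (funsym k a) \<tau> \<and> is_fun u k (Tms \<tau> n)" for k a u
      using that * unfolding mem_Tms[OF assms] closed_tm_iff[of \<tau> n] by blast
  qed
qed

lemma
  assumes "Vocabulary \<tau>"
  shows Tms_var: "mem i n \<Longrightarrow> mem (var_tm i) (Tms \<tau> n)"
    and Tms_con: "mem (consym a) \<tau> \<Longrightarrow> mem (con_tm (consym a)) (Tms \<tau> n)"
    and Tms_fun: "mem (funsym k a) \<tau> \<Longrightarrow> is_fun u k (Tms \<tau> n) \<Longrightarrow> mem (fun_tm (funsym k a) u) (Tms \<tau> n)"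
  using closed_tm_Tms[OF assms, of n] unfolding closed_tm_iff by blast+

lemma Tms_induct [consumes 3, case_names var con func]:
  assumes "D P" "Vocabulary \<tau>" "mem t (Tms \<tau> n)"
    and var: "\<And>i. mem i n \<Longrightarrow> P (var_tm i)"
    and con: "\<And>a. mem (consym a) \<tau> \<Longrightarrow> P (con_tm (consym a))"
    and func: "\<And>k a u. mem (funsym k a) \<tau> \<Longrightarrow> is_fun u k (Tms \<tau> n) \<Longrightarrow> (\<And>i. mem i k \<Longrightarrow> P (app u i)) \<Longrightarrow>
      P (fun_tm (funsym k a) u)"
  shows "P t"
proof -
  obtain X where X: "\<And>t. mem t X \<longleftrightarrow> mem t (Tms \<tau> n) \<and> P t" using sep_ex[OF assms(1)] by blast
  have "closed_tm \<tau> n X" unfolding closed_tm_iff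
  proof (intro conjI allI impI)
    fix k a u assume "mem (funsym k a) \<tau> \<and> is_fun u k X"
    then have f: "mem (funsym k a) \<tau>" and u: "is_fun u k X" by auto
    have "is_fun u k (Tms \<tau> n)" by (rule is_fun_mono[OF u]) (simp add: X)
    moreover have "P (app u i)" if "mem i k" for i using fun_val[OF u that] X by simp
    ultimately show "mem (fun_tm (funsym k a) u) X" using func[OF f] Tms_fun[OF assms(2) f] X by blast
  qed (use X var con Tms_var[OF assms(2)] Tms_con[OF assms(2)] in blast)+
  then show ?thesis using Tms_subset[OF assms(2) _ assms(3)] X by blast
qed

lemma DF_Tms [D_intros]:
  assumes "DF t" "DF n" shows "DF (\<lambda>x. Tms (voc (t x)) (n x))"
  by (rule DF_char[where P = "\<lambda>x z. \<forall>X. closed_tm (voc (t x)) (n x) X \<longrightarrow> mem z X"])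
     (intro D_intros assms[THEN DF_comp], simp add: mem_Tms)

lemma closed_fm_iff: "closed_fm \<tau> X \<longleftrightarrow> (\<forall>n. mem n omega \<longrightarrow>
     (\<forall>t u. mem t (Tms \<tau> n) \<and> mem u (Tms \<tau> n) \<longrightarrow> mem \<langle>n, eq_fm t u\<rangle> X) \<and>
     (\<forall>k a u. mem (relsym k a) \<tau> \<and> is_fun u k (Tms \<tau> n) \<longrightarrow> mem \<langle>n, rel_fm (relsym k a) u\<rangle> X) \<and>
     (\<forall>\<phi>. mem \<langle>n, \<phi>\<rangle> X \<longrightarrow> mem \<langle>n, neg_fm \<phi>\<rangle> X) \<and>
     (\<forall>\<phi> \<psi>. mem \<langle>n, \<phi>\<rangle> X \<and> mem \<langle>n, \<psi>\<rangle> X \<longrightarrow> mem \<langle>n, and_fm \<phi> \<psi>\<rangle> X) \<and>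
     (\<forall>\<phi>. mem \<langle>vsucc n, \<phi>\<rangle> X \<longrightarrow> mem \<langle>n, ex_fm \<phi>\<rangle> X))"
  unfolding closed_fm_def mem_Collect_eq Ball_def by blast

lemma D_closed_fm [D_intros]:
  assumes "DF t" "DF X" shows "D (\<lambda>x. closed_fm (voc (t x)) (X x))"
  unfolding closed_fm_iff by (intro D_intros assms[THEN DF_comp])

lemma D_Form [D_intros]:
  assumes "DF t" "DF n" "DF f" shows "D (\<lambda>x. Form (voc (t x)) (n x) (f x))"
  unfolding Form_def by (intro D_intros assms[THEN DF_comp])

lemma Univ_closed_fm:
  assumes X: "Univ X" "mem omega X" and \<tau>: "Vocabulary \<tau>" "mem \<tau> X"
  shows "closed_fm \<tau> X"
  unfolding closed_fm_iff
proof (intro allI impI)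
  fix n :: 'a assume n: "mem n omega"
  note N = Univ_numerals[OF X]
  have nX: "mem n X" using n N by simp
  have tm: "mem t X" if "mem t (Tms \<tau> n)" for t
    using Tms_subset[OF \<tau>(1) Univ_closed_tm[OF X \<tau> nX] that] .
  have "mem \<langle>n, rel_fm (relsym k a) u\<rangle> X" if "mem (relsym k a) \<tau> \<and> is_fun u k (Tms \<tau> n)" for k a u
  proof -
    have f: "mem (relsym k a) \<tau>" and u: "is_fun u k X" using that is_fun_mono tm by blast+
    have k: "mem k omega" using Vocabulary_arity(1)[OF \<tau>(1) f] by simp
    have "mem u X" by (rule Univ_finite_fun[OF X(1) k u]) (use k N in simp)
    then show ?thesis
      using Univ_trans[OF X(1) \<tau>(2) f] N nX by (simp add: fm_defs Univ_vpair[OF X(1)])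
  qed
  then show "(\<forall>t u. mem t (Tms \<tau> n) \<and> mem u (Tms \<tau> n) \<longrightarrow> mem \<langle>n, eq_fm t u\<rangle> X) \<and>
     (\<forall>k a u. mem (relsym k a) \<tau> \<and> is_fun u k (Tms \<tau> n) \<longrightarrow> mem \<langle>n, rel_fm (relsym k a) u\<rangle> X) \<and>
     (\<forall>\<phi>. mem \<langle>n, \<phi>\<rangle> X \<longrightarrow> mem \<langle>n, neg_fm \<phi>\<rangle> X) \<and>
     (\<forall>\<phi> \<psi>. mem \<langle>n, \<phi>\<rangle> X \<and> mem \<langle>n, \<psi>\<rangle> X \<longrightarrow> mem \<langle>n, and_fm \<phi> \<psi>\<rangle> X) \<and>
     (\<forall>\<phi>. mem \<langle>vsucc n, \<phi>\<rangle> X \<longrightarrow> mem \<langle>n, ex_fm \<phi>\<rangle> X)"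
    using N nX tm by (auto simp: fm_defs Univ_vpair[OF X(1)])
qed

lemma closed_fm_exists:
  assumes "Vocabulary \<tau>" obtains X where "closed_fm \<tau> X"
proof -
  obtain X where X: "Univ X" "mem \<langle>omega, \<tau>\<rangle> X" using Univ_exists .
  then show ?thesis using that[of X] assms by (intro that Univ_closed_fm) (auto simp: Univ_vpair)
qed

lemma
  assumes n: "Natural n"
  shows Form_eq: "mem t (Tms \<tau> n) \<Longrightarrow> mem u (Tms \<tau> n) \<Longrightarrow> Form \<tau> n (eq_fm t u)"
    and Form_rel: "mem (relsym k a) \<tau> \<Longrightarrow> is_fun u k (Tms \<tau> n) \<Longrightarrow> Form \<tau> n (rel_fm (relsym k a) u)"
    and Form_neg: "Form \<tau> n \<phi> \<Longrightarrow> Form \<tau> n (neg_fm \<phi>)"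
    and Form_and: "Form \<tau> n \<phi> \<Longrightarrow> Form \<tau> n \<psi> \<Longrightarrow> Form \<tau> n (and_fm \<phi> \<psi>)"
    and Form_ex: "Form \<tau> (vsucc n) \<phi> \<Longrightarrow> Form \<tau> n (ex_fm \<phi>)"
proof goal_cases
  have n: "mem n omega" using n by simp
  note c = closed_fm_iff[THEN iffD1, THEN spec, THEN mp, OF _ n]
  note F = Form_def mem_Collect_eq
  { case 1 then show ?case unfolding F using c by blast }
  { case 2 then show ?case unfolding F using c by blast }
  { case 3 then show ?case unfolding F using c by blast }
  { case 4 then show ?case unfolding F using c by blast }
  { case 5 then show ?case unfolding F using c by blast }
qed

text \<open>
  The formulas with the property \<open>P\<close> are separated from any closed set and form a closed set again.
\<close>

lemma Form_induct [consumes 4, case_names eq rel neg conj ex]: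
  assumes P: "D (\<lambda>z. P (vfst z) (vsnd z))" and \<tau>: "Vocabulary \<tau>" and "Natural n" "Form \<tau> n \<phi>"
    and "\<And>n t u. Natural n \<Longrightarrow> mem t (Tms \<tau> n) \<Longrightarrow> mem u (Tms \<tau> n) \<Longrightarrow> P n (eq_fm t u)"
    and "\<And>n k a u. Natural n \<Longrightarrow> mem (relsym k a) \<tau> \<Longrightarrow> is_fun u k (Tms \<tau> n) \<Longrightarrow> P n (rel_fm (relsym k a) u)"
    and "\<And>n \<phi>. Natural n \<Longrightarrow> Form \<tau> n \<phi> \<Longrightarrow> P n \<phi> \<Longrightarrow> P n (neg_fm \<phi>)"
    and "\<And>n \<phi> \<psi>. Natural n \<Longrightarrow> Form \<tau> n \<phi> \<Longrightarrow> P n \<phi> \<Longrightarrow> Form \<tau> n \<psi> \<Longrightarrow> P n \<psi> \<Longrightarrow> P n (and_fm \<phi> \<psi>)"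
    and "\<And>n \<phi>. Natural n \<Longrightarrow> Form \<tau> (vsucc n) \<phi> \<Longrightarrow> P (vsucc n) \<phi> \<Longrightarrow> P n (ex_fm \<phi>)"
  shows "P n \<phi>"
proof -
  obtain Y where Y: "closed_fm \<tau> Y" using closed_fm_exists[OF \<tau>] .
  have "D (\<lambda>z. Form (voc \<tau>) (vfst z) (vsnd z) \<and> P (vfst z) (vsnd z))" by (intro D_intros P)
  from sep_ex[OF this, of Y] obtain X where
    "\<And>z. mem z X \<longleftrightarrow> mem z Y \<and> Form \<tau> (vfst z) (vsnd z) \<and> P (vfst z) (vsnd z)" using \<tau> by auto
  then have X: "mem \<langle>n, \<phi>\<rangle> X \<longleftrightarrow> Form \<tau> n \<phi> \<and> P n \<phi>" for n \<phi>
    using Y unfolding Form_def mem_Collect_eq by auto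
  have "closed_fm \<tau> X" unfolding closed_fm_iff X mem_omega
    by (intro allI impI conjI; elim conjE; intro Form_eq Form_rel Form_neg Form_and Form_ex assms(5-9); assumption)
  then have "mem \<langle>n, \<phi>\<rangle> X" using \<open>Form \<tau> n \<phi>\<close> unfolding Form_def by simp
  then show ?thesis using X by blast
qed

section \<open>Semantics\<close>

definition vsep :: "'a::ZF \<Rightarrow> ('a \<Rightarrow> bool) \<Rightarrow> 'a" where
  "vsep A Q = vset {p. mem p A \<and> Q p}"

lemma mem_vsep: "D Q \<Longrightarrow> mem p (vsep A Q) \<longleftrightarrow> mem p A \<and> Q p"
  using mem_vset[OF small_sep[of Q A], of p] unfolding vsep_def by simp

lemma DF_vsep [D_intros]:
  assumes "DF A" "\<And>x. D (Q x)" "D (\<lambda>z. Q (vfst z) (vsnd z))"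
  shows "DF (\<lambda>x. vsep (A x) (Q x))"
  by (rule DF_char[where P = "\<lambda>x p. mem p (A x) \<and> Q x p"])
     (intro D_intros assms(1)[THEN DF_comp] D_comp2[where P = Q, OF assms(3)], simp add: mem_vsep assms(2))

lemma mem_Pow_fun [simp]: "mem s (Pow_fun M k) \<longleftrightarrow> is_fun s k M"
proof -
  have "small {s. is_fun s k M}"
    by (rule small_subset[of _ "vPow (vprod k M)"], intro D_intros) (auto simp: fun_mem fun_val)
  from mem_vset[OF this] show ?thesis unfolding Pow_fun_def by simp
qed

lemma DF_Pow_fun [D_intros]:
  assumes "DF f" "DF g" shows "DF (\<lambda>x. Pow_fun (f x) (g x))"
  by (rule DF_char[where P = "\<lambda>x s. is_fun s (g x) (f x)"])
     (intro D_intros assms[THEN DF_comp], simp)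

lemma Structure_iff: "Structure \<tau> M I \<longleftrightarrow> (\<exists>Y. is_fun I \<tau> Y) \<and>
     (\<forall>k a. mem (relsym k a) \<tau> \<longrightarrow> elts (vapp I (relsym k a)) \<subseteq> elts (Pow_fun M k)) \<and>
     (\<forall>k a. mem (funsym k a) \<tau> \<longrightarrow> is_fun (vapp I (funsym k a)) (Pow_fun M k) M) \<and>
     (\<forall>a. mem (consym a) \<tau> \<longrightarrow> mem (vapp I (consym a)) M)"
proof (cases "\<exists>Y. is_fun I \<tau> Y")
  case True
  then have "mem x \<tau> \<Longrightarrow> vapp I x = app I x" for x using vapp_app by blast
  then show ?thesis unfolding Structure_def by simp
qed (simp add: Structure_def)

lemma D_Structure [D_intros]:
  assumes "DF t" "DF M" "DF I" shows "D (\<lambda>x. Structure (t x) (M x) (I x))"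
  unfolding Structure_iff by (intro D_intros assms[THEN DF_comp])

text \<open>
  Evaluation and truth with \<open>vapp\<close>, \<open>voc\<close> and \<open>the0\<close> in place of the partial operations: definable for all
  arguments, and equivalent to the original notions for structures of a vocabulary.
\<close>

definition is_eval' :: "'a::ZF \<Rightarrow> 'a \<Rightarrow> 'a \<Rightarrow> 'a \<Rightarrow> 'a \<Rightarrow> 'a \<Rightarrow> bool" where
  "is_eval' \<tau> M I n s e \<longleftrightarrow> is_fun e (Tms (voc \<tau>) n) M \<and>
     (\<forall>i. mem i n \<longrightarrow> vapp e (var_tm i) = vapp s i) \<and>
     (\<forall>a. mem (consym a) \<tau> \<longrightarrow> vapp e (con_tm (consym a)) = vapp I (consym a)) \<and>
     (\<forall>k a u. mem (funsym k a) \<tau> \<and> is_fun u k (Tms (voc \<tau>) n) \<longrightarrow>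
        vapp e (fun_tm (funsym k a) u) = vapp (vapp I (funsym k a)) (vcomp e u))"

lemma D_is_eval' [D_intros]:
  assumes "DF t" "DF M" "DF I" "DF n" "DF s" "DF e" shows "D (\<lambda>x. is_eval' (t x) (M x) (I x) (n x) (s x) (e x))"
  unfolding is_eval'_def by (intro D_intros assms[THEN DF_comp] assms)

definition eval' :: "'a::ZF \<Rightarrow> 'a \<Rightarrow> 'a \<Rightarrow> 'a \<Rightarrow> 'a \<Rightarrow> 'a" where
  "eval' \<tau> M I n s = the0 (is_eval' \<tau> M I n s)"

lemma DF_eval' [D_intros]:
  assumes "DF t" "DF M" "DF I" "DF n" "DF s" shows "DF (\<lambda>x. eval' (t x) (M x) (I x) (n x) (s x))"
  unfolding eval'_def by (intro D_intros assms[THEN DF_comp])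

definition is_truth' :: "'a::ZF \<Rightarrow> 'a \<Rightarrow> 'a \<Rightarrow> 'a \<Rightarrow> bool" where
  "is_truth' \<tau> M I S \<longleftrightarrow> (\<forall>n. mem n omega \<longrightarrow> (\<forall>s. is_fun s n M \<longrightarrow>
     (\<forall>t. mem t (Tms (voc \<tau>) n) \<longrightarrow> (\<forall>u. mem u (Tms (voc \<tau>) n) \<longrightarrow>
        (mem \<langle>\<langle>n, eq_fm t u\<rangle>, s\<rangle> S \<longleftrightarrow> vapp (eval' \<tau> M I n s) t = vapp (eval' \<tau> M I n s) u))) \<and>
     (\<forall>k a u. mem (relsym k a) \<tau> \<and> is_fun u k (Tms (voc \<tau>) n) \<longrightarrow>
        (mem \<langle>\<langle>n, rel_fm (relsym k a) u\<rangle>, s\<rangle> S \<longleftrightarrow> mem (vcomp (eval' \<tau> M I n s) u) (vapp I (relsym k a)))) \<and>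
     (\<forall>\<phi>. Form (voc \<tau>) n \<phi> \<longrightarrow> (mem \<langle>\<langle>n, neg_fm \<phi>\<rangle>, s\<rangle> S \<longleftrightarrow> \<not> mem \<langle>\<langle>n, \<phi>\<rangle>, s\<rangle> S)) \<and>
     (\<forall>\<phi> \<psi>. Form (voc \<tau>) n \<phi> \<and> Form (voc \<tau>) n \<psi> \<longrightarrow>
        (mem \<langle>\<langle>n, and_fm \<phi> \<psi>\<rangle>, s\<rangle> S \<longleftrightarrow> mem \<langle>\<langle>n, \<phi>\<rangle>, s\<rangle> S \<and> mem \<langle>\<langle>n, \<psi>\<rangle>, s\<rangle> S)) \<and>
     (\<forall>\<phi>. Form (voc \<tau>) (vsucc n) \<phi> \<longrightarrow>
        (mem \<langle>\<langle>n, ex_fm \<phi>\<rangle>, s\<rangle> S \<longleftrightarrow> (\<exists>a. mem a M \<and> mem \<langle>\<langle>vsucc n, \<phi>\<rangle>, snoc s n a\<rangle> S)))))"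

lemma D_is_truth' [D_intros]:
  assumes "DF t" "DF M" "DF I" "DF S" shows "D (\<lambda>x. is_truth' (t x) (M x) (I x) (S x))"
  unfolding is_truth'_def by (intro D_intros assms[THEN DF_comp])

definition Sat' :: "'a::ZF \<Rightarrow> 'a \<Rightarrow> 'a \<Rightarrow> 'a \<Rightarrow> 'a \<Rightarrow> 'a \<Rightarrow> bool" where
  "Sat' \<tau> M I n \<phi> s \<longleftrightarrow> (\<exists>S. is_truth' \<tau> M I S \<and> mem \<langle>\<langle>n, \<phi>\<rangle>, s\<rangle> S)"

lemma D_Sat' [D_intros]:
  assumes "DF t" "DF M" "DF I" "DF n" "DF f" "DF s" shows "D (\<lambda>x. Sat' (t x) (M x) (I x) (n x) (f x) (s x))"
  unfolding Sat'_def by (intro D_intros assms[THEN DF_comp])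

text \<open>
  A code lies above its immediate parts in the transitive closure, so terms and formulas admit
  recursion along \<open>tc\<close> without any appeal to unique readability beyond the injectivity of pairs.
\<close>

lemma tc_vpair: "mem x (tc \<langle>x, y\<rangle>)" "mem y (tc \<langle>x, y\<rangle>)"
proof -
  have "mem (vinsert x (vinsert y vempty)) (tc \<langle>x, y\<rangle>)"
    by (rule tc_base) (simp add: vpair_vinsert)
  then show "mem x (tc \<langle>x, y\<rangle>)" "mem y (tc \<langle>x, y\<rangle>)" by (auto intro: tc_step)
qed

lemma tc_app: "is_fun u k A \<Longrightarrow> mem i k \<Longrightarrow> mem (app u i) (tc u)"
  by (rule tc_trans[OF tc_base[of "\<langle>i, app u i\<rangle>"] tc_vpair(2)]) (simp add: fun_pair)

lemma tc_subterms:
  "is_fun u k A \<Longrightarrow> mem i k \<Longrightarrow> mem (app u i) (tc (fun_tm f u))"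
  "mem \<phi> (tc (neg_fm \<phi>))" "mem \<phi> (tc (and_fm \<phi> \<psi>))" "mem \<psi> (tc (and_fm \<phi> \<psi>))" "mem \<phi> (tc (ex_fm \<phi>))"
  unfolding tm_defs fm_defs using tc_trans tc_vpair tc_app by meson+

locale fo_structure =
  fixes \<tau> M I :: "'a::ZF"
  assumes voc_tau: "Vocabulary \<tau>" and struct: "Structure \<tau> M I"
begin

lemma vapp_I: "mem x \<tau> \<Longrightarrow> vapp I x = app I x"
  using struct vapp_app unfolding Structure_def by blast

lemma rel_I: "mem (relsym k a) \<tau> \<Longrightarrow> mem p (app I (relsym k a)) \<Longrightarrow> is_fun p k M"
  using struct unfolding Structure_def subset_iff by (simp add: subset_iff)

lemma fun_I: "mem (funsym k a) \<tau> \<Longrightarrow> is_fun (app I (funsym k a)) (Pow_fun M k) M"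
  using struct unfolding Structure_def by simp

lemma con_I: "mem (consym a) \<tau> \<Longrightarrow> mem (app I (consym a)) M"
  using struct unfolding Structure_def by simp

lemma vapp_fun_I: "mem (funsym k a) \<tau> \<Longrightarrow> is_fun v k M \<Longrightarrow> vapp (vapp I (funsym k a)) v = app (app I (funsym k a)) v"
  by (simp add: vapp_I vapp_app[OF fun_I])

lemma is_eval_eq: assumes s: "is_fun s n M" shows "is_eval \<tau> M I n s e \<longleftrightarrow> is_eval' \<tau> M I n s e"
proof (cases "is_fun e (Tms \<tau> n) M")
  case e: True
  note v = vapp_app[OF e]
  have "vapp e (fun_tm (funsym k a) u) = app e (fun_tm (funsym k a) u)"
    "vapp (vapp I (funsym k a)) (vcomp e u) = app (app I (funsym k a)) (vcomp e u)"
    if "mem (funsym k a) \<tau> \<and> is_fun u k (Tms \<tau> n)" for k a u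
    using that vapp_fun_I vcomp_fun[OF _ e] v Tms_fun[OF voc_tau] by blast+
  then show ?thesis
    unfolding is_eval_def is_eval'_def voc_eq[OF voc_tau] mem_Collect_eq Ball_def
    using v Tms_var[OF voc_tau] Tms_con[OF voc_tau] vapp_app[OF s] vapp_I by simp
qed (simp add: is_eval_def is_eval'_def voc_tau)

lemma is_eval_unique:
  assumes e: "is_eval \<tau> M I n s e" "is_eval \<tau> M I n s e'" shows "e = e'"
proof -
  have f: "is_fun e (Tms \<tau> n) M" "is_fun e' (Tms \<tau> n) M" using e unfolding is_eval_def by auto
  show ?thesis
  proof (rule fun_ext[OF f])
    fix t assume t: "mem t (Tms \<tau> n)"
    have "D (\<lambda>t. mem t (Tms \<tau> n) \<longrightarrow> vapp e t = vapp e' t)" by (intro D_intros)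
    then have "mem t (Tms \<tau> n) \<longrightarrow> vapp e t = vapp e' t" using voc_tau t
    proof (induction rule: Tms_induct)
      case (var i)
      then show ?case using e unfolding is_eval_def by (simp add: vapp_app[OF f(1)] vapp_app[OF f(2)])
    next
      case (con a)
      then show ?case using e unfolding is_eval_def by (simp add: vapp_app[OF f(1)] vapp_app[OF f(2)])
    next
      case (func k a u)
      have "vcomp e u = vcomp e' u"
        by (rule fun_ext[OF vcomp_fun[OF func(2) f(1)] vcomp_fun[OF func(2) f(2)]])
          (use func(3) fun_val[OF func(2)] in \<open>simp add: app_vcomp[OF func(2) f(1)] app_vcomp[OF func(2) f(2)]
            vapp_app[OF f(1)] vapp_app[OF f(2)]\<close>)
      moreover have "app e (fun_tm (funsym k a) u) = app (app I (funsym k a)) (vcomp e u)"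
        "app e' (fun_tm (funsym k a) u) = app (app I (funsym k a)) (vcomp e' u)"
        using e func(1,2) unfolding is_eval_def by blast+
      ultimately show ?case by (simp add: vapp_app[OF f(1)] vapp_app[OF f(2)])
    qed
    then show "app e t = app e' t" using t by (simp add: vapp_app[OF f(1)] vapp_app[OF f(2)])
  qed
qed

text \<open>
  The tag of a code selects the clause of the recursion. It gives a value to every set; on terms
  this is the value of the term.
\<close>

lemma is_eval_exists: assumes s: "is_fun s n M" shows "\<exists>e. is_eval \<tau> M I n s e"
proof -
  define G where "G x f = (if vfst x = vempty then vapp s (vsnd x) else if vfst x = v1 then vapp I (vsnd x)
    else vapp (vapp I (vfst (vsnd x))) (vcomp f (vsnd (vsnd x))))" for x f
  have "DF (\<lambda>z. G (vfst z) (vsnd z))" unfolding G_def by (intro D_intros)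
  from mem_recursion[of G, OF this] obtain F where F: "DF F" "\<And>x. F x = G x (vlam (tc x) F)" by blast
  have F_var: "F (var_tm i) = app s i" if "mem i n" for i
    using F(2)[of "var_tm i"] vapp_app[OF s that] by (simp add: G_def var_tm_def)
  have F_con: "F (con_tm (consym a)) = app I (consym a)" if "mem (consym a) \<tau>" for a
    using F(2)[of "con_tm (consym a)"] vapp_I[OF that] by (simp add: G_def con_tm_def)
  have F_fun: "F (fun_tm (funsym k a) u) = app (app I (funsym k a)) (vcomp (vlam (Tms \<tau> n) F) u)"
    and F_fun_M: "mem (F (fun_tm (funsym k a) u)) M"
    if f: "mem (funsym k a) \<tau>" and u: "is_fun u k (Tms \<tau> n)" and M: "\<And>i. mem i k \<Longrightarrow> mem (F (app u i)) M" for k a u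
  proof -
    let ?t = "fun_tm (funsym k a) u"
    have "mem p (vcomp (vlam (tc ?t) F) u) \<longleftrightarrow> (\<exists>i. mem i k \<and> p = \<langle>i, F (app u i)\<rangle>)"
      "mem p (vcomp (vlam (Tms \<tau> n) F) u) \<longleftrightarrow> (\<exists>i. mem i k \<and> p = \<langle>i, F (app u i)\<rangle>)" for p
      using tc_subterms(1)[OF u] fun_val[OF u] by (auto simp: mem_vcomp mem_vlam[OF F(1)] fun_pair[OF u])
    moreover from this have v: "is_fun (vcomp (vlam (tc ?t) F) u) k M" unfolding is_fun_iff using M by auto
    ultimately have "vcomp (vlam (tc ?t) F) u = vcomp (vlam (Tms \<tau> n) F) u" by (intro elts_eqI) simp
    moreover have "F ?t = vapp (vapp I (funsym k a)) (vcomp (vlam (tc ?t) F) u)"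
      using F(2)[of ?t] by (simp add: G_def fun_tm_def)
    ultimately show "F ?t = app (app I (funsym k a)) (vcomp (vlam (Tms \<tau> n) F) u)" "mem (F ?t) M"
      using vapp_fun_I[OF f v] fun_val[OF fun_I[OF f], of "vcomp (vlam (tc ?t) F) u"] v by auto
  qed
  have FM: "mem (F t) M" if "mem t (Tms \<tau> n)" for t
  proof -
    have "D (\<lambda>t. mem (F t) M)" by (intro D_intros F)
    then show ?thesis using voc_tau that
      by (induction rule: Tms_induct) (auto simp: F_var F_con fun_val[OF s] con_I F_fun_M)
  qed
  have "is_eval \<tau> M I n s (vlam (Tms \<tau> n) F)" unfolding is_eval_def mem_Collect_eq Ball_def
    using FM F_var F_con F_fun by (auto intro!: vlam_fun F(1) simp: app_vlam[OF F(1)] fun_val Tms_var[OF voc_tau]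
      Tms_con[OF voc_tau] Tms_fun[OF voc_tau])
  then show ?thesis by blast
qed

lemma eval_tm: assumes s: "is_fun s n M" shows "is_eval \<tau> M I n s (eval_tm \<tau> M I n s)"
proof -
  have "\<exists>!e. is_eval \<tau> M I n s e" using is_eval_exists[OF s] is_eval_unique by (rule ex_ex1I)
  then show ?thesis unfolding eval_tm_def by (rule theI')
qed

lemma eval_tm_eq: assumes s: "is_fun s n M" shows "eval_tm \<tau> M I n s = eval' \<tau> M I n s"
  unfolding eval'_def
proof (rule the0_eq[symmetric])
  show "is_eval' \<tau> M I n s (eval_tm \<tau> M I n s)" using eval_tm[OF s] is_eval_eq[OF s] by simp
  show "is_eval' \<tau> M I n s e \<Longrightarrow> e = eval_tm \<tau> M I n s" for e
    using is_eval_unique[OF _ eval_tm[OF s], of e] is_eval_eq[OF s, of e] by simp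
qed

lemma eval_fun: "is_fun s n M \<Longrightarrow> is_fun (eval_tm \<tau> M I n s) (Tms \<tau> n) M"
  using eval_tm unfolding is_eval_def by blast

lemma eval_var: "is_fun s n M \<Longrightarrow> mem i n \<Longrightarrow> app (eval_tm \<tau> M I n s) (var_tm i) = app s i"
  using eval_tm unfolding is_eval_def by blast

lemma eval_con: "is_fun s n M \<Longrightarrow> mem (consym a) \<tau> \<Longrightarrow> app (eval_tm \<tau> M I n s) (con_tm (consym a)) = app I (consym a)"
  using eval_tm unfolding is_eval_def by blast

lemma eval_fun_tm: "is_fun s n M \<Longrightarrow> mem (funsym k a) \<tau> \<Longrightarrow> is_fun u k (Tms \<tau> n) \<Longrightarrow>
    app (eval_tm \<tau> M I n s) (fun_tm (funsym k a) u) = app (app I (funsym k a)) (vcomp (eval_tm \<tau> M I n s) u)"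
  using eval_tm unfolding is_eval_def by blast

lemma is_truth_eq: "is_truth \<tau> M I S \<longleftrightarrow> is_truth' \<tau> M I S"
proof -
  have "vapp (eval' \<tau> M I n s) t = app (eval_tm \<tau> M I n s) t" if "is_fun s n M" "mem t (Tms \<tau> n)" for n s t
    using eval_tm_eq[OF that(1)] vapp_app[OF eval_fun[OF that(1)] that(2)] by simp
  moreover have "eval' \<tau> M I n s = eval_tm \<tau> M I n s" if "is_fun s n M" for n s
    using eval_tm_eq[OF that] by simp
  ultimately show ?thesis
    unfolding is_truth_def is_truth'_def voc_eq[OF voc_tau] mem_Collect_eq Ball_def
    by (simp add: vapp_I Bex_def cong: imp_cong conj_cong)
qed

lemma Sat_eq: "Sat \<tau> M I n \<phi> s \<longleftrightarrow> Sat' \<tau> M I n \<phi> s"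
  unfolding Sat_def Sat'_def is_truth_eq by simp

end

context fo_structure
begin

lemma is_truthI:
  assumes "\<And>n s t u. Natural n \<Longrightarrow> is_fun s n M \<Longrightarrow> mem t (Tms \<tau> n) \<Longrightarrow> mem u (Tms \<tau> n) \<Longrightarrow>
      mem \<langle>\<langle>n, eq_fm t u\<rangle>, s\<rangle> S \<longleftrightarrow> app (eval_tm \<tau> M I n s) t = app (eval_tm \<tau> M I n s) u"
    and "\<And>n s k a u. Natural n \<Longrightarrow> is_fun s n M \<Longrightarrow> mem (relsym k a) \<tau> \<Longrightarrow> is_fun u k (Tms \<tau> n) \<Longrightarrow>
      mem \<langle>\<langle>n, rel_fm (relsym k a) u\<rangle>, s\<rangle> S \<longleftrightarrow> mem (vcomp (eval_tm \<tau> M I n s) u) (app I (relsym k a))"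
    and "\<And>n s \<phi>. Natural n \<Longrightarrow> is_fun s n M \<Longrightarrow> Form \<tau> n \<phi> \<Longrightarrow>
      mem \<langle>\<langle>n, neg_fm \<phi>\<rangle>, s\<rangle> S \<longleftrightarrow> \<not> mem \<langle>\<langle>n, \<phi>\<rangle>, s\<rangle> S"
    and "\<And>n s \<phi> \<psi>. Natural n \<Longrightarrow> is_fun s n M \<Longrightarrow> Form \<tau> n \<phi> \<Longrightarrow> Form \<tau> n \<psi> \<Longrightarrow>
      mem \<langle>\<langle>n, and_fm \<phi> \<psi>\<rangle>, s\<rangle> S \<longleftrightarrow> mem \<langle>\<langle>n, \<phi>\<rangle>, s\<rangle> S \<and> mem \<langle>\<langle>n, \<psi>\<rangle>, s\<rangle> S"
    and "\<And>n s \<phi>. Natural n \<Longrightarrow> is_fun s n M \<Longrightarrow> Form \<tau> (vsucc n) \<phi> \<Longrightarrow>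
      mem \<langle>\<langle>n, ex_fm \<phi>\<rangle>, s\<rangle> S \<longleftrightarrow> (\<exists>a. mem a M \<and> mem \<langle>\<langle>vsucc n, \<phi>\<rangle>, snoc s n a\<rangle> S)"
  shows "is_truth \<tau> M I S"
  unfolding is_truth_def Ball_def Bex_def mem_Collect_eq mem_omega
  by (intro allI impI conjI; (elim conjE)?; rule assms; assumption)

lemma
  assumes S: "is_truth \<tau> M I S" and n: "Natural n" and s: "is_fun s n M"
  shows truth_eq: "mem t (Tms \<tau> n) \<Longrightarrow> mem u (Tms \<tau> n) \<Longrightarrow>
        mem \<langle>\<langle>n, eq_fm t u\<rangle>, s\<rangle> S \<longleftrightarrow> app (eval_tm \<tau> M I n s) t = app (eval_tm \<tau> M I n s) u"
    and truth_rel: "mem (relsym k a) \<tau> \<Longrightarrow> is_fun u k (Tms \<tau> n) \<Longrightarrow>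
        mem \<langle>\<langle>n, rel_fm (relsym k a) u\<rangle>, s\<rangle> S \<longleftrightarrow> mem (vcomp (eval_tm \<tau> M I n s) u) (app I (relsym k a))"
    and truth_neg: "Form \<tau> n \<phi> \<Longrightarrow> mem \<langle>\<langle>n, neg_fm \<phi>\<rangle>, s\<rangle> S \<longleftrightarrow> \<not> mem \<langle>\<langle>n, \<phi>\<rangle>, s\<rangle> S"
    and truth_and: "Form \<tau> n \<phi> \<Longrightarrow> Form \<tau> n \<psi> \<Longrightarrow>
        mem \<langle>\<langle>n, and_fm \<phi> \<psi>\<rangle>, s\<rangle> S \<longleftrightarrow> mem \<langle>\<langle>n, \<phi>\<rangle>, s\<rangle> S \<and> mem \<langle>\<langle>n, \<psi>\<rangle>, s\<rangle> S"
    and truth_ex: "Form \<tau> (vsucc n) \<phi> \<Longrightarrow>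
        mem \<langle>\<langle>n, ex_fm \<phi>\<rangle>, s\<rangle> S \<longleftrightarrow> (\<exists>a. mem a M \<and> mem \<langle>\<langle>vsucc n, \<phi>\<rangle>, snoc s n a\<rangle> S)"
proof goal_cases
  note T = S[unfolded is_truth_def Ball_def Bex_def mem_Collect_eq mem_omega,
    THEN spec, THEN mp, OF n, THEN spec, THEN mp, OF s]
  note T1 = T[THEN conjunct2]
  note T2 = T1[THEN conjunct2]
  note T3 = T2[THEN conjunct2]
  { case 1 then show ?case using T[THEN conjunct1] by blast }
  { case 2 then show ?case using T1[THEN conjunct1] by blast }
  { case 3 then show ?case using T2[THEN conjunct1] by blast }
  { case 4 then show ?case using T3[THEN conjunct1] by blast }
  { case 5 then show ?case using T3[THEN conjunct2] by blast }
qed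

lemma truth_unique:
  assumes S: "is_truth \<tau> M I S" and S': "is_truth \<tau> M I S'"
    and n: "Natural n" and \<phi>: "Form \<tau> n \<phi>" and s: "is_fun s n M"
  shows "mem \<langle>\<langle>n, \<phi>\<rangle>, s\<rangle> S \<longleftrightarrow> mem \<langle>\<langle>n, \<phi>\<rangle>, s\<rangle> S'"
proof -
  have "D (\<lambda>z. \<forall>s. is_fun s (vfst z) M \<longrightarrow>
    (mem \<langle>\<langle>vfst z, vsnd z\<rangle>, s\<rangle> S \<longleftrightarrow> mem \<langle>\<langle>vfst z, vsnd z\<rangle>, s\<rangle> S'))" by (intro D_intros)
  then have "\<forall>s. is_fun s n M \<longrightarrow> (mem \<langle>\<langle>n, \<phi>\<rangle>, s\<rangle> S \<longleftrightarrow> mem \<langle>\<langle>n, \<phi>\<rangle>, s\<rangle> S')"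
    using voc_tau n \<phi>
  proof (induction rule: Form_induct)
    case (eq n t u)
    then show ?case using truth_eq[OF S] truth_eq[OF S'] by blast
  next
    case (rel n k a u)
    then show ?case using truth_rel[OF S] truth_rel[OF S'] by blast
  next
    case (neg n \<phi>)
    then show ?case using truth_neg[OF S] truth_neg[OF S'] by blast
  next
    case (conj n \<phi> \<psi>)
    then show ?case using truth_and[OF S] truth_and[OF S'] by blast
  next
    case (ex n \<phi>)
    then show ?case using truth_ex[OF S ex(1) _ ex(2)] truth_ex[OF S' ex(1) _ ex(2)] snoc_fun[of _ n M] by blast
  qed
  then show ?thesis using s by blast
qed

text \<open>
  By recursion on \<open>\<phi>\<close>, let \<open>F \<phi>\<close> be the set of pairs \<open>\<langle>n, s\<rangle>\<close> such that the assignment \<open>s\<close> of length \<open>n\<close>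
  satisfies \<open>\<phi>\<close>. The length is part of the pair because the variable bound by a quantifier depends on the context.
\<close>

lemma truth_exists: "\<exists>S. is_truth \<tau> M I S"
proof -
  \<comment> \<open>all assignments, paired with their lengths\<close>
  define Ass where "Ass = vsep (vprod omega (vPow (vprod omega M))) (\<lambda>p. is_fun (vsnd p) (vfst p) M)"
  have "D (\<lambda>p. is_fun (vsnd p) (vfst p) M)" by (intro D_intros)
  then have "mem p Ass \<longleftrightarrow> (\<exists>n s. p = \<langle>n, s\<rangle> \<and> Natural n \<and> is_fun s n M \<and> elts s \<subseteq> elts (vprod omega M))" for p
    unfolding Ass_def by (auto simp: mem_vsep)
  moreover have "elts s \<subseteq> elts (vprod omega M)" if "Natural n" "is_fun s n M" for n s
    using Natural_mem[OF that(1)] fun_val[OF that(2)] by (auto simp: fun_mem[OF that(2)])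
  ultimately have Ass: "mem p Ass \<longleftrightarrow> (\<exists>n s. p = \<langle>n, s\<rangle> \<and> Natural n \<and> is_fun s n M)" for p by blast
  define ev where "ev p = eval' \<tau> M I (vfst p) (vsnd p)" for p
  have ev: "DF ev" unfolding ev_def by (intro D_intros)
  define Geq where "Geq x = vsep Ass (\<lambda>p. vapp (ev p) (vfst (vsnd x)) = vapp (ev p) (vsnd (vsnd x)))" for x
  define Grel where "Grel x = vsep Ass (\<lambda>p. mem (vcomp (ev p) (vsnd (vsnd x))) (vapp I (vfst (vsnd x))))" for x
  define Gneg where "Gneg x f = vsep Ass (\<lambda>p. \<not> mem p (vapp f (vsnd x)))" for x f
  define Gand where "Gand x f = vsep Ass (\<lambda>p. mem p (vapp f (vfst (vsnd x))) \<and> mem p (vapp f (vsnd (vsnd x))))" for x f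
  define Gex where "Gex x f = vsep Ass (\<lambda>p. \<exists>a. mem a M \<and>
      mem \<langle>vsucc (vfst p), snoc (vsnd p) (vfst p) a\<rangle> (vapp f (vsnd x)))" for x f
  define G where "G x f = (if vfst x = vempty then Geq x else if vfst x = v1 then Grel x else
    if vfst x = v2 then Gneg x f else if vfst x = v3 then Gand x f else Gex x f)" for x f
  have "DF (\<lambda>z. G (vfst z) (vsnd z))"
    unfolding G_def Geq_def Grel_def Gneg_def Gand_def Gex_def
    by (intro D_intros ev[THEN DF_comp])
  from mem_recursion[of G, OF this] obtain F where F: "DF F" "\<And>x. F x = G x (vlam (tc x) F)" by blast
  note vF = vapp_vlam[OF F(1)]
  have Feq: "mem p (F (eq_fm t u)) \<longleftrightarrow> mem p Ass \<and> vapp (ev p) t = vapp (ev p) u" for p t u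
  proof -
    have "F (eq_fm t u) = Geq (eq_fm t u)" unfolding F(2)[of "eq_fm t u"] G_def by (simp add: fm_defs)
    moreover have "D (\<lambda>p. vapp (ev p) t = vapp (ev p) u)" by (intro D_intros ev)
    ultimately show ?thesis unfolding Geq_def by (simp add: eq_fm_def mem_vsep)
  qed
  have Frel: "mem p (F (rel_fm r u)) \<longleftrightarrow> mem p Ass \<and> mem (vcomp (ev p) u) (vapp I r)" for p r u
  proof -
    have "F (rel_fm r u) = Grel (rel_fm r u)" unfolding F(2)[of "rel_fm r u"] G_def by (simp add: fm_defs)
    moreover have "D (\<lambda>p. mem (vcomp (ev p) u) (vapp I r))" by (intro D_intros ev)
    ultimately show ?thesis unfolding Grel_def by (simp add: rel_fm_def mem_vsep)
  qed
  have Fneg: "mem p (F (neg_fm \<phi>)) \<longleftrightarrow> mem p Ass \<and> \<not> mem p (F \<phi>)" for p \<phi>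
  proof -
    have "F (neg_fm \<phi>) = Gneg (neg_fm \<phi>) (vlam (tc (neg_fm \<phi>)) F)"
      unfolding F(2)[of "neg_fm \<phi>"] G_def by (simp add: fm_defs)
    moreover have "D (\<lambda>p. \<not> mem p (F \<phi>))" by (intro D_intros)
    ultimately show ?thesis unfolding Gneg_def
      by (simp add: neg_fm_def vF[OF tc_subterms(2)[unfolded neg_fm_def]] mem_vsep)
  qed
  have Fand: "mem p (F (and_fm \<phi> \<psi>)) \<longleftrightarrow> mem p Ass \<and> mem p (F \<phi>) \<and> mem p (F \<psi>)" for p \<phi> \<psi>
  proof -
    have "F (and_fm \<phi> \<psi>) = Gand (and_fm \<phi> \<psi>) (vlam (tc (and_fm \<phi> \<psi>)) F)"
      unfolding F(2)[of "and_fm \<phi> \<psi>"] G_def by (simp add: fm_defs)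
    moreover have "D (\<lambda>p. mem p (F \<phi>) \<and> mem p (F \<psi>))" by (intro D_intros)
    ultimately show ?thesis unfolding Gand_def
      by (simp add: and_fm_def vF[OF tc_subterms(3)[unfolded and_fm_def]] vF[OF tc_subterms(4)[unfolded and_fm_def]] mem_vsep)
  qed
  have Fex: "mem p (F (ex_fm \<phi>)) \<longleftrightarrow> mem p Ass \<and>
      (\<exists>a. mem a M \<and> mem \<langle>vsucc (vfst p), snoc (vsnd p) (vfst p) a\<rangle> (F \<phi>))" for p \<phi>
  proof -
    have "F (ex_fm \<phi>) = Gex (ex_fm \<phi>) (vlam (tc (ex_fm \<phi>)) F)"
      unfolding F(2)[of "ex_fm \<phi>"] G_def by (simp add: fm_defs)
    moreover have "D (\<lambda>p. \<exists>a. mem a M \<and> mem \<langle>vsucc (vfst p), snoc (vsnd p) (vfst p) a\<rangle> (F \<phi>))" by (intro D_intros)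
    ultimately show ?thesis unfolding Gex_def
      by (simp add: ex_fm_def vF[OF tc_subterms(5)[unfolded ex_fm_def]] mem_vsep)
  qed
  obtain X where X: "closed_fm \<tau> X" using closed_fm_exists[OF voc_tau] .
  define S where "S = vsep (vprod X (vPow (vprod omega M))) (\<lambda>z. mem \<langle>vfst (vfst z), vsnd z\<rangle> (F (vsnd (vfst z))))"
  have "D (\<lambda>z. mem \<langle>vfst (vfst z), vsnd z\<rangle> (F (vsnd (vfst z))))" by (intro D_intros F(1)[THEN DF_comp])
  then have S: "mem \<langle>\<langle>n, \<phi>\<rangle>, s\<rangle> S \<longleftrightarrow> mem \<langle>n, s\<rangle> (F \<phi>)" if "Natural n" "Form \<tau> n \<phi>" "is_fun s n M" for n \<phi> s
    using that X unfolding S_def Form_def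
    by (auto simp: mem_vsep fun_mem[OF that(3)] fun_val[OF that(3)] Natural_mem[OF that(1)])
  have ev_eq: "ev \<langle>n, s\<rangle> = eval_tm \<tau> M I n s" if "is_fun s n M" for n s
    unfolding ev_def using eval_tm_eq[OF that] by simp
  have A: "mem \<langle>n, s\<rangle> Ass" if "Natural n" "is_fun s n M" for n s using that Ass by blast
  have "is_truth \<tau> M I S"
  proof (rule is_truthI, goal_cases)
    case (1 n s t u)
    then show ?case using S[OF 1(1) Form_eq[OF 1(1,3,4)] 1(2)] A[OF 1(1,2)]
      by (simp add: Feq ev_eq vapp_app[OF eval_fun[OF 1(2)]])
  next
    case (2 n s k a u)
    then show ?case using S[OF 2(1) Form_rel[OF 2(1,3,4)] 2(2)] A[OF 2(1,2)]
      by (simp add: Frel ev_eq vapp_I)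
  next
    case (3 n s \<phi>)
    then show ?case using S[OF 3(1) Form_neg[OF 3(1,3)] 3(2)] S[OF 3(1,3,2)] A[OF 3(1,2)] by (simp add: Fneg)
  next
    case (4 n s \<phi> \<psi>)
    then show ?case using S[OF 4(1) Form_and[OF 4(1,3,4)] 4(2)] S[OF 4(1,3,2)] S[OF 4(1,4,2)] A[OF 4(1,2)]
      by (simp add: Fand)
  next
    case (5 n s \<phi>)
    then show ?case
      using S[OF 5(1) Form_ex[OF 5(1,3)] 5(2)] S[OF Natural_vsucc[OF 5(1)] 5(3) snoc_fun[OF 5(2)]] A[OF 5(1,2)]
      by (simp add: Fex cong: conj_cong)
  qed
  then show ?thesis by blast
qed

lemma Sat_truth:
  "is_truth \<tau> M I S \<Longrightarrow> Natural n \<Longrightarrow> Form \<tau> n \<phi> \<Longrightarrow> is_fun s n M \<Longrightarrow>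
    Sat \<tau> M I n \<phi> s \<longleftrightarrow> mem \<langle>\<langle>n, \<phi>\<rangle>, s\<rangle> S"
  unfolding Sat_def mem_Collect_eq using truth_unique by blast

lemma
  assumes n: "Natural n" and s: "is_fun s n M"
  shows Sat_eq_fm: "mem t (Tms \<tau> n) \<Longrightarrow> mem u (Tms \<tau> n) \<Longrightarrow>
        Sat \<tau> M I n (eq_fm t u) s \<longleftrightarrow> app (eval_tm \<tau> M I n s) t = app (eval_tm \<tau> M I n s) u"
    and Sat_rel_fm: "mem (relsym k a) \<tau> \<Longrightarrow> is_fun u k (Tms \<tau> n) \<Longrightarrow>
        Sat \<tau> M I n (rel_fm (relsym k a) u) s \<longleftrightarrow> mem (vcomp (eval_tm \<tau> M I n s) u) (app I (relsym k a))"
    and Sat_neg_fm: "Form \<tau> n \<phi> \<Longrightarrow> Sat \<tau> M I n (neg_fm \<phi>) s \<longleftrightarrow> \<not> Sat \<tau> M I n \<phi> s"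
    and Sat_and_fm: "Form \<tau> n \<phi> \<Longrightarrow> Form \<tau> n \<psi> \<Longrightarrow>
        Sat \<tau> M I n (and_fm \<phi> \<psi>) s \<longleftrightarrow> Sat \<tau> M I n \<phi> s \<and> Sat \<tau> M I n \<psi> s"
    and Sat_ex_fm: "Form \<tau> (vsucc n) \<phi> \<Longrightarrow>
        Sat \<tau> M I n (ex_fm \<phi>) s \<longleftrightarrow> (\<exists>a. mem a M \<and> Sat \<tau> M I (vsucc n) \<phi> (snoc s n a))"
proof goal_cases
  obtain S where S: "is_truth \<tau> M I S" using truth_exists by blast
  note T = Sat_truth[OF S n _ s]
  { case 1 then show ?case using T[OF Form_eq[OF n]] truth_eq[OF S n s] by blast }
  { case 2 then show ?case using T[OF Form_rel[OF n]] truth_rel[OF S n s] by blast }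
  { case 3 then show ?case using T[OF Form_neg[OF n]] T truth_neg[OF S n s] by blast }
  { case 4 then show ?case using T[OF Form_and[OF n]] T truth_and[OF S n s] by blast }
  { case 5 then show ?case
    using T[OF Form_ex[OF n]] Sat_truth[OF S Natural_vsucc[OF n] _ snoc_fun[OF s]] truth_ex[OF S n s] by blast }
qed

end

section \<open>Translations between structures\<close>

text \<open>
  A map \<open>h\<close> of symbols, terms and formulas of \<open>\<tau>\<close> to those of \<open>\<tau>'\<close> with a bijection \<open>g\<close> of the universes
  that respects the interpretations. Two cases are needed: renamings of symbols, where \<open>g\<close> is the identity, and
  isomorphisms onto a reduct, where \<open>h\<close> is the identity.
\<close>

locale fo_translation = src: fo_structure \<tau> M I + tgt: fo_structure \<tau>' M' I'
  for \<tau> M I \<tau>' M' I' :: "'a::ZF" +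
  fixes h :: "'a \<Rightarrow> 'a" and g :: 'a
  assumes h: "DF h" and g: "is_fun g M M'"
    and g_inj: "mem x M \<Longrightarrow> mem y M \<Longrightarrow> app g x = app g y \<Longrightarrow> x = y"
    and g_surj: "mem z M' \<Longrightarrow> \<exists>x. mem x M \<and> app g x = z"
    and fo_rel: "mem (relsym k a) \<tau> \<Longrightarrow> \<exists>a'. h (relsym k a) = relsym k a' \<and> mem (relsym k a') \<tau>' \<and>
      (\<forall>p. is_fun p k M \<longrightarrow> (mem p (app I (relsym k a)) \<longleftrightarrow> mem (vcomp g p) (app I' (relsym k a'))))"
    and fo_func: "mem (funsym k a) \<tau> \<Longrightarrow> \<exists>a'. h (funsym k a) = funsym k a' \<and> mem (funsym k a') \<tau>' \<and>
      (\<forall>p. is_fun p k M \<longrightarrow> app g (app (app I (funsym k a)) p) = app (app I' (funsym k a')) (vcomp g p))"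
    and fo_con: "mem (consym a) \<tau> \<Longrightarrow> \<exists>a'. h (consym a) = consym a' \<and> mem (consym a') \<tau>' \<and>
      app g (app I (consym a)) = app I' (consym a')"
    and h_var: "Natural n \<Longrightarrow> mem i n \<Longrightarrow> h (var_tm i) = var_tm i"
    and h_con: "mem (consym a) \<tau> \<Longrightarrow> h (con_tm (consym a)) = con_tm (h (consym a))"
    and h_fun: "Natural n \<Longrightarrow> mem (funsym k a) \<tau> \<Longrightarrow> is_fun u k (Tms \<tau> n) \<Longrightarrow>
      h (fun_tm (funsym k a) u) = fun_tm (h (funsym k a)) (vcomp (vlam (Tms \<tau> n) h) u)"
    and h_eq: "Natural n \<Longrightarrow> mem t (Tms \<tau> n) \<Longrightarrow> mem u (Tms \<tau> n) \<Longrightarrow> h (eq_fm t u) = eq_fm (h t) (h u)"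
    and h_rel: "Natural n \<Longrightarrow> mem (relsym k a) \<tau> \<Longrightarrow> is_fun u k (Tms \<tau> n) \<Longrightarrow>
      h (rel_fm (relsym k a) u) = rel_fm (h (relsym k a)) (vcomp (vlam (Tms \<tau> n) h) u)"
    and h_neg: "Natural n \<Longrightarrow> Form \<tau> n \<phi> \<Longrightarrow> h (neg_fm \<phi>) = neg_fm (h \<phi>)"
    and h_and: "Natural n \<Longrightarrow> Form \<tau> n \<phi> \<Longrightarrow> Form \<tau> n \<psi> \<Longrightarrow> h (and_fm \<phi> \<psi>) = and_fm (h \<phi>) (h \<psi>)"
    and h_ex: "Natural n \<Longrightarrow> Form \<tau> (vsucc n) \<phi> \<Longrightarrow> h (ex_fm \<phi>) = ex_fm (h \<phi>)"
begin

lemma h_Tms: 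
  assumes n: "Natural n" and t: "mem t (Tms \<tau> n)" shows "mem (h t) (Tms \<tau>' n)"
proof -
  have "D (\<lambda>t. mem (h t) (Tms \<tau>' n))" by (intro D_intros h)
  then show ?thesis using src.voc_tau t
  proof (induction rule: Tms_induct)
    case (var i)
    then show ?case using Tms_var[OF tgt.voc_tau] by (simp add: h_var[OF n])
  next
    case (con a)
    then show ?case using Tms_con[OF tgt.voc_tau] fo_con[OF con] by (auto simp: h_con)
  next
    case (func k a u)
    obtain a' where a': "h (funsym k a) = funsym k a'" "mem (funsym k a') \<tau>'" using fo_func[OF func(1)] by blast
    obtain B where B: "is_fun (vlam (Tms \<tau> n) h) (Tms \<tau> n) B" using vlam_fun_ex[OF h] by blast
    have "is_fun (vcomp (vlam (Tms \<tau> n) h) u) k (Tms \<tau>' n)"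
    proof (rule fun_codom[OF vcomp_fun[OF func(2) B]])
      show "mem (app (vcomp (vlam (Tms \<tau> n) h) u) i) (Tms \<tau>' n)" if "mem i k" for i
        using func(3)[OF that] by (simp add: app_vcomp[OF func(2) B that] app_vlam[OF h] fun_val[OF func(2) that])
    qed
    then show ?case using Tms_fun[OF tgt.voc_tau a'(2)] by (simp add: h_fun[OF n func(1,2)] a')
  qed
qed

lemma h_lam: "Natural n \<Longrightarrow> is_fun (vlam (Tms \<tau> n) h) (Tms \<tau> n) (Tms \<tau>' n)"
  by (rule vlam_fun[OF h]) (rule h_Tms)

lemma h_Form:
  assumes n: "Natural n" and \<phi>: "Form \<tau> n \<phi>" shows "Form \<tau>' n (h \<phi>)"
proof -
  have "D (\<lambda>z. Form (voc \<tau>') (vfst z) (h (vsnd z)))" by (intro D_intros h[THEN DF_comp])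
  then have "D (\<lambda>z. Form \<tau>' (vfst z) (h (vsnd z)))" by (simp add: tgt.voc_tau)
  then show ?thesis using src.voc_tau n \<phi>
  proof (induction rule: Form_induct)
    case (eq n t u)
    then show ?case by (simp add: h_eq Form_eq h_Tms)
  next
    case (rel n k a u)
    obtain a' where a': "h (relsym k a) = relsym k a'" "mem (relsym k a') \<tau>'" using fo_rel[OF rel(2)] by blast
    show ?case using Form_rel[OF rel(1) a'(2) vcomp_fun[OF rel(3) h_lam[OF rel(1)]]]
      by (simp add: h_rel[OF rel] a')
  next
    case (neg n \<phi>)
    then show ?case by (simp add: h_neg Form_neg)
  next
    case (conj n \<phi> \<psi>)
    then show ?case by (simp add: h_and Form_and)
  next
    case (ex n \<phi>)
    then show ?case by (simp add: h_ex Form_ex)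
  qed
qed

lemma h_eval:
  assumes n: "Natural n" and s: "is_fun s n M" and t: "mem t (Tms \<tau> n)"
  shows "app g (app (eval_tm \<tau> M I n s) t) = app (eval_tm \<tau>' M' I' n (vcomp g s)) (h t)"
proof -
  define E E' where "E = eval_tm \<tau> M I n s" and "E' = eval_tm \<tau>' M' I' n (vcomp g s)"
  have s': "is_fun (vcomp g s) n M'" using vcomp_fun[OF s g] .
  have E: "is_fun E (Tms \<tau> n) M" and E': "is_fun E' (Tms \<tau>' n) M'"
    unfolding E_def E'_def using src.eval_fun[OF s] tgt.eval_fun[OF s'] .
  have "D (\<lambda>t. mem t (Tms \<tau> n) \<longrightarrow> vapp g (vapp E t) = vapp E' (h t))" by (intro D_intros h)
  then have "mem t (Tms \<tau> n) \<longrightarrow> vapp g (vapp E t) = vapp E' (h t)" using src.voc_tau t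
  proof (induction rule: Tms_induct)
    case (var i)
    have "app E' (var_tm i) = app g (app E (var_tm i))"
      using src.eval_var[OF s var] tgt.eval_var[OF s' var] app_vcomp[OF s g var] by (simp add: E_def E'_def)
    then show ?case
      using vapp_app[OF g fun_val[OF E]] vapp_app[OF E] vapp_app[OF E'] Tms_var[OF tgt.voc_tau var]
      by (simp add: h_var[OF n var])
  next
    case (con a)
    obtain a' where a': "h (consym a) = consym a'" "mem (consym a') \<tau>'" "app g (app I (consym a)) = app I' (consym a')"
      using fo_con[OF con] by blast
    have "app E' (con_tm (consym a')) = app g (app E (con_tm (consym a)))"
      using src.eval_con[OF s con] tgt.eval_con[OF s' a'(2)] a'(3) by (simp add: E_def E'_def)
    then show ?case
      using vapp_app[OF g fun_val[OF E]] vapp_app[OF E] vapp_app[OF E'] Tms_con[OF tgt.voc_tau a'(2)]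
      by (simp add: h_con[OF con] a'(1))
  next
    case (func k a u)
    let ?H = "vlam (Tms \<tau> n) h"
    obtain a' where a': "h (funsym k a) = funsym k a'" "mem (funsym k a') \<tau>'"
      "\<And>p. is_fun p k M \<Longrightarrow> app g (app (app I (funsym k a)) p) = app (app I' (funsym k a')) (vcomp g p)"
      using fo_func[OF func(1)] by blast
    note u = func(2) and H = h_lam[OF n]
    have Hu: "is_fun (vcomp ?H u) k (Tms \<tau>' n)" using vcomp_fun[OF u H] .
    have "vcomp g (vcomp E u) = vcomp E' (vcomp ?H u)"
    proof (rule fun_ext[OF vcomp_fun[OF vcomp_fun[OF u E] g] vcomp_fun[OF Hu E']])
      fix i assume i: "mem i k"
      have ui: "mem (app u i) (Tms \<tau> n)" using fun_val[OF u i] .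
      then have "app g (app E (app u i)) = app E' (h (app u i))"
        using func(3)[OF i] vapp_app[OF g fun_val[OF E]] vapp_app[OF E] vapp_app[OF E'] h_Tms[OF n] by simp
      then show "app (vcomp g (vcomp E u)) i = app (vcomp E' (vcomp ?H u)) i"
        using ui by (simp add: app_vcomp[OF vcomp_fun[OF u E] g i] app_vcomp[OF u E i]
          app_vcomp[OF Hu E' i] app_vcomp[OF u H i] app_vlam[OF h])
    qed
    then have "app E' (fun_tm (funsym k a') (vcomp ?H u)) = app g (app E (fun_tm (funsym k a) u))"
      using src.eval_fun_tm[OF s func(1) u] tgt.eval_fun_tm[OF s' a'(2) Hu] a'(3)[OF vcomp_fun[OF u E]]
      by (simp add: E_def E'_def)
    then show ?case
      using vapp_app[OF g fun_val[OF E]] vapp_app[OF E] vapp_app[OF E'] Tms_fun[OF tgt.voc_tau a'(2) Hu]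
      by (simp add: h_fun[OF n func(1) u] a'(1))
  qed
  then show ?thesis
    using t vapp_app[OF g fun_val[OF E]] vapp_app[OF E] vapp_app[OF E'] h_Tms[OF n]
    by (simp add: E_def[symmetric] E'_def[symmetric])
qed

text \<open>
  The preimage of a truth set for \<open>\<tau>'\<close> satisfies Tarski's clauses for \<open>\<tau>\<close>, so the claim follows from the
  uniqueness of truth.
\<close>

lemma Sat_translate:
  assumes "Natural n" "Form \<tau> n \<phi>" "is_fun s n M"
  shows "Sat \<tau> M I n \<phi> s \<longleftrightarrow> Sat \<tau>' M' I' n (h \<phi>) (vcomp g s)"
proof -
  obtain S' where S': "is_truth \<tau>' M' I' S'" using tgt.truth_exists by blast
  obtain X where X: "closed_fm \<tau> X" using closed_fm_exists[OF src.voc_tau] .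
  have "D (\<lambda>z. mem \<langle>\<langle>vfst (vfst z), h (vsnd (vfst z))\<rangle>, vcomp g (vsnd z)\<rangle> S')" by (intro D_intros h[THEN DF_comp])
  from sep_ex[OF this, of "vprod X (vPow (vprod omega M))"] obtain S
    where "\<And>z. mem z S \<longleftrightarrow> mem z (vprod X (vPow (vprod omega M))) \<and>
      mem \<langle>\<langle>vfst (vfst z), h (vsnd (vfst z))\<rangle>, vcomp g (vsnd z)\<rangle> S'" by blast
  then have S: "mem \<langle>\<langle>n, \<phi>\<rangle>, s\<rangle> S \<longleftrightarrow> mem \<langle>\<langle>n, h \<phi>\<rangle>, vcomp g s\<rangle> S'"
    if "Natural n" "Form \<tau> n \<phi>" "is_fun s n M" for n \<phi> s
    using that X unfolding Form_def
    by (auto simp: fun_mem[OF that(3)] fun_val[OF that(3)] Natural_mem[OF that(1)])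
  have "is_truth \<tau> M I S"
  proof (rule src.is_truthI, goal_cases)
    case (1 n s t u)
    note n = 1(1) and s = 1(2) and t = 1(3) and u = 1(4) and E = src.eval_fun[OF 1(2)]
    have "mem \<langle>\<langle>n, eq_fm t u\<rangle>, s\<rangle> S \<longleftrightarrow> app g (app (eval_tm \<tau> M I n s) t) = app g (app (eval_tm \<tau> M I n s) u)"
      using S[OF n Form_eq[OF n t u] s] tgt.truth_eq[OF S' n vcomp_fun[OF s g]] h_Tms[OF n] t u
      by (simp add: h_eq[OF n] h_eval[OF n s])
    then show ?case using g_inj[OF fun_val[OF E t] fun_val[OF E u]] by metis
  next
    case (2 n s k a u)
    let ?H = "vlam (Tms \<tau> n) h"
    note n = 2(1) and s = 2(2) and r = 2(3) and u = 2(4)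
    have s': "is_fun (vcomp g s) n M'" using vcomp_fun[OF s g] .
    note E = src.eval_fun[OF s] and E' = tgt.eval_fun[OF s'] and H = h_lam[OF n]
    obtain a' where a': "h (relsym k a) = relsym k a'" "mem (relsym k a') \<tau>'"
      "\<And>p. is_fun p k M \<Longrightarrow> mem p (app I (relsym k a)) \<longleftrightarrow> mem (vcomp g p) (app I' (relsym k a'))"
      using fo_rel[OF r] by blast
    have Hu: "is_fun (vcomp ?H u) k (Tms \<tau>' n)" using vcomp_fun[OF u H] .
    have "vcomp g (vcomp (eval_tm \<tau> M I n s) u) = vcomp (eval_tm \<tau>' M' I' n (vcomp g s)) (vcomp ?H u)"
      by (rule fun_ext[OF vcomp_fun[OF vcomp_fun[OF u E] g] vcomp_fun[OF Hu E']])
        (simp add: app_vcomp[OF vcomp_fun[OF u E] g] app_vcomp[OF u E] app_vcomp[OF Hu E']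
          app_vcomp[OF u H] app_vlam[OF h] h_eval[OF n s] fun_val[OF u])
    then show ?case
      using S[OF n Form_rel[OF n r u] s] tgt.truth_rel[OF S' n s' a'(2) Hu] a'(3)[OF vcomp_fun[OF u E]]
      by (simp add: h_rel[OF n r u] a'(1))
  next
    case (3 n s \<phi>)
    then show ?case
      using S[OF 3(1) Form_neg[OF 3(1,3)] 3(2)] S[OF 3(1,3,2)]
        tgt.truth_neg[OF S' 3(1) vcomp_fun[OF 3(2) g] h_Form[OF 3(1,3)]]
      by (simp add: h_neg)
  next
    case (4 n s \<phi> \<psi>)
    then show ?case
      using S[OF 4(1) Form_and[OF 4(1,3,4)] 4(2)] S[OF 4(1,3,2)] S[OF 4(1,4,2)]
        tgt.truth_and[OF S' 4(1) vcomp_fun[OF 4(2) g] h_Form[OF 4(1,3)] h_Form[OF 4(1,4)]]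
      by (simp add: h_and)
  next
    case (5 n s \<phi>)
    note n = 5(1) and s = 5(2) and \<phi> = 5(3) and n1 = Natural_vsucc[OF 5(1)]
    have "mem \<langle>\<langle>n, ex_fm \<phi>\<rangle>, s\<rangle> S \<longleftrightarrow>
        (\<exists>b. mem b M' \<and> mem \<langle>\<langle>vsucc n, h \<phi>\<rangle>, snoc (vcomp g s) n b\<rangle> S')"
      using S[OF n Form_ex[OF n \<phi>] s] tgt.truth_ex[OF S' n vcomp_fun[OF s g] h_Form[OF n1 \<phi>]]
      by (simp add: h_ex[OF n \<phi>])
    also have "\<dots> \<longleftrightarrow> (\<exists>a. mem a M \<and> mem \<langle>\<langle>vsucc n, h \<phi>\<rangle>, snoc (vcomp g s) n (app g a)\<rangle> S')"
      using g_surj fun_val[OF g] by metis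
    also have "\<dots> \<longleftrightarrow> (\<exists>a. mem a M \<and> mem \<langle>\<langle>vsucc n, \<phi>\<rangle>, snoc s n a\<rangle> S)"
      using S[OF n1 \<phi> snoc_fun[OF s]] vcomp_snoc[OF s _ g] by (simp cong: conj_cong)
    finally show ?case .
  qed
  from src.Sat_truth[OF this assms] tgt.Sat_truth[OF S' assms(1) h_Form[OF assms(1,2)] vcomp_fun[OF assms(3) g]]
  show ?thesis using S[OF assms] by simp
qed

end

section \<open>Membership structures\<close>

definition mem_rel :: "'a::ZF \<Rightarrow> 'a" where
  "mem_rel M = vset {p. \<exists>x\<in>elts M. \<exists>y\<in>elts M. x \<in> elts y \<and> p = seq2 x y}"

lemma mem_mem_rel: "mem p (mem_rel M) \<longleftrightarrow> (\<exists>x y. mem x M \<and> mem y M \<and> mem x y \<and> p = seq2 x y)"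
proof -
  have "small {p. \<exists>x\<in>elts M. \<exists>y\<in>elts M. x \<in> elts y \<and> p = seq2 x y}"
    by (rule small_subset[of _ "Pow_fun M v2"], intro D_intros) (auto intro: seq2_fun)
  from mem_vset[OF this] show ?thesis unfolding mem_rel_def by auto
qed

lemma mem_mem_voc [simp]: "mem x mem_voc \<longleftrightarrow> x = relsym v2 vempty"
  using mem_vset[OF small_single] unfolding mem_voc_def by auto

lemma mem_mem_interp: "mem p (mem_interp M) \<longleftrightarrow> p = \<langle>relsym v2 vempty, mem_rel M\<rangle>"
  using mem_vset[OF small_single] unfolding mem_interp_def mem_rel_def[symmetric] by auto

lemma mem_interp_fun: "is_fun (mem_interp M) mem_voc (vinsert (mem_rel M) vempty)"
  unfolding is_fun_iff by (auto simp: mem_mem_interp)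

lemma app_mem_interp [simp]: "app (mem_interp M) (relsym v2 vempty) = mem_rel M"
  by (rule app_unique[OF mem_interp_fun]) (simp add: mem_mem_interp)

lemma Natural_v [simp]: "Natural v1" "Natural v2" "Natural v3" "Natural v4"
  by (intro Natural_vsucc Natural_vempty)+

lemma Vocabulary_mem_voc [simp]: "Vocabulary mem_voc"
  unfolding Vocabulary_iff by auto

lemma fo_structure_mem: "fo_structure mem_voc M (mem_interp M)"
proof
  show "Structure mem_voc M (mem_interp M)"
    unfolding Structure_def using mem_interp_fun
    by (auto simp: mem_mem_rel intro: seq2_fun)
qed simp

abbreviation MSat :: "'a::ZF \<Rightarrow> 'a \<Rightarrow> 'a \<Rightarrow> 'a \<Rightarrow> bool" where
  "MSat M \<equiv> Sat mem_voc M (mem_interp M)"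

definition mem_fm :: "'a::ZF \<Rightarrow> 'a \<Rightarrow> 'a" where
  "mem_fm i j = rel_fm (relsym v2 vempty) (seq2 (var_tm i) (var_tm j))"

lemma Form_mem_fm: "Natural n \<Longrightarrow> mem i n \<Longrightarrow> mem j n \<Longrightarrow> Form mem_voc n (mem_fm i j)"
  unfolding mem_fm_def by (intro Form_rel seq2_fun Tms_var) auto

lemma Form_eq_var: "Natural n \<Longrightarrow> mem i n \<Longrightarrow> mem j n \<Longrightarrow> Form mem_voc n (eq_fm (var_tm i) (var_tm j))"
  by (intro Form_eq Tms_var) auto

lemma MSat_mem: 
  assumes "Natural n" "mem i n" "mem j n" and s: "is_fun s n M"
  shows "MSat M n (mem_fm i j) s \<longleftrightarrow> mem (app s i) (app s j)"
proof -
  interpret fo_structure mem_voc M "mem_interp M" by (rule fo_structure_mem)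
  have "is_fun (seq2 (var_tm i) (var_tm j)) v2 (Tms mem_voc n)"
    using assms by (intro seq2_fun Tms_var) auto
  then show ?thesis unfolding mem_fm_def
    using assms by (simp add: Sat_rel_fm[OF assms(1) s] vcomp_seq2[OF eval_fun[OF s]] Tms_var eval_var[OF s]
      mem_mem_rel fun_val[OF s])
qed

lemma MSat_eq:
  assumes "Natural n" "mem i n" "mem j n" and s: "is_fun s n M"
  shows "MSat M n (eq_fm (var_tm i) (var_tm j)) s \<longleftrightarrow> app s i = app s j"
proof -
  interpret fo_structure mem_voc M "mem_interp M" by (rule fo_structure_mem)
  show ?thesis using assms by (simp add: Sat_eq_fm[OF assms(1) s] Tms_var eval_var[OF s])
qed

lemmas MSat_neg = fo_structure.Sat_neg_fm[OF fo_structure_mem]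
lemmas MSat_and = fo_structure.Sat_and_fm[OF fo_structure_mem]
lemmas MSat_ex = fo_structure.Sat_ex_fm[OF fo_structure_mem]

definition seq1 :: "'a::ZF \<Rightarrow> 'a" where "seq1 x = snoc vempty vempty x"

lemma seq1_fun: "mem x A \<Longrightarrow> is_fun (seq1 x) v1 A"
  unfolding seq1_def by (intro snoc_fun fun_vempty)

lemma app_seq1 [simp]: "app (seq1 x) vempty = x"
  unfolding seq1_def by (rule app_snoc[OF fun_vempty])

lemma vcomp_seq1: "is_fun g A B \<Longrightarrow> mem x A \<Longrightarrow> vcomp g (seq1 x) = seq1 (app g x)"
  unfolding seq1_def by (subst vcomp_snoc[OF fun_vempty]) auto

locale elementary =
  fixes M j :: "'a::ZF"
  assumes emb: "mem_emb M j"
begin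

lemma j_fun: "is_fun j M M"
  using emb unfolding mem_emb_def elem_emb_def by simp

lemmas jM = fun_val[OF j_fun]

lemma transfer: "Natural n \<Longrightarrow> Form mem_voc n \<phi> \<Longrightarrow> is_fun s n M \<Longrightarrow> MSat M n \<phi> s \<longleftrightarrow> MSat M n \<phi> (vcomp j s)"
  using emb unfolding mem_emb_def elem_emb_def by simp

lemma j_mem:
  assumes x: "mem x M" and y: "mem y M" shows "mem (app j x) (app j y) \<longleftrightarrow> mem x y"
proof -
  have "MSat M v2 (mem_fm vempty v1) (seq2 x y) \<longleftrightarrow> MSat M v2 (mem_fm vempty v1) (vcomp j (seq2 x y))"
    by (intro transfer Form_mem_fm seq2_fun x y) simp_all
  then show ?thesis
    by (simp add: vcomp_seq2[OF j_fun x y] MSat_mem seq2_fun x y jM)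
qed

text \<open>
  An element that belongs to no other is mapped to such an element. This is how the parameter in
  \<open>proto_Berkeley_fixing\<close> is recognized.
\<close>

lemma j_top:
  assumes x: "mem x M" shows "(\<exists>y. mem y M \<and> mem (app j x) y) \<longleftrightarrow> (\<exists>y. mem y M \<and> mem x y)"
proof -
  let ?\<phi> = "ex_fm (mem_fm vempty v1)"
  have F: "Form mem_voc v2 (mem_fm vempty v1)" by (rule Form_mem_fm) simp_all
  have S: "MSat M v1 ?\<phi> (seq1 z) \<longleftrightarrow> (\<exists>y. mem y M \<and> mem z y)" if z: "mem z M" for z
    unfolding MSat_ex[OF Natural_v(1) seq1_fun[OF z] F]
    by (simp add: MSat_mem snoc_fun seq1_fun z app_snoc[OF seq1_fun[OF z]] cong: conj_cong)
  have "MSat M v1 ?\<phi> (seq1 x) \<longleftrightarrow> MSat M v1 ?\<phi> (vcomp j (seq1 x))"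
    by (intro transfer Form_ex F seq1_fun x) simp_all
  then show ?thesis by (simp add: vcomp_seq1[OF j_fun x] S x jM)
qed

lemma j_empty:
  assumes x: "mem x M" shows "(\<exists>y. mem y M \<and> mem y (app j x)) \<longleftrightarrow> (\<exists>y. mem y M \<and> mem y x)"
proof -
  let ?\<phi> = "ex_fm (mem_fm v1 vempty)"
  have F: "Form mem_voc v2 (mem_fm v1 vempty)" by (rule Form_mem_fm) simp_all
  have S: "MSat M v1 ?\<phi> (seq1 z) \<longleftrightarrow> (\<exists>y. mem y M \<and> mem y z)" if z: "mem z M" for z
    unfolding MSat_ex[OF Natural_v(1) seq1_fun[OF z] F]
    by (simp add: MSat_mem snoc_fun seq1_fun z app_snoc[OF seq1_fun[OF z]] cong: conj_cong)
  have "MSat M v1 ?\<phi> (seq1 x) \<longleftrightarrow> MSat M v1 ?\<phi> (vcomp j (seq1 x))"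
    by (intro transfer Form_ex F seq1_fun x) simp_all
  then show ?thesis by (simp add: vcomp_seq1[OF j_fun x] S x jM)
qed

text \<open>
  Together with \<open>j_mem\<close> this shows that the image of \<open>{x, y}\<close> has no elements besides the images of \<open>x\<close> and \<open>y\<close>.
\<close>

lemma j_pair:
  assumes x: "mem x M" and y: "mem y M" and z: "mem z M"
  shows "(\<exists>w. mem w M \<and> mem w (app j z) \<and> w \<noteq> app j x \<and> w \<noteq> app j y) \<longleftrightarrow>
    (\<exists>w. mem w M \<and> mem w z \<and> w \<noteq> x \<and> w \<noteq> y)"
proof -
  let ?n1 = "neg_fm (eq_fm (var_tm v3) (var_tm vempty))"
  let ?n2 = "neg_fm (eq_fm (var_tm v3) (var_tm v1))"
  let ?\<psi> = "and_fm (mem_fm v3 v2) (and_fm ?n1 ?n2)"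
  have F: "Form mem_voc v4 (eq_fm (var_tm v3) (var_tm vempty))" "Form mem_voc v4 (eq_fm (var_tm v3) (var_tm v1))"
    "Form mem_voc v4 (mem_fm v3 v2)"
    by (intro Form_eq_var Form_mem_fm; simp)+
  have F': "Form mem_voc v4 ?n1" "Form mem_voc v4 ?n2" "Form mem_voc v4 (and_fm ?n1 ?n2)"
    by (intro Form_and Form_neg F Natural_v)+
  have F\<psi>: "Form mem_voc v4 ?\<psi>" by (intro Form_and F F' Natural_v)
  have s: "is_fun (snoc (seq2 x y) v2 z) v3 M" if "mem x M" "mem y M" "mem z M" for x y z
    by (intro snoc_fun seq2_fun that)
  have S: "MSat M v3 (ex_fm ?\<psi>) (snoc (seq2 x y) v2 z) \<longleftrightarrow> (\<exists>w. mem w M \<and> mem w z \<and> w \<noteq> x \<and> w \<noteq> y)"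
    if m: "mem x M" "mem y M" "mem z M" for x y z
  proof -
    have "MSat M v4 ?\<psi> (snoc (snoc (seq2 x y) v2 z) v3 w) \<longleftrightarrow> mem w z \<and> w \<noteq> x \<and> w \<noteq> y" if w: "mem w M" for w
    proof -
      note s4 = snoc_fun[OF s[OF m] w]
      have a: "app (snoc (snoc (seq2 x y) v2 z) v3 w) v3 = w" "app (snoc (snoc (seq2 x y) v2 z) v3 w) v2 = z"
        "app (snoc (snoc (seq2 x y) v2 z) v3 w) vempty = x" "app (snoc (snoc (seq2 x y) v2 z) v3 w) v1 = y"
        by (simp_all add: app_snoc[OF s[OF m]] app_snoc[OF seq2_fun[OF m(1,2)]])
      show ?thesis
        by (simp add: MSat_and[OF Natural_v(4) s4] MSat_neg[OF Natural_v(4) s4] F F' MSat_eq[OF Natural_v(4) _ _ s4]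
          MSat_mem[OF Natural_v(4) _ _ s4] a)
    qed
    then show ?thesis unfolding MSat_ex[OF Natural_v(3) s[OF m] F\<psi>] by blast
  qed
  have "MSat M v3 (ex_fm ?\<psi>) (snoc (seq2 x y) v2 z) \<longleftrightarrow> MSat M v3 (ex_fm ?\<psi>) (vcomp j (snoc (seq2 x y) v2 z))"
    by (intro transfer Form_ex F\<psi> s x y z Natural_v)
  then show ?thesis
    by (simp add: vcomp_snoc[OF seq2_fun[OF x y] z j_fun] vcomp_seq2[OF j_fun x y] S x y z jM)
qed

end

section \<open>Embeddings that fix a parameter\<close>

text \<open>
  The part of elementarity that is used for an embedding provided by the proto Berkeley property.
  All further properties are obtained by coding them into sets that the embedding fixes.
\<close>

locale pair_embedding =
  fixes X j :: "'a::ZF"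
  assumes X: "Univ X" and j_fun: "is_fun j X X"
    and j_mem: "mem x X \<Longrightarrow> mem y X \<Longrightarrow> mem (app j x) (app j y) \<longleftrightarrow> mem x y"
    and j_vpair: "mem x X \<Longrightarrow> mem y X \<Longrightarrow> app j \<langle>x, y\<rangle> = \<langle>app j x, app j y\<rangle>"

text \<open>
  Let \<open>M = X \<union> {X, {X, p}}\<close> for a transitive \<open>X\<close> containing \<open>p\<close> and \<open>l\<close>. Then \<open>{X, p}\<close> is the only element of \<open>M\<close> that belongs to no
  element of \<open>M\<close>, so it is fixed by every elementary embedding of \<open>M\<close>. Since \<open>p \<in> X\<close>, foundation excludes
  that \<open>X\<close> is mapped to \<open>p\<close>. So \<open>X\<close> and \<open>p\<close> are fixed, and the embedding restricts to \<open>X\<close>.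
\<close>

lemma proto_Berkeley_fixing:
  assumes l: "proto_Berkeley vempty l"
  obtains X j \<kappa> where "pair_embedding X j" "mem l X" "mem p X" "app j p = p" "mem \<kappa> l" "Ordinal \<kappa>"
    "app j \<kappa> \<noteq> \<kappa>" "\<And>\<xi>. mem \<xi> \<kappa> \<Longrightarrow> app j \<xi> = \<xi>"
proof -
  obtain X where X: "Univ X" "mem \<langle>l, p\<rangle> X" using Univ_exists .
  then have lX: "mem l X" and pX: "mem p X" by (simp_all add: Univ_vpair)
  define T where "T = vinsert X (vinsert p vempty)"
  define M where "M = vinsert T (vinsert X X)"
  have T: "mem x T \<longleftrightarrow> x = X \<or> x = p" for x unfolding T_def by simp
  have M: "mem x M \<longleftrightarrow> x = T \<or> x = X \<or> mem x X" for x unfolding M_def by simp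
  have "Transitive M" unfolding Transitive_iff M using T pX Univ_trans[OF X(1)] by metis
  moreover have "mem l M" using M lX by simp
  ultimately obtain j \<kappa> where j: "mem_emb M j" and \<kappa>: "is_crit M j \<kappa>" "mem \<kappa> l"
    using l unfolding proto_Berkeley_def mem_Collect_eq by blast
  interpret elementary M j by unfold_locales (rule j)
  have TX: "\<not> mem T X" using T[of X] mem_asym by blast
  have jT: "app j T = T"
  proof -
    have "\<not> (\<exists>y. mem y M \<and> mem T y)" using M TX Univ_trans[OF X(1)] by (metis mem_irrefl)
    then have "\<not> (\<exists>y. mem y M \<and> mem (app j T) y)" using j_top[of T] M by simp
    moreover have "mem (app j T) M" using jM M by simp
    moreover have "\<exists>y. mem y M \<and> mem X y" "mem x X \<Longrightarrow> \<exists>y. mem y M \<and> mem x y" for x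
      using M T by blast+
    ultimately show ?thesis using M by metis
  qed
  have jX': "app j X = X \<or> app j X = p" "app j p = X \<or> app j p = p"
    using j_mem[of X T] j_mem[of p T] M T pX jT by auto
  have jpX: "mem (app j p) (app j X)" using j_mem[of p X] M pX by simp
  have jX: "app j X = X"
    using jX' jpX pX mem_irrefl mem_asym by metis
  have jp: "app j p = p" using jX' jpX jX by auto
  have jfun: "is_fun (vlam X (vapp j)) X X" and japp: "\<And>x. mem x X \<Longrightarrow> app (vlam X (vapp j)) x = app j x"
  proof -
    have XM: "\<And>x. mem x X \<Longrightarrow> mem x M" using M by simp
    show *: "\<And>x. mem x X \<Longrightarrow> app (vlam X (vapp j)) x = app j x" using vlam_restrict(2)[OF j_fun XM] .
    show "is_fun (vlam X (vapp j)) X X"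
      by (rule fun_codom[OF vlam_restrict(1)[OF j_fun XM]]) (use * j_mem[OF XM, of _ X] M jX in auto)
  qed
  have jX_in: "mem (app j x) X" if "mem x X" for x using fun_val[OF jfun that] japp[OF that] by simp
  have up: "app j (vinsert x (vinsert y vempty)) = vinsert (app j x) (vinsert (app j y) vempty)"
    if x: "mem x X" and y: "mem y X" for x y
  proof -
    let ?z = "vinsert x (vinsert y vempty)"
    have z: "mem ?z X" by (intro Univ_insert X(1) x y Univ_vempty[OF X(1) y])
    have "\<not> (\<exists>w. mem w M \<and> mem w (app j ?z) \<and> w \<noteq> app j x \<and> w \<noteq> app j y)"
    proof -
      have "mem x M" "mem y M" "mem ?z M" using x y z M by simp_all
      then show ?thesis using j_pair[of x y ?z] by auto
    qed
    moreover have "mem w M" if "mem w (app j ?z)" for w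
      using Univ_trans[OF X(1) jX_in[OF z] that] M by simp
    moreover have "mem (app j x) (app j ?z)" "mem (app j y) (app j ?z)"
      using j_mem[of x ?z] j_mem[of y ?z] x y z M by simp_all
    ultimately show ?thesis by (intro elts_eqI) auto
  qed
  have single: "vinsert x vempty = vinsert x (vinsert x vempty)" for x :: 'a by (rule elts_eqI) simp
  have jpair: "app j \<langle>x, y\<rangle> = \<langle>app j x, app j y\<rangle>" if x: "mem x X" and y: "mem y X" for x y
  proof -
    have *: "\<langle>x, y\<rangle> = vinsert (vinsert x (vinsert x vempty)) (vinsert (vinsert x (vinsert y vempty)) vempty)" for x y :: 'a
      using vpair_vinsert[of x y] single[of x] by simp
    have "mem (vinsert x (vinsert x vempty)) X" "mem (vinsert x (vinsert y vempty)) X"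
      by (intro Univ_insert X(1) x y Univ_vempty[OF X(1) y])+
    then show ?thesis unfolding * using up x y by simp
  qed
  show ?thesis
  proof (rule that)
    show "pair_embedding X (vlam X (vapp j))"
    proof
      show "mem x X \<Longrightarrow> mem y X \<Longrightarrow> mem (app (vlam X (vapp j)) x) (app (vlam X (vapp j)) y) \<longleftrightarrow> mem x y" for x y
        using j_mem[of x y] japp M by simp
      show "mem x X \<Longrightarrow> mem y X \<Longrightarrow> app (vlam X (vapp j)) \<langle>x, y\<rangle> = \<langle>app (vlam X (vapp j)) x, app (vlam X (vapp j)) y\<rangle>" for x y
        using jpair japp Univ_vpair[OF X(1)] by simp
    qed (fact X(1), fact jfun)
    show "mem l X" "mem p X" "mem \<kappa> l" by fact+
    show "app (vlam X (vapp j)) p = p" using japp pX jp by simp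
    have \<kappa>X: "mem \<kappa> X" using Univ_trans[OF X(1) lX \<kappa>(2)] .
    show "Ordinal \<kappa>" using \<kappa>(1) unfolding is_crit_def by simp
    show "app (vlam X (vapp j)) \<kappa> \<noteq> \<kappa>" using \<kappa>(1) japp[OF \<kappa>X] unfolding is_crit_def by simp
    show "app (vlam X (vapp j)) \<xi> = \<xi>" if "mem \<xi> \<kappa>" for \<xi>
    proof -
      have "mem \<xi> X" using Univ_trans[OF X(1) \<kappa>X that] .
      moreover from this have "app j \<xi> = \<xi>"
        using \<kappa>(1) that Ordinal_mem[OF \<open>Ordinal \<kappa>\<close> that] M unfolding is_crit_def by auto
      ultimately show ?thesis using japp by simp
    qed
  qed
qed

section \<open>Chains of theories\<close>

lemma has_rel_type_iff:
  assumes I: "\<exists>Y. is_fun I \<tau> Y" and r: "mem r \<tau>"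
  shows "has_rel_type r A I M R \<longleftrightarrow> (\<exists>f. Bij f A M \<and> (\<forall>x. mem x A \<longrightarrow> (\<forall>y. mem y A \<longrightarrow>
    (mem (seq2 x y) (vapp I r) \<longleftrightarrow> mem \<langle>vapp f x, vapp f y\<rangle> R))))"
proof -
  have "vapp I r = app I r" using I vapp_app[OF _ r] by blast
  moreover have "mem x A \<Longrightarrow> vapp f x = app f x" if "Bij f A M" for f x
    using that vapp_app unfolding Bij_def by blast
  ultimately show ?thesis unfolding has_rel_type_def mem_Collect_eq Ball_def by (simp cong: conj_cong)
qed

text \<open>A definable form of the existence of a model.\<close>

definition has_model' :: "'a::ZF \<Rightarrow> 'a \<Rightarrow> 'a \<Rightarrow> 'a \<Rightarrow> 'a \<Rightarrow> bool" where
  "has_model' \<tau> r T M R \<longleftrightarrow> (\<exists>A I. Structure \<tau> A I \<and> (\<forall>\<phi>. mem \<phi> T \<longrightarrow> Sat' \<tau> A I vempty \<phi> vempty) \<and>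
     (\<exists>f. Bij f A M \<and> (\<forall>x. mem x A \<longrightarrow> (\<forall>y. mem y A \<longrightarrow>
       (mem (seq2 x y) (vapp I r) \<longleftrightarrow> mem \<langle>vapp f x, vapp f y\<rangle> R)))))"

lemma D_has_model' [D_intros]:
  assumes "DF t" "DF r" "DF T" "DF M" "DF R" shows "D (\<lambda>x. has_model' (t x) (r x) (T x) (M x) (R x))"
  unfolding has_model'_def by (intro D_intros assms[THEN DF_comp])

lemma has_model_iff:
  assumes "Vocabulary \<tau>" "mem r \<tau>"
  shows "has_model_of_type fo_models \<tau> r T M R \<longleftrightarrow> has_model' \<tau> r T M R"
proof -
  have "(Structure \<tau> A I \<and> (\<forall>\<phi>\<in>elts T. fo_models \<tau> A I \<phi>) \<and> has_rel_type r A I M R) \<longleftrightarrow>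
    (Structure \<tau> A I \<and> (\<forall>\<phi>. mem \<phi> T \<longrightarrow> Sat' \<tau> A I vempty \<phi> vempty) \<and>
     (\<exists>f. Bij f A M \<and> (\<forall>x. mem x A \<longrightarrow> (\<forall>y. mem y A \<longrightarrow>
       (mem (seq2 x y) (vapp I r) \<longleftrightarrow> mem \<langle>vapp f x, vapp f y\<rangle> R)))))" for A I
  proof (cases "Structure \<tau> A I")
    case True
    then interpret fo_structure \<tau> A I by unfold_locales (use assms in auto)
    have "\<exists>Y. is_fun I \<tau> Y" using True unfolding Structure_def by simp
    then show ?thesis using has_rel_type_iff[OF _ assms(2)] by (simp add: fo_models_def Sat_eq)
  qed simp
  then show ?thesis unfolding has_model_of_type_def has_model'_def by simp
qed

text \<open>
  The hypotheses of chain compactness, in definable form and with the union left implicit.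
\<close>

definition model_chain :: "'a::ZF \<Rightarrow> 'a \<Rightarrow> 'a \<Rightarrow> 'a \<Rightarrow> 'a \<Rightarrow> 'a \<Rightarrow> bool" where
  "model_chain M R \<mu> \<tau> a C \<longleftrightarrow> Ordinal \<mu> \<and> Vocabulary \<tau> \<and> mem (relsym v2 a) \<tau> \<and> (\<exists>Y. is_fun C \<mu> Y) \<and>
     (\<forall>\<beta>. mem \<beta> \<mu> \<longrightarrow> (\<forall>\<gamma>. mem \<gamma> \<beta> \<longrightarrow> elts (vapp C \<gamma>) \<subseteq> elts (vapp C \<beta>)) \<and>
       (\<forall>\<phi>. mem \<phi> (vapp C \<beta>) \<longrightarrow> Form (voc \<tau>) vempty \<phi>) \<and> has_model' \<tau> (relsym v2 a) (vapp C \<beta>) M R)"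

lemma D_model_chain [D_intros]:
  assumes "DF m" "DF t" "DF a" "DF C" shows "D (\<lambda>x. model_chain M R (m x) (t x) (a x) (C x))"
  unfolding model_chain_def by (intro D_intros assms[THEN DF_comp] assms)

lemma chain_compact_iff:
  assumes \<mu>: "Ordinal \<mu>"
  shows "chain_compact fo_sentence fo_models \<mu> M R \<longleftrightarrow>
    (\<forall>\<tau> a C. model_chain M R \<mu> \<tau> a C \<longrightarrow> has_model' \<tau> (relsym v2 a) (vUN \<mu> (vapp C)) M R)"
    (is "?L \<longleftrightarrow> ?R")
proof
  assume L: ?L
  show ?R
  proof (intro allI impI)
    fix \<tau> a C assume C: "model_chain M R \<mu> \<tau> a C"
    then obtain Y where Y: "is_fun C \<mu> Y" and \<tau>: "Vocabulary \<tau>" and r: "mem (relsym v2 a) \<tau>"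
      unfolding model_chain_def by blast
    have app: "app C \<beta> = vapp C \<beta>" if "mem \<beta> \<mu>" for \<beta> using vapp_app[OF Y that] by simp
    let ?T = "vUN \<mu> (vapp C)"
    have T: "mem \<phi> ?T \<longleftrightarrow> (\<exists>\<beta>. mem \<beta> \<mu> \<and> mem \<phi> (app C \<beta>))" for \<phi>
      using app by (auto simp: mem_vUN DF_vapp1)
    have "has_model_of_type fo_models \<tau> (relsym v2 a) ?T M R"
    proof (rule L[unfolded chain_compact_def mem_Collect_eq Ball_def, rule_format, of \<tau> a ?T C], intro conjI allI impI)
      show "fo_sentence \<tau> \<phi>" if "mem \<phi> ?T" for \<phi>
        using that C app \<tau> unfolding T model_chain_def fo_sentence_def by auto
      show "elts (app C \<gamma>) \<subseteq> elts (app C \<beta>)" if "mem \<beta> \<mu>" "mem \<gamma> \<beta>" for \<beta> \<gamma>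
        using that C app Ordinal_trans[OF \<mu> that] unfolding model_chain_def by metis
      show "elts ?T = (\<Union>\<beta>\<in>elts \<mu>. elts (app C \<beta>))" using T by auto
      show "has_model_of_type fo_models \<tau> (relsym v2 a) (app C \<beta>) M R" if "mem \<beta> \<mu>" for \<beta>
        using that C app unfolding has_model_iff[OF \<tau> r] model_chain_def by metis
    qed (use \<tau> r Y in blast)+
    then show "has_model' \<tau> (relsym v2 a) ?T M R" unfolding has_model_iff[OF \<tau> r] .
  qed
next
  assume R: ?R
  show ?L unfolding chain_compact_def mem_Collect_eq Ball_def
  proof (intro allI impI, elim conjE exE)
    fix \<tau> a T C Y
    assume \<tau>: "Vocabulary \<tau>" and r: "mem (relsym v2 a) \<tau>" and S: "\<forall>\<phi>. mem \<phi> T \<longrightarrow> fo_sentence \<tau> \<phi>"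
      and mono: "\<forall>\<beta>. mem \<beta> \<mu> \<longrightarrow> (\<forall>\<gamma>. mem \<gamma> \<beta> \<longrightarrow> elts (app C \<gamma>) \<subseteq> elts (app C \<beta>))"
      and T: "elts T = (\<Union>\<beta>\<in>elts \<mu>. elts (app C \<beta>))"
      and mod: "\<forall>\<beta>. mem \<beta> \<mu> \<longrightarrow> has_model_of_type fo_models \<tau> (relsym v2 a) (app C \<beta>) M R"
      and Y: "is_fun C \<mu> Y"
    have app: "vapp C \<beta> = app C \<beta>" if "mem \<beta> \<mu>" for \<beta> using vapp_app[OF Y that] .
    have T: "mem \<phi> T \<longleftrightarrow> (\<exists>\<beta>. mem \<beta> \<mu> \<and> mem \<phi> (vapp C \<beta>))" for \<phi>
      using T app by (auto simp: set_eq_iff)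
    then have TU: "vUN \<mu> (vapp C) = T" by (intro elts_eqI) (simp add: mem_vUN DF_vapp1)
    have "model_chain M R \<mu> \<tau> a C" unfolding model_chain_def
    proof (intro conjI allI impI)
      show "elts (vapp C \<gamma>) \<subseteq> elts (vapp C \<beta>)" if "mem \<beta> \<mu>" "mem \<gamma> \<beta>" for \<beta> \<gamma>
        using that mono app Ordinal_trans[OF \<mu> that] by metis
      show "Form (voc \<tau>) vempty \<phi>" if "mem \<beta> \<mu>" "mem \<phi> (vapp C \<beta>)" for \<beta> \<phi>
        using that T S \<tau> unfolding fo_sentence_def by auto
      show "has_model' \<tau> (relsym v2 a) (vapp C \<beta>) M R" if "mem \<beta> \<mu>" for \<beta>
        using that mod app unfolding has_model_iff[OF \<tau> r] by metis
    qed (use \<mu> \<tau> r Y in blast)+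
    then show "has_model_of_type fo_models \<tau> (relsym v2 a) T M R"
      using R TU unfolding has_model_iff[OF \<tau> r] by metis
  qed
qed

context pair_embedding
begin

text \<open>
  The graph \<open>W\<close> of the successor function is fixed, so the values at successors are determined.
\<close>

lemma j_Natural:
  assumes om: "mem omega X" and z: "app j vempty = vempty"
    and W: "mem W X" "app j W = W" "\<And>p. mem p W \<longleftrightarrow> (\<exists>n. Natural n \<and> p = \<langle>n, vsucc n\<rangle>)"
    and n: "Natural n"
  shows "app j n = n"
proof -
  note N = Univ_numerals(1)[OF X om]
  have "D (\<lambda>n. vapp j n = n)" by (intro D_intros)
  moreover have "mem n omega" using n by simp
  ultimately have "vapp j n = n"
  proof (induction rule: nat_induct)
    case zero
    then show ?case using vapp_app[OF j_fun] Univ_numerals(2)[OF X om] z by simp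
  next
    case (succ n)
    then have n: "Natural n" "mem n X" "mem (vsucc n) X" "app j n = n"
      using N Natural_vsucc vapp_app[OF j_fun] by auto
    have "mem (app j \<langle>n, vsucc n\<rangle>) (app j W)" using j_mem[of "\<langle>n, vsucc n\<rangle>" W] n W by (simp add: Univ_vpair[OF X])
    then have "mem \<langle>n, app j (vsucc n)\<rangle> W" using n W(2) by (simp add: j_vpair)
    then have "app j (vsucc n) = vsucc n" using W(3) by auto
    then show ?case using vapp_app[OF j_fun n(3)] by simp
  qed
  then show ?thesis using vapp_app[OF j_fun N[OF n]] by simp
qed

lemma j_app:
  assumes f: "is_fun f A B" "mem f X" "is_fun (app j f) A' B'" and x: "mem x A"
  shows "app (app j f) (app j x) = app j (app f x)"
proof (rule app_unique[OF f(3)])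
  have p: "mem \<langle>x, app f x\<rangle> f" using fun_pair[OF f(1)] x by simp
  then have "mem \<langle>x, app f x\<rangle> X" by (rule Univ_trans[OF X f(2)])
  moreover from this have "mem x X" "mem (app f x) X" by (simp_all add: Univ_vpair[OF X])
  ultimately show "mem \<langle>app j x, app j (app f x)\<rangle> (app j f)"
    using j_mem[OF _ f(2)] p j_vpair by metis
qed

end

section \<open>Renaming a model along an embedding\<close>

locale fo_embedding = pair_embedding X j for X j :: "'a::ZF" +
  fixes X0 :: 'a
  assumes X0: "Univ X0" "mem omega X0" and X0_X: "mem x X0 \<Longrightarrow> mem x X"
    and j_nat: "Natural n \<Longrightarrow> app j n = n"
    and j_is_fun: "mem u X0 \<Longrightarrow> mem k X0 \<Longrightarrow> is_fun u k Y \<Longrightarrow> \<exists>Y. is_fun (app j u) (app j k) Y"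
begin

lemma nat_X0: "Natural n \<Longrightarrow> mem n X0"
  using Univ_numerals(1)[OF X0] .

lemmas vpair_X0 = Univ_vpair[OF X0(1)]

lemma j_vpair0: "mem \<langle>x, y\<rangle> X0 \<Longrightarrow> app j \<langle>x, y\<rangle> = \<langle>app j x, app j y\<rangle>"
  using j_vpair X0_X vpair_X0 by blast

lemma vapp_j: "mem x X0 \<Longrightarrow> vapp j x = app j x"
  using vapp_app[OF j_fun X0_X] .

text \<open>
  As \<open>j\<close> commutes with pairs, fixes natural numbers and maps a finite sequence to the sequence of the images,
  it maps codes of formulas of \<open>\<tau>\<close> to the codes of the formulas of \<open>j(\<tau>)\<close> obtained by renaming the symbols.
\<close>

lemma renamed_model:
  assumes \<tau>: "Vocabulary \<tau>" "mem \<tau> X0" and \<tau>': "Vocabulary (app j \<tau>)" and I: "Structure (app j \<tau>) A I"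
  defines "I' \<equiv> vlam \<tau> (\<lambda>x. vapp I (vapp j x))"
  shows "Structure \<tau> A I'" and "mem x \<tau> \<Longrightarrow> app I' x = app I (app j x)"
    and "Form \<tau> vempty \<phi> \<Longrightarrow> Sat \<tau> A I' vempty \<phi> vempty \<longleftrightarrow> Sat (app j \<tau>) A I vempty (app j \<phi>) vempty"
    and "Form \<tau> vempty \<phi> \<Longrightarrow> mem \<phi> X0"
proof -
  interpret tgt: fo_structure "app j \<tau>" A I by unfold_locales (fact \<tau>', fact I)
  have DI: "DF (\<lambda>x. vapp I (vapp j x))" by (intro D_intros)
  have sym: "mem x X0" "mem (app j x) (app j \<tau>)" if "mem x \<tau>" for x
  proof -
    show "mem x X0" by (rule Univ_trans[OF X0(1) \<tau>(2) that])
    then show "mem (app j x) (app j \<tau>)" using j_mem X0_X \<tau>(2) that by blast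
  qed
  have app_I': "app I' x = app I (app j x)" if "mem x \<tau>" for x
    using that sym[OF that] by (simp add: I'_def app_vlam[OF DI] vapp_j tgt.vapp_I)
  have jrel: "app j (relsym k a) = relsym k (app j a)" if "mem (relsym k a) \<tau>" for k a
    using sym(1)[OF that] j_nat[OF Natural_vempty] j_nat[OF Vocabulary_arity(1)[OF \<tau>(1) that]]
    by (simp add: relsym_def j_vpair0 vpair_X0)
  have jfun: "app j (funsym k a) = funsym k (app j a)" if "mem (funsym k a) \<tau>" for k a
    using sym(1)[OF that] j_nat[OF Natural_v(1)] j_nat[OF Vocabulary_arity(2)[OF \<tau>(1) that]]
    by (simp add: funsym_def j_vpair0 vpair_X0)
  have jcon: "app j (consym a) = consym (app j a)" if "mem (consym a) \<tau>" for a
    using sym(1)[OF that] j_nat[OF Natural_v(2)] by (simp add: consym_def j_vpair0 vpair_X0)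
  have I': "Structure \<tau> A I'"
    unfolding Structure_def
  proof (intro conjI allI impI)
    show "\<exists>Y. is_fun I' \<tau> Y" unfolding I'_def by (rule vlam_fun_ex[OF DI])
    show "elts (app I' (relsym k a)) \<subseteq> elts (Pow_fun A k)" if "relsym k a \<in> elts \<tau>" for k a
      using that tgt.rel_I[of k "app j a"] sym(2)[of "relsym k a"] by (auto simp: app_I' jrel)
    show "is_fun (app I' (funsym k a)) (Pow_fun A k) A" if "funsym k a \<in> elts \<tau>" for k a
      using that tgt.fun_I[of k "app j a"] sym(2)[of "funsym k a"] by (auto simp: app_I' jfun)
    show "app I' (consym a) \<in> elts A" if "consym a \<in> elts \<tau>" for a
      using that tgt.con_I[of "app j a"] sym(2)[of "consym a"] by (auto simp: app_I' jcon)
  qed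
  interpret src: fo_structure \<tau> A I' by unfold_locales (fact \<tau>(1), fact I')
  have Tms_X0: "mem t X0" if "Natural n" "mem t (Tms \<tau> n)" for n t
    using Tms_subset[OF \<tau>(1) Univ_closed_tm[OF X0 \<tau> nat_X0[OF that(1)]] that(2)] .
  have Form_X0: "mem \<phi> X0" if "Natural n" "Form \<tau> n \<phi>" for n \<phi>
    using Univ_closed_fm[OF X0 \<tau>] that(2) unfolding Form_def by (auto simp: vpair_X0)
  have jH: "app j u = vcomp (vlam (Tms \<tau> n) (vapp j)) u" "mem u X0"
    if n: "Natural n" and k: "Natural k" and u: "is_fun u k (Tms \<tau> n)" for n k u
  proof -
    have u0: "is_fun u k X0" using is_fun_mono[OF u] Tms_X0[OF n] by blast
    show uX: "mem u X0" by (rule Univ_finite_fun[OF X0(1) _ u0 nat_X0[OF k]]) (use k in simp)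
    obtain Y where ju: "is_fun (app j u) k Y" using j_is_fun[OF uX nat_X0[OF k] u] j_nat[OF k] by auto
    obtain B where B: "is_fun (vlam (Tms \<tau> n) (vapp j)) (Tms \<tau> n) B" using vlam_fun_ex[OF DF_vapp1] by blast
    show "app j u = vcomp (vlam (Tms \<tau> n) (vapp j)) u"
    proof (rule fun_ext[OF ju vcomp_fun[OF u B]])
      fix i assume i: "mem i k"
      have "app (app j u) (app j i) = app j (app u i)"
        by (rule j_app[OF u X0_X[OF uX] _ i]) (use ju j_nat[OF k] in simp)
      then show "app (app j u) i = app (vcomp (vlam (Tms \<tau> n) (vapp j)) u) i"
        using j_nat[OF Natural_mem[OF k i]] fun_val[OF u i] vapp_j[OF Tms_X0[OF n fun_val[OF u i]]]
        by (simp add: app_vcomp[OF u B i] app_vlam[OF DF_vapp1])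
    qed
  qed
  have jv: "vapp j x = app j x" if "mem x \<tau>" for x using vapp_j[OF sym(1)[OF that]] .
  interpret tr: fo_translation \<tau> A I' "app j \<tau>" A I "vapp j" "vlam A (\<lambda>x. x)"
  proof
    show "DF (vapp j)" by (rule DF_vapp1)
    show "is_fun (vlam A (\<lambda>x. x)) A A" by (rule vlam_id_fun)
    show "mem x A \<Longrightarrow> mem y A \<Longrightarrow> app (vlam A (\<lambda>x. x)) x = app (vlam A (\<lambda>x. x)) y \<Longrightarrow> x = y" for x y
      by (simp add: app_vlam[OF DF_id])
    show "mem z A \<Longrightarrow> \<exists>x. mem x A \<and> app (vlam A (\<lambda>x. x)) x = z" for z
      using app_vlam[OF DF_id] by blast
    show "\<exists>a'. vapp j (relsym k a) = relsym k a' \<and> mem (relsym k a') (app j \<tau>) \<and>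
      (\<forall>p. is_fun p k A \<longrightarrow> (mem p (app I' (relsym k a)) \<longleftrightarrow> mem (vcomp (vlam A (\<lambda>x. x)) p) (app I (relsym k a'))))"
      if "mem (relsym k a) \<tau>" for k a
      using that sym(2)[OF that] by (intro exI[of _ "app j a"]) (simp add: jv jrel app_I' vcomp_vlam_id)
    show "\<exists>a'. vapp j (funsym k a) = funsym k a' \<and> mem (funsym k a') (app j \<tau>) \<and>
      (\<forall>p. is_fun p k A \<longrightarrow> app (vlam A (\<lambda>x. x)) (app (app I' (funsym k a)) p) =
        app (app I (funsym k a')) (vcomp (vlam A (\<lambda>x. x)) p))"
      if "mem (funsym k a) \<tau>" for k a
      using that sym(2)[OF that] fun_val[OF tgt.fun_I, of k "app j a"]
      by (intro exI[of _ "app j a"]) (simp add: jv jfun app_I' vcomp_vlam_id app_vlam[OF DF_id])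
    show "\<exists>a'. vapp j (consym a) = consym a' \<and> mem (consym a') (app j \<tau>) \<and>
      app (vlam A (\<lambda>x. x)) (app I' (consym a)) = app I (consym a')"
      if "mem (consym a) \<tau>" for a
      using that sym(2)[OF that] tgt.con_I[of "app j a"]
      by (intro exI[of _ "app j a"]) (simp add: jv jcon app_I' app_vlam[OF DF_id])
    show "vapp j (var_tm i) = var_tm i" if n: "Natural n" and i: "mem i n" for n i
      using Tms_X0[OF n Tms_var[OF \<tau>(1) i]] j_nat[OF Natural_vempty] j_nat[OF Natural_mem[OF n i]]
      by (simp add: vapp_j) (simp add: var_tm_def j_vpair0)
    show "vapp j (con_tm (consym a)) = con_tm (vapp j (consym a))" if a: "mem (consym a) \<tau>" for a
      using Tms_X0[OF Natural_vempty Tms_con[OF \<tau>(1) a]] j_nat[OF Natural_v(1)]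
      by (simp add: vapp_j jv[OF a]) (simp add: con_tm_def j_vpair0)
    show "vapp j (fun_tm (funsym k a) u) = fun_tm (vapp j (funsym k a)) (vcomp (vlam (Tms \<tau> n) (vapp j)) u)"
      if n: "Natural n" and f: "mem (funsym k a) \<tau>" and u: "is_fun u k (Tms \<tau> n)" for n k a u
      using Tms_X0[OF n Tms_fun[OF \<tau>(1) f u]] j_nat[OF Natural_v(2)] jH[OF n Vocabulary_arity(2)[OF \<tau>(1) f] u]
      by (simp add: vapp_j jv[OF f]) (simp add: fun_tm_def j_vpair0 vpair_X0)
    show "vapp j (eq_fm t u) = eq_fm (vapp j t) (vapp j u)"
      if n: "Natural n" and t: "mem t (Tms \<tau> n)" and u: "mem u (Tms \<tau> n)" for n t u
      using Form_X0[OF n Form_eq[OF n t u]] Tms_X0[OF n t] Tms_X0[OF n u] j_nat[OF Natural_vempty]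
      by (simp add: vapp_j) (simp add: eq_fm_def j_vpair0 vpair_X0)
    show "vapp j (rel_fm (relsym k a) u) = rel_fm (vapp j (relsym k a)) (vcomp (vlam (Tms \<tau> n) (vapp j)) u)"
      if n: "Natural n" and r: "mem (relsym k a) \<tau>" and u: "is_fun u k (Tms \<tau> n)" for n k a u
      using Form_X0[OF n Form_rel[OF n r u]] j_nat[OF Natural_v(1)] jH[OF n Vocabulary_arity(1)[OF \<tau>(1) r] u]
      by (simp add: vapp_j jv[OF r]) (simp add: rel_fm_def j_vpair0 vpair_X0)
    show "vapp j (neg_fm \<phi>) = neg_fm (vapp j \<phi>)" if n: "Natural n" and \<phi>: "Form \<tau> n \<phi>" for n \<phi>
      using Form_X0[OF n Form_neg[OF n \<phi>]] Form_X0[OF n \<phi>] j_nat[OF Natural_v(2)]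
      by (simp add: vapp_j) (simp add: neg_fm_def j_vpair0)
    show "vapp j (and_fm \<phi> \<psi>) = and_fm (vapp j \<phi>) (vapp j \<psi>)"
      if n: "Natural n" and \<phi>: "Form \<tau> n \<phi>" and \<psi>: "Form \<tau> n \<psi>" for n \<phi> \<psi>
      using Form_X0[OF n Form_and[OF n \<phi> \<psi>]] Form_X0[OF n \<phi>] Form_X0[OF n \<psi>] j_nat[OF Natural_v(3)]
      by (simp add: vapp_j) (simp add: and_fm_def j_vpair0 vpair_X0)
    show "vapp j (ex_fm \<phi>) = ex_fm (vapp j \<phi>)" if n: "Natural n" and \<phi>: "Form \<tau> (vsucc n) \<phi>" for n \<phi>
      using Form_X0[OF n Form_ex[OF n \<phi>]] Form_X0[OF Natural_vsucc[OF n] \<phi>] j_nat[OF Natural_v(4)]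
      by (simp add: vapp_j) (simp add: ex_fm_def j_vpair0)
  qed
  show "Structure \<tau> A I'" by (rule I')
  show "mem x \<tau> \<Longrightarrow> app I' x = app I (app j x)" by (rule app_I')
  show X: "mem \<phi> X0" if "Form \<tau> vempty \<phi>" using Form_X0[OF Natural_vempty that] .
  show "Sat \<tau> A I' vempty \<phi> vempty \<longleftrightarrow> Sat (app j \<tau>) A I vempty (app j \<phi>) vempty" if "Form \<tau> vempty \<phi>"
    using tr.Sat_translate[OF Natural_vempty that fun_vempty] vapp_j[OF X[OF that]] by simp
qed

end

section \<open>From proto Berkeley cardinals to chain compactness\<close>

theorem proto_Berkeley_imp_chain_compact:
  fixes l M R :: "'a::ZF"
  assumes l: "proto_Berkeley vempty l"
  shows "\<exists>\<mu>. mem \<mu> l \<and> InfCardinal \<mu> \<and> chain_compact fo_sentence fo_models \<mu> M R"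
proof (rule ccontr)
  assume contra: "\<not> ?thesis"
  \<comment> \<open>\<open>Ctr \<mu> x\<close>: the triple \<open>x\<close> is a counterexample to \<open>\<mu>\<close>-chain compactness.\<close>
  define Ctr where "Ctr \<mu> x \<longleftrightarrow> (\<exists>\<tau> a C. x = \<langle>\<langle>\<tau>, a\<rangle>, C\<rangle> \<and> model_chain M R \<mu> \<tau> a C \<and>
    \<not> has_model' \<tau> (relsym v2 a) (vUN \<mu> (vapp C)) M R)" for \<mu> x
  have DCtr: "D (\<lambda>z. InfCardinal (vfst z) \<longrightarrow> Ctr (vfst z) (vsnd z))"
    unfolding Ctr_def by (intro D_intros)
  have ex: "\<exists>x. InfCardinal \<mu> \<longrightarrow> Ctr \<mu> x" if "mem \<mu> l" for \<mu>
  proof (cases "InfCardinal \<mu>")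
    case True
    then have "\<not> chain_compact fo_sentence fo_models \<mu> M R" using contra that by blast
    moreover have "Ordinal \<mu>" using True unfolding InfCardinal_def Cardinal_def by simp
    ultimately obtain \<tau> a C where "Ctr \<mu> \<langle>\<langle>\<tau>, a\<rangle>, C\<rangle>"
      unfolding Ctr_def using chain_compact_iff[of \<mu> M R] by blast
    then show ?thesis by blast
  qed simp
  obtain b where b: "\<And>\<mu>. mem \<mu> l \<Longrightarrow> \<exists>x. mem x b \<and> (InfCardinal \<mu> \<longrightarrow> Ctr \<mu> x)"
    using collection[of "\<lambda>\<mu> x. InfCardinal \<mu> \<longrightarrow> Ctr \<mu> x" l, OF DCtr ex] by blast
  \<comment> \<open>The power set of \<open>l \<times> l\<close> puts the bijections between elements of \<open>l\<close> into \<open>X0\<close>.\<close>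
  obtain X0 where X0: "Univ X0" "mem \<langle>\<langle>b, l\<rangle>, \<langle>vPow (vprod l l), omega\<rangle>\<rangle> X0" using Univ_exists .
  then have X0m: "mem b X0" "mem l X0" "mem (vPow (vprod l l)) X0" "mem omega X0" by (simp_all add: Univ_vpair)

  \<comment> \<open>The relations to be preserved: being a function with a given domain, being the successor of a
    natural number, being a bijection between given sets, being a chain of theories with models.\<close>
  have "D (\<lambda>p. \<exists>Y. is_fun (vfst p) (vsnd p) Y)" by (intro D_intros)
  from sep_ex[OF this, of X0] obtain Wf where Wf: "\<And>p. mem p Wf \<longleftrightarrow> mem p X0 \<and> (\<exists>Y. is_fun (vfst p) (vsnd p) Y)" by blast
  have "D (\<lambda>p. Natural (vfst p) \<and> vsnd p = vsucc (vfst p))" by (intro D_intros)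
  from sep_ex[OF this, of "vprod omega omega"] obtain Ws :: 'a where
    "\<And>p. mem p Ws \<longleftrightarrow> mem p (vprod omega omega) \<and> Natural (vfst p) \<and> vsnd p = vsucc (vfst p)" by blast
  then have Ws: "mem p Ws \<longleftrightarrow> (\<exists>n. Natural n \<and> p = \<langle>n, vsucc n\<rangle>)" for p using Natural_vsucc by auto
  have "D (\<lambda>p. Bij (vfst p) (vfst (vsnd p)) (vsnd (vsnd p)))" by (intro D_intros)
  from sep_ex[OF this, of X0] obtain Wb where
    Wb: "\<And>p. mem p Wb \<longleftrightarrow> mem p X0 \<and> Bij (vfst p) (vfst (vsnd p)) (vsnd (vsnd p))" by blast
  have "D (\<lambda>p. model_chain M R (vfst p) (vfst (vfst (vsnd p))) (vsnd (vfst (vsnd p))) (vsnd (vsnd p)))" by (intro D_intros)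
  from sep_ex[OF this, of X0] obtain Wc where Wc: "\<And>p. mem p Wc \<longleftrightarrow> mem p X0 \<and>
    model_chain M R (vfst p) (vfst (vfst (vsnd p))) (vsnd (vfst (vsnd p))) (vsnd (vsnd p))" by blast

  obtain X j \<kappa> where emb: "pair_embedding X j" and lX: "mem l X"
    and pX: "mem \<langle>\<langle>vempty, X0\<rangle>, \<langle>\<langle>Wf, Ws\<rangle>, \<langle>Wb, Wc\<rangle>\<rangle>\<rangle> X"
    and jp: "app j \<langle>\<langle>vempty, X0\<rangle>, \<langle>\<langle>Wf, Ws\<rangle>, \<langle>Wb, Wc\<rangle>\<rangle>\<rangle> = \<langle>\<langle>vempty, X0\<rangle>, \<langle>\<langle>Wf, Ws\<rangle>, \<langle>Wb, Wc\<rangle>\<rangle>\<rangle>"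
    and \<kappa>: "mem \<kappa> l" "Ordinal \<kappa>" "app j \<kappa> \<noteq> \<kappa>" and fixd: "\<And>\<xi>. mem \<xi> \<kappa> \<Longrightarrow> app j \<xi> = \<xi>"
    using proto_Berkeley_fixing[OF l, of "\<langle>\<langle>vempty, X0\<rangle>, \<langle>\<langle>Wf, Ws\<rangle>, \<langle>Wb, Wc\<rangle>\<rangle>\<rangle>"] by metis
  interpret pair_embedding X j by fact
  have mX: "mem vempty X" "mem X0 X" "mem Wf X" "mem Ws X" "mem Wb X" "mem Wc X"
    using pX by (simp_all add: Univ_vpair[OF X])
  have jW: "app j vempty = vempty" "app j X0 = X0" "app j Wf = Wf" "app j Ws = Ws" "app j Wb = Wb" "app j Wc = Wc"
    using jp mX by (simp_all add: j_vpair Univ_vpair[OF X])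
  have X0_X: "mem x X" if "mem x X0" for x using Univ_trans[OF X mX(2) that] .
  have pres: "mem (app j p) W" if "mem p W" "mem W X" "app j W = W" for p W
    using j_mem[of p W] Univ_trans[OF X that(2,1)] that by simp
  have jX0: "mem (app j x) X0" if "mem x X0" for x using pres[OF that mX(2) jW(2)] .
  have jp2: "app j \<langle>x, y\<rangle> = \<langle>app j x, app j y\<rangle>" if "mem \<langle>x, y\<rangle> X0" for x y
    using j_vpair that X0_X by (simp add: Univ_vpair[OF X0(1)])
  note V = Univ_vpair[OF X0(1)]
  have j_nat: "app j n = n" if "Natural n" for n
    by (rule j_Natural[OF X0_X[OF X0m(4)] jW(1) mX(4) jW(4) Ws that])
  interpret fo_embedding X j X0
  proof
    show "\<exists>Y. is_fun (app j u) (app j k) Y" if u: "mem u X0" "mem k X0" "is_fun u k Y" for u k Y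
    proof -
      have "mem \<langle>u, k\<rangle> Wf" using u by (auto simp: Wf V)
      from pres[OF this mX(3) jW(3)] show ?thesis using u by (simp add: jp2 V Wf)
    qed
  qed (fact X0(1), fact X0m(4), fact X0_X, fact j_nat)

  have \<kappa>0: "mem \<kappa> X0" using Univ_trans[OF X0(1) X0m(2) \<kappa>(1)] .
  \<comment> \<open>If \<open>f\<close> were a bijection from some \<open>a \<in> \<kappa>\<close> onto \<open>\<kappa>\<close>, then \<open>j(f)\<close> would be a bijection from \<open>a\<close> onto \<open>j(\<kappa>)\<close>
    with the same values as \<open>f\<close>, so that \<open>j(\<kappa>) = \<kappa>\<close>.\<close>
  have inf: "InfCardinal \<kappa>"
    unfolding InfCardinal_def Cardinal_iff
  proof (intro conjI allI impI notI)
    show "Ordinal \<kappa>" by fact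
    have "\<not> mem \<kappa> omega" using j_nat \<kappa>(3) by auto
    then have "\<kappa> = omega \<or> mem omega \<kappa>" using Ordinal_linear[OF \<kappa>(2) Ordinal_omega] by blast
    then show "elts omega \<subseteq> elts \<kappa>" using Ordinal_trans[OF \<kappa>(2)] by auto
    fix a assume a: "mem a \<kappa>" and "\<exists>f. Bij f a \<kappa>"
    then obtain f where f: "Bij f a \<kappa>" by blast
    then have ff: "is_fun f a \<kappa>" unfolding Bij_def by simp
    have lO: "Ordinal l" using l unfolding proto_Berkeley_def Cardinal_def by simp
    have "mem f (vPow (vprod l l))"
      using Ordinal_trans[OF lO \<kappa>(1)] Ordinal_trans[OF lO Ordinal_trans[OF lO \<kappa>(1) a]]
      by (auto simp: fun_mem[OF ff] fun_val[OF ff])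
    then have f0: "mem f X0" using Univ_trans[OF X0(1) X0m(3)] by blast
    have a0: "mem a X0" using Univ_trans[OF X0(1) \<kappa>0 a] .
    have "mem \<langle>f, \<langle>a, \<kappa>\<rangle>\<rangle> Wb" using f f0 a0 \<kappa>0 by (simp add: Wb V)
    from pres[OF this mX(5) jW(5)] have jf: "Bij (app j f) a (app j \<kappa>)"
      using f0 a0 \<kappa>0 fixd[OF a] by (simp add: jp2 V Wb)
    then have jff: "is_fun (app j f) a (app j \<kappa>)" unfolding Bij_def by simp
    have eq: "app (app j f) x = app f x" if x: "mem x a" for x
    proof -
      have "app (app j f) (app j x) = app j (app f x)"
        by (rule j_app[OF ff X0_X[OF f0] _ x]) (use jff fixd[OF a] in simp)
      then show ?thesis using fixd fun_val[OF ff x] Ordinal_trans[OF \<kappa>(2) a x] by simp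
    qed
    have "mem y \<kappa>" if y: "mem y (app j \<kappa>)" for y
    proof -
      obtain x where "mem x a" "app (app j f) x = y" using Bij_surj[OF jf y] by blast
      then show ?thesis using eq[of x] fun_val[OF ff, of x] by simp
    qed
    moreover have "mem y (app j \<kappa>)" if "mem y \<kappa>" for y
      using j_mem[OF X0_X X0_X, of y \<kappa>] Univ_trans[OF X0(1) \<kappa>0 that] \<kappa>0 that fixd by simp
    ultimately have "app j \<kappa> = \<kappa>" by (intro elts_eqI) auto
    then show False using \<kappa>(3) by simp
  qed

  obtain x where x: "mem x b" "Ctr \<kappa> x" using b[OF \<kappa>(1)] inf by blast
  have x0: "mem x X0" using Univ_trans[OF X0(1) X0m(1) x(1)] .
  obtain \<tau> a C where x_eq: "x = \<langle>\<langle>\<tau>, a\<rangle>, C\<rangle>" and mc: "model_chain M R \<kappa> \<tau> a C"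
    and nm: "\<not> has_model' \<tau> (relsym v2 a) (vUN \<kappa> (vapp C)) M R"
    using x(2) unfolding Ctr_def by blast
  have \<tau>0: "mem \<tau> X0" "mem a X0" "mem C X0" using x0 by (simp_all add: x_eq V)
  have "mem \<langle>\<kappa>, \<langle>\<langle>\<tau>, a\<rangle>, C\<rangle>\<rangle> Wc" using mc \<tau>0 \<kappa>0 by (simp add: Wc V)
  from pres[OF this mX(6) jW(6)] have jmc: "model_chain M R (app j \<kappa>) (app j \<tau>) (app j a) (app j C)"
    using \<tau>0 \<kappa>0 by (simp add: jp2 V Wc)
  have j\<kappa>O: "Ordinal (app j \<kappa>)" using jmc unfolding model_chain_def by simp
  \<comment> \<open>Below \<open>\<kappa>\<close> everything is fixed, so \<open>j(\<kappa>) \<in> \<kappa>\<close> would give \<open>j(\<kappa>) \<in> j(\<kappa>)\<close> by applying \<open>j\<close>.\<close>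
  have \<kappa>j: "mem \<kappa> (app j \<kappa>)"
  proof -
    have "\<not> mem (app j \<kappa>) \<kappa>"
    proof
      assume lt: "mem (app j \<kappa>) \<kappa>"
      then have "mem (app j (app j \<kappa>)) (app j \<kappa>)"
        using j_mem[OF X0_X[OF jX0[OF \<kappa>0]] X0_X[OF \<kappa>0]] by simp
      then show False using fixd[OF lt] by simp
    qed
    then show ?thesis using Ordinal_linear[OF \<kappa>(2) j\<kappa>O] \<kappa>(3) by metis
  qed
  have voc: "Vocabulary \<tau>" and r: "mem (relsym v2 a) \<tau>" using mc unfolding model_chain_def by simp_all
  have voc': "Vocabulary (app j \<tau>)" using jmc unfolding model_chain_def by simp
  obtain Y where Y: "is_fun C \<kappa> Y" using mc unfolding model_chain_def by blast
  obtain Y' where Y': "is_fun (app j C) (app j \<kappa>) Y'" using jmc unfolding model_chain_def by blast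
  have "has_model' (app j \<tau>) (relsym v2 (app j a)) (vapp (app j C) \<kappa>) M R"
    using jmc \<kappa>j unfolding model_chain_def by blast
  then obtain A I f where I: "Structure (app j \<tau>) A I"
    and sat: "\<And>\<phi>. mem \<phi> (vapp (app j C) \<kappa>) \<Longrightarrow> Sat' (app j \<tau>) A I vempty \<phi> vempty"
    and f: "Bij f A M" "\<And>x y. mem x A \<Longrightarrow> mem y A \<Longrightarrow>
      mem (seq2 x y) (vapp I (relsym v2 (app j a))) \<longleftrightarrow> mem \<langle>vapp f x, vapp f y\<rangle> R"
    unfolding has_model'_def by blast
  interpret tgt: fo_structure "app j \<tau>" A I by unfold_locales (fact voc', fact I)
  define I' where "I' = vlam \<tau> (\<lambda>x. vapp I (vapp j x))"
  note ren = renamed_model[OF voc \<tau>0(1) voc' I, folded I'_def]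
  interpret src: fo_structure \<tau> A I' by unfold_locales (fact voc, fact ren(1))
  \<comment> \<open>If \<open>\<phi>\<close> is in the member of \<open>C\<close> with index \<open>\<beta> < \<kappa>\<close>, then \<open>j(\<phi>)\<close> is in the member of \<open>j(C)\<close> with index \<open>j(\<beta>) = \<beta>\<close>,
    and this is contained in the member with index \<open>\<kappa>\<close>.\<close>
  have "Sat' \<tau> A I' vempty \<phi> vempty" if "mem \<phi> (vUN \<kappa> (vapp C))" for \<phi>
  proof -
    have "mem \<phi> (vUN \<kappa> (vapp C))" by (fact that)
    then obtain \<beta> where \<beta>: "mem \<beta> \<kappa>" "mem \<phi> (vapp C \<beta>)" by (auto simp: mem_vUN DF_vapp1)
    then have \<phi>: "Form \<tau> vempty \<phi>" using mc voc unfolding model_chain_def by auto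
    have \<beta>j: "mem \<beta> (app j \<kappa>)" using Ordinal_trans[OF j\<kappa>O \<kappa>j \<beta>(1)] .
    have C\<beta>: "mem \<phi> (app C \<beta>)" using \<beta> vapp_app[OF Y] by simp
    have "mem \<langle>\<beta>, app C \<beta>\<rangle> C" using fun_pair[OF Y] \<beta>(1) by simp
    then have "mem \<langle>\<beta>, app C \<beta>\<rangle> X0" by (rule Univ_trans[OF X0(1) \<tau>0(3)])
    then have "mem (app C \<beta>) X0" by (simp add: V)
    then have "mem (app j \<phi>) (app j (app C \<beta>))"
      using j_mem[OF X0_X[OF ren(4)[OF \<phi>]] X0_X] C\<beta> by simp
    also have "app j (app C \<beta>) = app (app j C) (app j \<beta>)"
      using j_app[OF Y X0_X[OF \<tau>0(3)] Y' \<beta>(1)] by simp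
    also have "\<dots> = vapp (app j C) \<beta>" using vapp_app[OF Y' \<beta>j] fixd[OF \<beta>(1)] by simp
    finally have "mem (app j \<phi>) (vapp (app j C) \<kappa>)"
      using jmc \<kappa>j \<beta>(1) unfolding model_chain_def by blast
    then have "Sat (app j \<tau>) A I vempty (app j \<phi>) vempty" using sat tgt.Sat_eq by blast
    then show ?thesis using ren(3)[OF \<phi>] src.Sat_eq by blast
  qed
  moreover have "mem (seq2 x y) (vapp I' (relsym v2 a)) \<longleftrightarrow> mem \<langle>vapp f x, vapp f y\<rangle> R"
    if "mem x A" "mem y A" for x y
  proof -
    have "mem (relsym v2 a) X0" using Univ_trans[OF X0(1) \<tau>0(1) r] .
    then have jr: "app j (relsym v2 a) = relsym v2 (app j a)"
      by (simp add: relsym_def jp2 V j_nat)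
    have "mem (relsym v2 (app j a)) (app j \<tau>)" using jmc unfolding model_chain_def by simp
    then have "vapp I' (relsym v2 a) = vapp I (relsym v2 (app j a))"
      using ren(2)[OF r] src.vapp_I[OF r] tgt.vapp_I jr by simp
    then show ?thesis using f(2)[OF that] by simp
  qed
  ultimately have "has_model' \<tau> (relsym v2 a) (vUN \<kappa> (vapp C)) M R"
    unfolding has_model'_def using ren(1) f(1) by blast
  then show False using nm by blast
qed

section \<open>From chain compactness to elementary embeddings\<close>

lemma membership_reduct:
  fixes M A I \<tau> g :: "'a::ZF"
  assumes \<tau>: "Vocabulary \<tau>" "mem (relsym v2 vempty) \<tau>" and I: "Structure \<tau> A I" and g: "is_fun g M A"
    and inj: "\<And>x y. mem x M \<Longrightarrow> mem y M \<Longrightarrow> app g x = app g y \<Longrightarrow> x = y"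
    and surj: "\<And>z. mem z A \<Longrightarrow> \<exists>x. mem x M \<and> app g x = z"
    and rel: "\<And>x y. mem x M \<Longrightarrow> mem y M \<Longrightarrow>
      mem (seq2 (app g x) (app g y)) (app I (relsym v2 vempty)) \<longleftrightarrow> mem x y"
    and n: "Natural n" and \<phi>: "Form mem_voc n \<phi>"
  shows "Form \<tau> n \<phi>" and "is_fun s n M \<Longrightarrow> MSat M n \<phi> s \<longleftrightarrow> Sat \<tau> A I n \<phi> (vcomp g s)"
proof -
  interpret tgt: fo_structure \<tau> A I by unfold_locales (fact \<tau>(1), fact I)
  interpret src: fo_structure mem_voc M "mem_interp M" by (rule fo_structure_mem)
  interpret tr: fo_translation mem_voc M "mem_interp M" \<tau> A I "\<lambda>x. x" g
  proof
    show "\<exists>a'. relsym k a = relsym k a' \<and> mem (relsym k a') \<tau> \<and>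
      (\<forall>p. is_fun p k M \<longrightarrow> (mem p (app (mem_interp M) (relsym k a)) \<longleftrightarrow> mem (vcomp g p) (app I (relsym k a'))))"
      if r: "mem (relsym k a) mem_voc" for k a
    proof -
      have "mem p (mem_rel M) \<longleftrightarrow> mem (vcomp g p) (app I (relsym v2 vempty))" if p: "is_fun p v2 M" for p
      proof -
        have xy: "mem (app p vempty) M" "mem (app p v1) M" using fun_val[OF p] by simp_all
        have "mem (seq2 x y) (mem_rel M) \<longleftrightarrow> mem x y" if "mem x M" "mem y M" for x y
          using that by (auto simp: mem_mem_rel)
        then show ?thesis
          using rel[OF xy] xy vcomp_seq2[OF g xy] fun_v2[OF p] by metis
      qed
      then show ?thesis using r \<tau>(2) by auto
    qed
    show "DF (\<lambda>x::'a. x)" by (rule DF_id)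
  qed (use g inj surj in \<open>auto simp: vcomp_vlam_id\<close>)
  show "Form \<tau> n \<phi>" by (rule tr.h_Form[OF n \<phi>])
  show "is_fun s n M \<Longrightarrow> MSat M n \<phi> s \<longleftrightarrow> Sat \<tau> A I n \<phi> (vcomp g s)" by (rule tr.Sat_translate[OF n \<phi>])
qed

text \<open>
  The sentence is \<open>\<exists>v\<^sub>0. v\<^sub>0 = c\<^sub>0 \<and> (\<exists>v\<^sub>1. v\<^sub>1 = c\<^sub>1 \<and> \<dots> \<phi>)\<close>, where \<open>c\<^sub>i\<close> is the constant for the element \<open>s(i)\<close>. With de Bruijn
  levels \<open>\<phi>\<close> itself is left unchanged, so no substitution has to be defined. The induction removes the
  last free variable of \<open>\<phi>\<close>.
\<close>

lemma diagram_sentence: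
  fixes M \<tau> :: "'a::ZF"
  assumes \<tau>: "Vocabulary \<tau>" and con: "\<And>x. mem x M \<Longrightarrow> mem (consym x) \<tau>"
    and n: "Natural n" and "Form \<tau> n \<phi>" "is_fun s n M"
  obtains \<psi> where "Form \<tau> vempty \<psi>"
    "\<And>A I c. Structure \<tau> A I \<Longrightarrow> is_fun c M A \<Longrightarrow> (\<And>x. mem x M \<Longrightarrow> app c x = app I (consym x)) \<Longrightarrow>
      Sat \<tau> A I vempty \<psi> vempty \<longleftrightarrow> Sat \<tau> A I n \<phi> (vcomp c s)"
proof -
  \<comment> \<open>\<open>E n \<phi> s \<psi>\<close>: \<open>\<psi>\<close> expresses \<open>\<phi>\<close> at \<open>s\<close>. The total notions make \<open>E\<close> definable, so that induction applies.\<close>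
  define E where "E n \<phi> s \<psi> \<longleftrightarrow> Form (voc \<tau>) vempty \<psi> \<and> (\<forall>A I c. Structure \<tau> A I \<longrightarrow> is_fun c M A \<longrightarrow>
    (\<forall>x. mem x M \<longrightarrow> vapp c x = vapp I (consym x)) \<longrightarrow>
    (Sat' \<tau> A I vempty \<psi> vempty \<longleftrightarrow> Sat' \<tau> A I n \<phi> (vcomp c s)))" for n \<phi> s \<psi>
  have "D (\<lambda>n. \<forall>\<phi> s. Form (voc \<tau>) n \<phi> \<longrightarrow> is_fun s n M \<longrightarrow> (\<exists>\<psi>. E n \<phi> s \<psi>))"
    unfolding E_def by (intro D_intros)
  moreover have "mem n omega" using n by simp
  ultimately have "\<forall>\<phi> s. Form (voc \<tau>) n \<phi> \<longrightarrow> is_fun s n M \<longrightarrow> (\<exists>\<psi>. E n \<phi> s \<psi>)"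
  proof (induction rule: nat_induct)
    case zero
    show ?case
    proof (intro allI impI)
      fix \<phi> s assume \<phi>: "Form (voc \<tau>) vempty \<phi>" and s: "is_fun s vempty M"
      show "\<exists>\<psi>. E vempty \<phi> s \<psi>" using \<phi> fun_from_vempty[OF s] unfolding E_def by (intro exI[of _ \<phi>]) simp
    qed
  next
    case (succ n)
    then have n: "Natural n" by simp
    show ?case
    proof (intro allI impI)
      fix \<phi> s assume "Form (voc \<tau>) (vsucc n) \<phi>" and s: "is_fun s (vsucc n) M"
      then have \<phi>: "Form \<tau> (vsucc n) \<phi>" using \<tau> by simp
      define x where "x = app s n"
      define s0 where "s0 = vlam n (vapp s)"
      define e where "e = eq_fm (var_tm n) (con_tm (consym x))"
      have x: "mem x M" unfolding x_def using fun_val[OF s] by simp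
      have s0: "is_fun s0 n M" unfolding s0_def by (rule vlam_restrict[OF s]) simp
      have s_eq: "s = snoc s0 n x" unfolding s0_def x_def by (rule fun_vsucc_snoc[OF s])
      note n1 = Natural_vsucc[OF n]
      have tm: "mem (var_tm n) (Tms \<tau> (vsucc n))" "mem (con_tm (consym x)) (Tms \<tau> (vsucc n))"
        using Tms_var[OF \<tau>] Tms_con[OF \<tau> con[OF x]] by simp_all
      have e: "Form \<tau> (vsucc n) e" unfolding e_def by (rule Form_eq[OF n1 tm])
      have e\<phi>: "Form \<tau> (vsucc n) (and_fm e \<phi>)" by (rule Form_and[OF n1 e \<phi>])
      have "Form (voc \<tau>) n (ex_fm (and_fm e \<phi>))" using Form_ex[OF n e\<phi>] \<tau> by simp
      then obtain \<psi> where \<psi>: "E n (ex_fm (and_fm e \<phi>)) s0 \<psi>" using succ.IH s0 by blast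
      have "Sat' \<tau> A I n (ex_fm (and_fm e \<phi>)) (vcomp c s0) \<longleftrightarrow> Sat' \<tau> A I (vsucc n) \<phi> (vcomp c s)"
        if A: "Structure \<tau> A I" and c: "is_fun c M A" and cx: "vapp c x = vapp I (consym x)" for A I c
      proof -
        interpret fo_structure \<tau> A I by unfold_locales (fact \<tau>, fact A)
        have cs: "is_fun (vcomp c s0) n A" using vcomp_fun[OF s0 c] .
        have cx: "app c x = app I (consym x)"
          using cx vapp_app[OF c x] vapp_I[OF con[OF x]] by simp
        have "Sat \<tau> A I (vsucc n) e (snoc (vcomp c s0) n a) \<longleftrightarrow> a = app c x" if a: "mem a A" for a
          using tm by (simp add: e_def Sat_eq_fm[OF n1 snoc_fun[OF cs a]] eval_var[OF snoc_fun[OF cs a]]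
            eval_con[OF snoc_fun[OF cs a] con[OF x]] app_snoc[OF cs] cx)
        then have "Sat \<tau> A I n (ex_fm (and_fm e \<phi>)) (vcomp c s0) \<longleftrightarrow>
          (\<exists>a. mem a A \<and> a = app c x \<and> Sat \<tau> A I (vsucc n) \<phi> (snoc (vcomp c s0) n a))"
          by (simp add: Sat_ex_fm[OF n cs e\<phi>] Sat_and_fm[OF n1 snoc_fun[OF cs] e \<phi>] cong: conj_cong)
        also have "\<dots> \<longleftrightarrow> Sat \<tau> A I (vsucc n) \<phi> (vcomp c s)"
          using fun_val[OF c x] by (simp add: s_eq vcomp_snoc[OF s0 x c])
        finally show ?thesis by (simp add: Sat_eq)
      qed
      then have "E (vsucc n) \<phi> s \<psi>" using \<psi> x unfolding E_def by blast
      then show "\<exists>\<psi>. E (vsucc n) \<phi> s \<psi>" by blast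
    qed
  qed
  moreover have "Form (voc \<tau>) n \<phi>" using assms by simp
  ultimately obtain \<psi> where \<psi>: "E n \<phi> s \<psi>" using assms(5) by blast
  show ?thesis
  proof (rule that)
    show "Form \<tau> vempty \<psi>" using \<psi> \<tau> unfolding E_def by simp
    fix A I c assume A: "Structure \<tau> A I" and c: "is_fun c M A" and cx: "\<And>x. mem x M \<Longrightarrow> app c x = app I (consym x)"
    interpret fo_structure \<tau> A I by unfold_locales (fact \<tau>, fact A)
    have "vapp c x = vapp I (consym x)" if "mem x M" for x
      using cx[OF that] vapp_app[OF c that] vapp_I[OF con[OF that]] by simp
    then show "Sat \<tau> A I vempty \<psi> vempty \<longleftrightarrow> Sat \<tau> A I n \<phi> (vcomp c s)"
      using \<psi> A c unfolding E_def Sat_eq by blast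
  qed
qed

text \<open>
  The constant for \<open>M\<close>, which is not an element of \<open>M\<close>, plays the role of the additional constant \<open>d\<close>. In a
  model \<open>(A, J)\<close> of the union of the chain with an isomorphism \<open>f\<close> onto \<open>(M, \<in>)\<close>, the embedding maps \<open>x\<close> to the image under \<open>f\<close> of
  the interpretation of the constant for \<open>x\<close>.
\<close>

lemma chain_compact_gives_embedding:
  fixes M \<mu> :: "'a::ZF"
  assumes M: "Transitive M" "mem \<mu> M" and \<mu>: "InfCardinal \<mu>"
    and R: "\<And>p. mem p R \<longleftrightarrow> (\<exists>x y. mem x M \<and> mem y M \<and> mem x y \<and> p = \<langle>x, y\<rangle>)"
    and comp: "chain_compact fo_sentence fo_models \<mu> M R"
  obtains j \<xi> where "mem_emb M j" "mem \<xi> (vsucc \<mu>)" "app j \<xi> \<noteq> \<xi>"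
proof -
  have \<mu>O: "Ordinal \<mu>" using \<mu> unfolding InfCardinal_def Cardinal_def by simp
  have "mem vempty omega" by simp
  then have \<mu>0: "mem vempty \<mu>" using \<mu> unfolding InfCardinal_def by blast
  note \<mu>s = InfCardinal_limit[OF \<mu>]
  have \<mu>M: "mem \<gamma> M" if "mem \<gamma> \<mu>" for \<gamma> using M that unfolding Transitive_iff by blast
  let ?r = "relsym v2 vempty :: 'a"
  have "small {z. \<exists>x. mem x (vsucc M) \<and> z = consym x}" by (rule small_image_Collect) (intro D_intros)
  then obtain K where K: "\<And>z. mem z K \<longleftrightarrow> (\<exists>x. mem x (vsucc M) \<and> z = consym x)" using mem_vset by blast
  define \<tau> where "\<tau> = vinsert ?r K"
  have \<tau>: "mem z \<tau> \<longleftrightarrow> z = ?r \<or> z = consym M \<or> (\<exists>x. mem x M \<and> z = consym x)" for z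
    unfolding \<tau>_def by (auto simp: K)
  have voc: "Vocabulary \<tau>" unfolding Vocabulary_iff \<tau> by auto
  have r\<tau>: "mem ?r \<tau>" and con: "mem x M \<Longrightarrow> mem (consym x) \<tau>" and conM: "mem (consym M) \<tau>" for x
    by (auto simp: \<tau>)
  \<comment> \<open>\<open>I \<gamma>\<close> interprets the constant for \<open>x \<in> M\<close> by \<open>x\<close> and the additional constant by \<open>\<gamma>\<close>.\<close>
  define val where "val \<gamma> z = (if vfst z = v2 then (if vsnd z = M then \<gamma> else vsnd z) else mem_rel M)" for \<gamma> z
  have Dval: "DF (val \<gamma>)" for \<gamma> unfolding val_def by (intro D_intros)
  define I where "I \<gamma> = vlam \<tau> (val \<gamma>)" for \<gamma>
  have DI: "DF I" unfolding I_def val_def by (intro D_intros)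
  have MM: "x \<noteq> M" if "mem x M" for x using that by auto
  have appI: "app (I \<gamma>) ?r = mem_rel M" "app (I \<gamma>) (consym M) = \<gamma>" "mem x M \<Longrightarrow> app (I \<gamma>) (consym x) = x" for \<gamma> x
    using r\<tau> conM con[of x] MM[of x] by (simp_all add: I_def app_vlam[OF Dval]) (simp_all add: val_def relsym_def consym_def)
  have strI: "Structure \<tau> M (I \<gamma>)" if "mem \<gamma> M" for \<gamma>
    unfolding Structure_def mem_Collect_eq
  proof (intro conjI allI impI)
    show "\<exists>Y. is_fun (I \<gamma>) \<tau> Y" unfolding I_def by (rule vlam_fun_ex[OF Dval])
    show "elts (app (I \<gamma>) (relsym k a)) \<subseteq> elts (Pow_fun M k)" if "mem (relsym k a) \<tau>" for k a
      using that appI(1)[of \<gamma>] by (auto simp: \<tau> mem_mem_rel intro: seq2_fun)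
    show "is_fun (app (I \<gamma>) (funsym k a)) (Pow_fun M k) M" if "mem (funsym k a) \<tau>" for k a
      using that by (auto simp: \<tau>)
    show "mem (app (I \<gamma>) (consym a)) M" if "mem (consym a) \<tau>" for a
      using that \<open>mem \<gamma> M\<close> appI(2,3) by (auto simp: \<tau>)
  qed
  obtain X where X: "Univ X" "mem \<langle>omega, \<tau>\<rangle> X" using Univ_exists .
  have "closed_fm \<tau> X" using X voc by (intro Univ_closed_fm) (simp_all add: Univ_vpair)
  then have FX: "mem \<phi> X" if "Form \<tau> vempty \<phi>" for \<phi> using that X(1) unfolding Form_def by (auto simp: Univ_vpair)
  \<comment> \<open>\<open>P \<beta>\<close> defines the member with index \<open>\<beta>\<close> of the chain; its model of type \<open>(M, \<in>)\<close> is \<open>(M, I \<beta>)\<close>.\<close>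
  define P where "P \<beta> \<phi> \<longleftrightarrow> Form (voc \<tau>) vempty \<phi> \<and>
    (\<forall>\<gamma>. mem \<gamma> \<mu> \<longrightarrow> elts \<beta> \<subseteq> elts \<gamma> \<longrightarrow> Sat' \<tau> M (I \<gamma>) vempty \<phi> vempty)" for \<beta> \<phi>
  have DP: "D (P \<beta>)" "D (\<lambda>z. P (vfst z) (vsnd z))" for \<beta>
    unfolding P_def by (intro D_intros DI[THEN DF_comp])+
  define C where "C = vlam \<mu> (\<lambda>\<beta>. vsep X (P \<beta>))"
  have DC: "DF (\<lambda>\<beta>. vsep X (P \<beta>))" by (intro D_intros DP)
  have C: "mem \<phi> (vapp C \<beta>) \<longleftrightarrow> P \<beta> \<phi>" if "mem \<beta> \<mu>" for \<phi> \<beta>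
    using FX voc by (auto simp: C_def vapp_vlam[OF DC that] mem_vsep[OF DP(1)] P_def)
  have idB: "Bij (vlam M (\<lambda>x. x)) M M"
    unfolding Bij_def using vlam_id_fun by (auto simp: app_vlam[OF DF_id])
  have "model_chain M R \<mu> \<tau> vempty C" unfolding model_chain_def
  proof (intro conjI allI impI)
    show "\<exists>Y. is_fun C \<mu> Y" unfolding C_def by (rule vlam_fun_ex[OF DC])
    show "elts (vapp C \<gamma>) \<subseteq> elts (vapp C \<beta>)" if "mem \<beta> \<mu>" "mem \<gamma> \<beta>" for \<beta> \<gamma>
    proof -
      have "elts \<gamma> \<subseteq> elts \<beta>" using Ordinal_trans[OF Ordinal_mem[OF \<mu>O that(1)] that(2)] by blast
      then show ?thesis using C[OF that(1)] C[OF Ordinal_trans[OF \<mu>O that]] unfolding P_def by auto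
    qed
    show "Form (voc \<tau>) vempty \<phi>" if "mem \<beta> \<mu>" "mem \<phi> (vapp C \<beta>)" for \<beta> \<phi>
      using that C unfolding P_def by blast
    show "has_model' \<tau> ?r (vapp C \<beta>) M R" if \<beta>: "mem \<beta> \<mu>" for \<beta>
    proof -
      interpret fo_structure \<tau> M "I \<beta>" by unfold_locales (fact voc, rule strI[OF \<mu>M[OF \<beta>]])
      have "mem (seq2 x y) (vapp (I \<beta>) ?r) \<longleftrightarrow> mem \<langle>vapp (vlam M (\<lambda>x. x)) x, vapp (vlam M (\<lambda>x. x)) y\<rangle> R"
        if "mem x M" "mem y M" for x y
        using that by (auto simp: vapp_I[OF r\<tau>] appI mem_mem_rel R vapp_vlam[OF DF_id])
      moreover have "Sat' \<tau> M (I \<beta>) vempty \<phi> vempty" if "mem \<phi> (vapp C \<beta>)" for \<phi>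
        using that \<beta> unfolding C[OF \<beta>] P_def by blast
      ultimately show ?thesis unfolding has_model'_def using strI[OF \<mu>M[OF \<beta>]] idB by blast
    qed
  qed (use \<mu>O voc r\<tau> in auto)
  then have "has_model' \<tau> ?r (vUN \<mu> (vapp C)) M R"
    using comp chain_compact_iff[OF \<mu>O] by blast
  then obtain A J f where J: "Structure \<tau> A J" and sat': "\<And>\<phi>. mem \<phi> (vUN \<mu> (vapp C)) \<Longrightarrow> Sat' \<tau> A J vempty \<phi> vempty"
    and f: "Bij f A M" "\<And>x y. mem x A \<Longrightarrow> mem y A \<Longrightarrow> mem (seq2 x y) (vapp J ?r) \<longleftrightarrow> mem \<langle>vapp f x, vapp f y\<rangle> R"
    unfolding has_model'_def by blast
  interpret A: fo_structure \<tau> A J by unfold_locales (fact voc, fact J)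
  have sat: "Sat \<tau> A J vempty \<phi> vempty"
    if \<phi>: "Form \<tau> vempty \<phi>" and \<beta>: "mem \<beta> \<mu>"
      and true: "\<And>\<gamma>. mem \<gamma> \<mu> \<Longrightarrow> elts \<beta> \<subseteq> elts \<gamma> \<Longrightarrow> Sat \<tau> M (I \<gamma>) vempty \<phi> vempty" for \<phi> \<beta>
  proof -
    have "Sat' \<tau> M (I \<gamma>) vempty \<phi> vempty" if "mem \<gamma> \<mu>" "elts \<beta> \<subseteq> elts \<gamma>" for \<gamma>
    proof -
      interpret fo_structure \<tau> M "I \<gamma>" by unfold_locales (fact voc, rule strI[OF \<mu>M[OF that(1)]])
      show ?thesis using true[OF that] Sat_eq by simp
    qed
    then have "P \<beta> \<phi>" unfolding P_def using \<phi> voc by simp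
    then have "mem \<phi> (vUN \<mu> (vapp C))" using \<beta> C by (auto simp: mem_vUN DF_vapp1)
    then show ?thesis using sat' A.Sat_eq by blast
  qed
  have ff: "is_fun f A M" using f(1) unfolding Bij_def by simp
  obtain g where g: "is_fun g M A" and gf: "\<And>x. mem x A \<Longrightarrow> app g (app f x) = x" and fg: "\<And>y. mem y M \<Longrightarrow> app f (app g y) = y"
    using Bij_inverse[OF f(1)] by blast
  have relA: "mem (seq2 x y) (app J ?r) \<longleftrightarrow> mem (app f x) (app f y)" if "mem x A" "mem y A" for x y
    using f(2)[OF that] that fun_val[OF ff] by (auto simp: A.vapp_I[OF r\<tau>] vapp_app[OF ff] R)
  define c where "c = vlam M (\<lambda>x. vapp J (consym x))"
  have Dc: "DF (\<lambda>x. vapp J (consym x))" by (intro D_intros)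
  have app_c: "app c x = app J (consym x)" if "mem x M" for x
    unfolding c_def using that con[OF that] by (simp add: app_vlam[OF Dc] A.vapp_I)
  have c: "is_fun c M A"
    unfolding c_def by (rule vlam_fun[OF Dc]) (simp add: A.vapp_I con A.con_I)
  define j where "j = vcomp f c"
  have j: "is_fun j M M" unfolding j_def by (rule vcomp_fun[OF c ff])
  have app_j: "app j x = app f (app c x)" if "mem x M" for x unfolding j_def by (rule app_vcomp[OF c ff that])
  have gj: "vcomp g j = c"
    by (rule fun_ext[OF vcomp_fun[OF j g] c]) (simp add: app_vcomp[OF j g] app_j gf fun_val[OF c])
  \<comment> \<open>The diagram sentence of \<open>\<phi>\<close> and \<open>s\<close> does not mention \<open>d\<close>. So it or its negation holds in \<open>(M, I \<gamma>)\<close> for all \<open>\<gamma> < \<mu>\<close>, hence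
    belongs to the chain, hence holds in \<open>(A, J)\<close>.\<close>
  have emb: "mem_emb M j" unfolding mem_emb_def elem_emb_def
  proof (intro conjI ballI allI impI)
    show "is_fun j M M" by (rule j)
    fix n \<phi> s assume "n \<in> elts omega" and "Form mem_voc n \<phi> \<and> is_fun s n M"
    then have n: "Natural n" and \<phi>: "Form mem_voc n \<phi>" and s: "is_fun s n M" by auto
    have redI: "Form \<tau> n \<phi>" "MSat M n \<phi> s \<longleftrightarrow> Sat \<tau> M (I \<gamma>) n \<phi> s" if "mem \<gamma> \<mu>" for \<gamma>
    proof -
      note * = membership_reduct[OF voc r\<tau> strI[OF \<mu>M[OF that]] vlam_id_fun _ _ _ n \<phi>]
      show "Form \<tau> n \<phi>" by (rule *(1)) (auto simp: app_vlam[OF DF_id] appI mem_mem_rel)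
      have "MSat M n \<phi> s \<longleftrightarrow> Sat \<tau> M (I \<gamma>) n \<phi> (vcomp (vlam M (\<lambda>x. x)) s)"
        by (rule *(2)[OF _ _ _ s]) (auto simp: app_vlam[OF DF_id] appI mem_mem_rel)
      then show "MSat M n \<phi> s \<longleftrightarrow> Sat \<tau> M (I \<gamma>) n \<phi> s" by (simp add: vcomp_vlam_id[OF s])
    qed
    obtain \<psi> where \<psi>: "Form \<tau> vempty \<psi>" and sat_\<psi>: "\<And>A I c. Structure \<tau> A I \<Longrightarrow> is_fun c M A \<Longrightarrow>
      (\<And>x. mem x M \<Longrightarrow> app c x = app I (consym x)) \<Longrightarrow>
      Sat \<tau> A I vempty \<psi> vempty \<longleftrightarrow> Sat \<tau> A I n \<phi> (vcomp c s)"
      using diagram_sentence[OF voc con n redI(1)[OF \<mu>0] s] by blast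
    have \<psi>I: "Sat \<tau> M (I \<gamma>) vempty \<psi> vempty \<longleftrightarrow> MSat M n \<phi> s" if \<gamma>: "mem \<gamma> \<mu>" for \<gamma>
      using sat_\<psi>[OF strI[OF \<mu>M[OF \<gamma>]] vlam_id_fun] redI(2)[OF \<gamma>]
      by (simp add: appI app_vlam[OF DF_id] vcomp_vlam_id[OF s])
    have js: "is_fun (vcomp j s) n M" using vcomp_fun[OF s j] .
    have "MSat M n \<phi> (vcomp j s) \<longleftrightarrow> Sat \<tau> A J n \<phi> (vcomp g (vcomp j s))"
    proof (rule membership_reduct(2)[OF voc r\<tau> J g _ _ _ n \<phi> js])
      show "mem x M \<Longrightarrow> mem y M \<Longrightarrow> app g x = app g y \<Longrightarrow> x = y" for x y using fg by metis
      show "mem z A \<Longrightarrow> \<exists>x. mem x M \<and> app g x = z" for z using gf fun_val[OF ff] by blast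
      show "mem x M \<Longrightarrow> mem y M \<Longrightarrow> mem (seq2 (app g x) (app g y)) (app J ?r) \<longleftrightarrow> mem x y" for x y
        using relA fun_val[OF g] fg by simp
    qed
    also have "vcomp g (vcomp j s) = vcomp c s" using vcomp_assoc[OF s j g] gj by simp
    also have "Sat \<tau> A J n \<phi> (vcomp c s) \<longleftrightarrow> Sat \<tau> A J vempty \<psi> vempty"
      using sat_\<psi>[OF J c app_c] by simp
    also have "\<dots> \<longleftrightarrow> MSat M n \<phi> s"
    proof (cases "MSat M n \<phi> s")
      case True
      then show ?thesis using sat[OF \<psi> \<mu>0] \<psi>I by blast
    next
      case False
      have "Sat \<tau> A J vempty (neg_fm \<psi>) vempty"
      proof (rule sat[OF Form_neg[OF Natural_vempty \<psi>] \<mu>0])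
        fix \<gamma> assume \<gamma>: "mem \<gamma> \<mu>"
        interpret fo_structure \<tau> M "I \<gamma>" by unfold_locales (fact voc, rule strI[OF \<mu>M[OF \<gamma>]])
        show "Sat \<tau> M (I \<gamma>) vempty (neg_fm \<psi>) vempty"
          using False \<psi>I[OF \<gamma>] Sat_neg_fm[OF Natural_vempty fun_vempty \<psi>] by blast
      qed
      then show ?thesis using False A.Sat_neg_fm[OF Natural_vempty fun_vempty \<psi>] by blast
    qed
    finally show "MSat M n \<phi> s \<longleftrightarrow> MSat M n \<phi> (vcomp j s)" by simp
  qed

  define d where "d = app J (consym M)"
  have d: "mem d A" unfolding d_def by (rule A.con_I[OF conM])
  have tm: "mem (con_tm (consym M)) (Tms \<tau> vempty)" "mem x M \<Longrightarrow> mem (con_tm (consym x)) (Tms \<tau> vempty)" for x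
    using Tms_con[OF voc conM] Tms_con[OF voc con] by blast+
  let ?\<phi> = "rel_fm ?r (seq2 (con_tm (consym M)) (con_tm (consym \<mu>)))"
  have u: "is_fun (seq2 (con_tm (consym M)) (con_tm (consym \<mu>))) v2 (Tms \<tau> vempty)"
    using tm M(2) by (intro seq2_fun)
  have rel_val: "Sat \<tau> B K vempty ?\<phi> vempty \<longleftrightarrow> mem (seq2 (app K (consym M)) (app K (consym \<mu>))) (app K ?r)"
    if "Structure \<tau> B K" for B K
  proof -
    interpret fo_structure \<tau> B K by unfold_locales (fact voc, fact that)
    note e = eval_fun[OF fun_vempty]
    show ?thesis unfolding Sat_rel_fm[OF Natural_vempty fun_vempty r\<tau> u]
      using tm M(2) by (simp add: vcomp_seq2[OF e] eval_con[OF fun_vempty] conM con)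
  qed
  have "Sat \<tau> A J vempty ?\<phi> vempty"
  proof (rule sat[OF Form_rel[OF Natural_vempty r\<tau> u] \<mu>0])
    fix \<gamma> assume \<gamma>: "mem \<gamma> \<mu>"
    show "Sat \<tau> M (I \<gamma>) vempty ?\<phi> vempty"
      unfolding rel_val[OF strI[OF \<mu>M[OF \<gamma>]]] using \<gamma> \<mu>M[OF \<gamma>] M(2) by (auto simp: appI mem_mem_rel)
  qed
  then have d\<mu>: "mem (app f d) (app j \<mu>)"
    unfolding rel_val[OF J] using relA[OF d fun_val[OF c M(2)]] by (simp add: d_def app_j[OF M(2)] app_c[OF M(2)])
  \<comment> \<open>The sentence expressing that \<open>d\<close> differs from \<open>\<xi>\<close> is in the chain from index \<open>\<xi> + 1\<close> on, and this index is below the limit \<open>\<mu>\<close>.\<close>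
  have dj: "app f d \<noteq> app j \<xi>" if \<xi>: "mem \<xi> \<mu>" for \<xi>
  proof -
    let ?e = "eq_fm (con_tm (consym M)) (con_tm (consym \<xi>))"
    have \<xi>M: "mem \<xi> M" using \<mu>M[OF \<xi>] .
    have Fe: "Form \<tau> vempty ?e" using tm \<xi>M by (intro Form_eq Natural_vempty)
    have eq_val: "Sat \<tau> B K vempty (neg_fm ?e) vempty \<longleftrightarrow> app K (consym M) \<noteq> app K (consym \<xi>)"
      if "Structure \<tau> B K" for B K
    proof -
      interpret fo_structure \<tau> B K by unfold_locales (fact voc, fact that)
      show ?thesis unfolding Sat_neg_fm[OF Natural_vempty fun_vempty Fe]
        using tm \<xi>M by (simp add: Sat_eq_fm[OF Natural_vempty fun_vempty] eval_con[OF fun_vempty] conM con)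
    qed
    have "Sat \<tau> A J vempty (neg_fm ?e) vempty"
    proof (rule sat[OF Form_neg[OF Natural_vempty Fe] \<mu>s[OF \<xi>]])
      fix \<gamma> assume \<gamma>: "mem \<gamma> \<mu>" "elts (vsucc \<xi>) \<subseteq> elts \<gamma>"
      have "\<xi> \<in> elts (vsucc \<xi>)" by simp
      then have "\<xi> \<in> elts \<gamma>" using \<gamma>(2) by (rule rev_subsetD)
      then have "\<gamma> \<noteq> \<xi>" by auto
      then show "Sat \<tau> M (I \<gamma>) vempty (neg_fm ?e) vempty"
        unfolding eq_val[OF strI[OF \<mu>M[OF \<gamma>(1)]]] using \<xi>M by (simp add: appI)
    qed
    then have "d \<noteq> app c \<xi>" unfolding eq_val[OF J] by (simp add: d_def app_c[OF \<xi>M])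
    show ?thesis
    proof
      assume "app f d = app j \<xi>"
      then have "app g (app f d) = app g (app f (app c \<xi>))" using app_j[OF \<xi>M] by simp
      then show False using \<open>d \<noteq> app c \<xi>\<close> gf[OF d] gf[OF fun_val[OF c \<xi>M]] by simp
    qed
  qed
  have "\<exists>\<xi>. mem \<xi> (vsucc \<mu>) \<and> app j \<xi> \<noteq> \<xi>"
  proof (rule ccontr)
    assume "\<not> ?thesis"
    then have fixd: "app j \<xi> = \<xi>" if "\<xi> = \<mu> \<or> mem \<xi> \<mu>" for \<xi> using that by auto
    have "mem (app f d) \<mu>" using d\<mu> fixd[of \<mu>] by simp
    then show False using dj[of "app f d"] fixd[of "app f d"] by simp
  qed
  then show ?thesis using that emb by blast
qed

text \<open>
  The critical point is the least moved ordinal. It is at most \<open>\<mu> < l\<close>, and it is not \<open>0\<close> because the empty set is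
  definable.
\<close>

theorem chain_compact_imp_proto_Berkeley:
  fixes l :: "'a::ZF"
  assumes l: "Cardinal l"
    and comp: "\<And>M R. is_relation M R \<Longrightarrow> \<exists>\<mu>. mem \<mu> l \<and> InfCardinal \<mu> \<and> chain_compact fo_sentence fo_models \<mu> M R"
  shows "proto_Berkeley vempty l"
proof -
  have lO: "Ordinal l" using l unfolding Cardinal_def by simp
  have "mem vempty l"
  proof -
    have "is_relation vempty (vempty::'a)" unfolding is_relation_def by simp
    then obtain \<mu> where "mem \<mu> l" using comp by blast
    then show ?thesis using Ordinal_linear[OF Ordinal_vempty lO] mem_vempty by metis
  qed
  moreover have "\<exists>j \<kappa>. mem_emb M j \<and> is_crit M j \<kappa> \<and> mem vempty \<kappa> \<and> mem \<kappa> l"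
    if M: "Transitive M" "mem l M" for M
  proof -
    have "D (\<lambda>p. mem (vfst p) (vsnd p))" by (intro D_intros)
    from sep_ex[OF this, of "vprod M M"] obtain R
      where "\<And>p. mem p R \<longleftrightarrow> mem p (vprod M M) \<and> mem (vfst p) (vsnd p)" by blast
    then have R: "mem p R \<longleftrightarrow> (\<exists>x y. mem x M \<and> mem y M \<and> mem x y \<and> p = \<langle>x, y\<rangle>)" for p by auto
    have "is_relation M R" unfolding is_relation_def by (auto simp: R)
    then obtain \<mu> where \<mu>: "mem \<mu> l" "InfCardinal \<mu>" "chain_compact fo_sentence fo_models \<mu> M R" using comp by blast
    have \<mu>M: "mem \<mu> M" using M \<mu>(1) unfolding Transitive_iff by blast
    obtain j \<xi> where emb: "mem_emb M j" and \<xi>: "mem \<xi> (vsucc \<mu>)" "app j \<xi> \<noteq> \<xi>"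
      using chain_compact_gives_embedding[OF M(1) \<mu>M \<mu>(2) R \<mu>(3)] by blast
    interpret elementary M j by unfold_locales (rule emb)
    have \<mu>O: "Ordinal \<mu>" by (rule Ordinal_mem[OF lO \<mu>(1)])
    have \<xi>l: "mem \<xi> l" using \<xi>(1) \<mu>(1) Ordinal_trans[OF lO \<mu>(1)] by auto
    have lM: "mem x M" if "mem x l" for x using M that unfolding Transitive_iff by blast
    have "D (\<lambda>x. mem x M \<and> vapp j x \<noteq> x)" by (intro D_intros)
    moreover have "Ordinal \<xi>" by (rule Ordinal_mem[OF lO \<xi>l])
    moreover have "mem \<xi> M \<and> vapp j \<xi> \<noteq> \<xi>" using lM[OF \<xi>l] \<xi>(2) vapp_app[OF j_fun] by simp
    ultimately obtain \<kappa> where \<kappa>: "Ordinal \<kappa>" "mem \<kappa> M \<and> vapp j \<kappa> \<noteq> \<kappa>" "mem \<kappa> (vsucc \<xi>)"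
      and least: "\<And>x. mem x \<kappa> \<Longrightarrow> \<not> (mem x M \<and> vapp j x \<noteq> x)"
      by (rule Ordinal_least) blast
    have "mem \<kappa> l" using \<kappa>(3) \<xi>l Ordinal_trans[OF lO \<xi>l] by auto
    moreover have "is_crit M j \<kappa>"
      unfolding is_crit_def using \<kappa>(1,2) least vapp_app[OF j_fun] by auto
    moreover have "mem vempty \<kappa>"
    proof -
      have "\<kappa> \<noteq> vempty"
      proof
        assume \<kappa>0: "\<kappa> = vempty"
        then have m: "mem vempty M" using \<kappa>(2) by simp
        have "\<not> (\<exists>y. mem y M \<and> mem y (app j vempty))" using j_empty[OF m] by simp
        moreover have "mem y M" if "mem y (app j vempty)" for y
          using jM[OF m] that M(1) unfolding Transitive_iff by blast
        ultimately have "app j vempty = vempty" unfolding eq_vempty_iff by blast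
        then show False using \<kappa>(2) \<kappa>0 vapp_app[OF j_fun m] by simp
      qed
      then show ?thesis using Ordinal_linear[OF Ordinal_vempty \<kappa>(1)] mem_vempty by metis
    qed
    ultimately show ?thesis using emb by blast
  qed
  ultimately show ?thesis unfolding proto_Berkeley_def using l by auto
qed

section \<open>The equivalence\<close>

theorem theorem4p5:
  fixes l :: "'a::ZF"
  assumes "Cardinal l"
  shows "proto_Berkeley vempty l \<longleftrightarrow>
    (\<forall>M R. is_relation M R \<longrightarrow>
      (\<exists>\<mu>\<in>elts l. InfCardinal \<mu> \<and> chain_compact fo_sentence fo_models \<mu> M R))"
proof
  assume "proto_Berkeley vempty l"
  then show "\<forall>M R. is_relation M R \<longrightarrow>
      (\<exists>\<mu>\<in>elts l. InfCardinal \<mu> \<and> chain_compact fo_sentence fo_models \<mu> M R)"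
    using proto_Berkeley_imp_chain_compact[of l] by auto
next
  assume "\<forall>M R. is_relation M R \<longrightarrow>
      (\<exists>\<mu>\<in>elts l. InfCardinal \<mu> \<and> chain_compact fo_sentence fo_models \<mu> M R)"
  then show "proto_Berkeley vempty l"
    by (intro chain_compact_imp_proto_Berkeley[OF assms]) auto
qed

end
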